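(* Let $A/B$ be a QF ring extension such that $A$ is a generator as a right $B$-module, and let $E=\mathrm{End}\,A_B$. If the ring extension $\lambda: A\to E$, $\lambda_a(x)=ax$, is D2 (depth two), then $A/B$ is D2.
   Context: Rings are unital. $X^{(n)}$ denotes the direct sum of $n$ copies of $X$. For bimodules $X,Y$ over the same pair of rings, $X\,|\,Y$ means $X\oplus P\cong Y^{(n)}$ for some bimodule $P$ and some $n\in\mathbb{N}$, and $X\sim Y$ (similar) means $X\,|\,Y$ and $Y\,|\,X$. A ring extension $A/B$ is a unital ring homomorphism $B\to A$ (not necessarily injective), via which $A$ is a natural $B$-bimodule. $({}_BA)^*=\mathrm{Hom}({}_BA,{}_BB)$ is an $(A,B)$-bimodule via $(a\cdot f\cdot b)(x)=f(xa)b$, and $(A_B)^*=\mathrm{Hom}(A_B,B_B)$ is a $(B,A)$-bimodule via $(b\cdot g\cdot a)(x)=b\,g(ax)$. QF extension: $A/B$ is left QF if ${}_BA$ is finitely generated projective and $A\,|\,({}_BA)^*$ as $(A,B)$-bimodules; right QF if $A_B$ is finitely generated projective and $A\,|\,(A_B)^*$ as $(B,A)$-bimodules; QF if both left and right QF. Depth two: a ring extension $A/B$ is right D2 if $A\otimes_BA\sim A$ as natural $(A,B)$-bimodules, left D2 if $A\otimes_BA\sim A$ as natural $(B,A)$-bimodules, and D2 if it is both left and right D2. *)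

theory Defs
  imports "HOL-Algebra.Algebra"
begin

section \<open>Modules and bimodules over noncommutative rings\<close>

text \<open>The library locale \<^locale>\<open>module\<close> requires a commutative ring of scalars. The module
  records below extend the ring record, as in the library; their fields \<open>mult\<close> and \<open>one\<close>
  carry no meaning.\<close>

locale left_module = R?: ring R + M?: abelian_group M
  for R :: "('r, 'k) ring_scheme" (structure) and M :: "('r, 'm, 'l) module_scheme" (structure) +
  assumes smult_closed:
      "\<lbrakk>r \<in> carrier R; x \<in> carrier M\<rbrakk> \<Longrightarrow> r \<odot>\<^bsub>M\<^esub> x \<in> carrier M"
    and smult_l_distr:
      "\<lbrakk>r \<in> carrier R; s \<in> carrier R; x \<in> carrier M\<rbrakk>
        \<Longrightarrow> (r \<oplus>\<^bsub>R\<^esub> s) \<odot>\<^bsub>M\<^esub> x = r \<odot>\<^bsub>M\<^esub> x \<oplus>\<^bsub>M\<^esub> s \<odot>\<^bsub>M\<^esub> x"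
    and smult_r_distr:
      "\<lbrakk>r \<in> carrier R; x \<in> carrier M; y \<in> carrier M\<rbrakk>
        \<Longrightarrow> r \<odot>\<^bsub>M\<^esub> (x \<oplus>\<^bsub>M\<^esub> y) = r \<odot>\<^bsub>M\<^esub> x \<oplus>\<^bsub>M\<^esub> r \<odot>\<^bsub>M\<^esub> y"
    and smult_assoc:
      "\<lbrakk>r \<in> carrier R; s \<in> carrier R; x \<in> carrier M\<rbrakk>
        \<Longrightarrow> (r \<otimes>\<^bsub>R\<^esub> s) \<odot>\<^bsub>M\<^esub> x = r \<odot>\<^bsub>M\<^esub> (s \<odot>\<^bsub>M\<^esub> x)"
    and smult_one:
      "x \<in> carrier M \<Longrightarrow> \<one>\<^bsub>R\<^esub> \<odot>\<^bsub>M\<^esub> x = x"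

record ('r, 's, 'm) bimodule = "('r, 'm) module" +
  rsmult :: "'m \<Rightarrow> 's \<Rightarrow> 'm"  (infixl \<open>\<bullet>\<index>\<close> 70)

locale bimodule = left_module R M + S?: ring S
  for R :: "('r, 'k) ring_scheme" (structure) and S :: "('s, 'l) ring_scheme" (structure)
    and M :: "('r, 's, 'm, 'n) bimodule_scheme" (structure) +
  assumes rsmult_closed:
      "\<lbrakk>x \<in> carrier M; s \<in> carrier S\<rbrakk> \<Longrightarrow> x \<bullet>\<^bsub>M\<^esub> s \<in> carrier M"
    and rsmult_l_distr:
      "\<lbrakk>x \<in> carrier M; y \<in> carrier M; s \<in> carrier S\<rbrakk>
        \<Longrightarrow> (x \<oplus>\<^bsub>M\<^esub> y) \<bullet>\<^bsub>M\<^esub> s = x \<bullet>\<^bsub>M\<^esub> s \<oplus>\<^bsub>M\<^esub> y \<bullet>\<^bsub>M\<^esub> s"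
    and rsmult_r_distr:
      "\<lbrakk>x \<in> carrier M; s \<in> carrier S; t \<in> carrier S\<rbrakk>
        \<Longrightarrow> x \<bullet>\<^bsub>M\<^esub> (s \<oplus>\<^bsub>S\<^esub> t) = x \<bullet>\<^bsub>M\<^esub> s \<oplus>\<^bsub>M\<^esub> x \<bullet>\<^bsub>M\<^esub> t"
    and rsmult_assoc:
      "\<lbrakk>x \<in> carrier M; s \<in> carrier S; t \<in> carrier S\<rbrakk>
        \<Longrightarrow> x \<bullet>\<^bsub>M\<^esub> (s \<otimes>\<^bsub>S\<^esub> t) = (x \<bullet>\<^bsub>M\<^esub> s) \<bullet>\<^bsub>M\<^esub> t"
    and rsmult_one:
      "x \<in> carrier M \<Longrightarrow> x \<bullet>\<^bsub>M\<^esub> \<one>\<^bsub>S\<^esub> = x"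
    and smult_rsmult_assoc:
      "\<lbrakk>r \<in> carrier R; x \<in> carrier M; s \<in> carrier S\<rbrakk>
        \<Longrightarrow> (r \<odot>\<^bsub>M\<^esub> x) \<bullet>\<^bsub>M\<^esub> s = r \<odot>\<^bsub>M\<^esub> (x \<bullet>\<^bsub>M\<^esub> s)"

definition left_hom ::
  "('r, 'k) ring_scheme \<Rightarrow> ('r, 'm, 'x) module_scheme \<Rightarrow> ('r, 'n, 'y) module_scheme \<Rightarrow> ('m \<Rightarrow> 'n) set"
  where "left_hom R M N =
    {h \<in> carrier M \<rightarrow> carrier N.
      (\<forall>x\<in>carrier M. \<forall>y\<in>carrier M. h (x \<oplus>\<^bsub>M\<^esub> y) = h x \<oplus>\<^bsub>N\<^esub> h y) \<and>
      (\<forall>r\<in>carrier R. \<forall>x\<in>carrier M. h (r \<odot>\<^bsub>M\<^esub> x) = r \<odot>\<^bsub>N\<^esub> h x)}"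

definition right_hom ::
  "('s, 'k) ring_scheme \<Rightarrow> ('q, 's, 'm, 'x) bimodule_scheme \<Rightarrow> ('r, 's, 'n, 'y) bimodule_scheme
    \<Rightarrow> ('m \<Rightarrow> 'n) set"
  where "right_hom S M N =
    {h \<in> carrier M \<rightarrow> carrier N.
      (\<forall>x\<in>carrier M. \<forall>y\<in>carrier M. h (x \<oplus>\<^bsub>M\<^esub> y) = h x \<oplus>\<^bsub>N\<^esub> h y) \<and>
      (\<forall>x\<in>carrier M. \<forall>s\<in>carrier S. h (x \<bullet>\<^bsub>M\<^esub> s) = h x \<bullet>\<^bsub>N\<^esub> s)}"

definition bimodule_iso ::
  "('r, 'k) ring_scheme \<Rightarrow> ('s, 'l) ring_scheme \<Rightarrow> ('r, 's, 'm, 'x) bimodule_scheme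
    \<Rightarrow> ('r, 's, 'n, 'y) bimodule_scheme \<Rightarrow> ('m \<Rightarrow> 'n) set"
  where "bimodule_iso R S M N =
    {h \<in> left_hom R M N \<inter> right_hom S M N. bij_betw h (carrier M) (carrier N)}"


section \<open>Direct sums and similarity\<close>

definition direct_sum ::
  "('r, 's, 'm, 'x) bimodule_scheme \<Rightarrow> ('r, 's, 'n, 'y) bimodule_scheme \<Rightarrow> ('r, 's, 'm \<times> 'n) bimodule"
  where "direct_sum M N =
    \<lparr>carrier = carrier M \<times> carrier N,
     monoid.mult = undefined, one = undefined,
     ring.zero = (\<zero>\<^bsub>M\<^esub>, \<zero>\<^bsub>N\<^esub>),
     ring.add = (\<lambda>(x, y) (x', y'). (x \<oplus>\<^bsub>M\<^esub> x', y \<oplus>\<^bsub>N\<^esub> y')),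
     smult = (\<lambda>r (x, y). (r \<odot>\<^bsub>M\<^esub> x, r \<odot>\<^bsub>N\<^esub> y)),
     rsmult = (\<lambda>(x, y) s. (x \<bullet>\<^bsub>M\<^esub> s, y \<bullet>\<^bsub>N\<^esub> s))\<rparr>"

definition copies :: "nat \<Rightarrow> ('r, 's, 'm, 'x) bimodule_scheme \<Rightarrow> ('r, 's, nat \<Rightarrow> 'm) bimodule"
  where "copies n M =
    \<lparr>carrier = {..<n} \<rightarrow>\<^sub>E carrier M,
     monoid.mult = undefined, one = undefined,
     ring.zero = (\<lambda>i\<in>{..<n}. \<zero>\<^bsub>M\<^esub>),
     ring.add = (\<lambda>u v. \<lambda>i\<in>{..<n}. u i \<oplus>\<^bsub>M\<^esub> v i),
     smult = (\<lambda>r u. \<lambda>i\<in>{..<n}. r \<odot>\<^bsub>M\<^esub> u i),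
     rsmult = (\<lambda>u s. \<lambda>i\<in>{..<n}. u i \<bullet>\<^bsub>M\<^esub> s)\<rparr>"

text \<open>The complement \<open>P\<close> may be sought on the element type of \<open>copies n N\<close> without loss of
  generality: any such \<open>P\<close> embeds into \<open>copies n N\<close>.\<close>

definition bimodule_divides ::
  "('r, 'k) ring_scheme \<Rightarrow> ('s, 'l) ring_scheme \<Rightarrow> ('r, 's, 'm) bimodule
    \<Rightarrow> ('r, 's, 'n) bimodule \<Rightarrow> bool"
  where "bimodule_divides R S M N \<longleftrightarrow>
    (\<exists>n (P :: ('r, 's, nat \<Rightarrow> 'n) bimodule).
      bimodule R S P \<and> bimodule_iso R S (direct_sum M P) (copies n N) \<noteq> {})"

definition bimodule_similar ::
  "('r, 'k) ring_scheme \<Rightarrow> ('s, 'l) ring_scheme \<Rightarrow> ('r, 's, 'm) bimodule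
    \<Rightarrow> ('r, 's, 'n) bimodule \<Rightarrow> bool"
  where "bimodule_similar R S M N \<longleftrightarrow>
    bimodule_divides R S M N \<and> bimodule_divides R S N M"


section \<open>Tensor products\<close>

text \<open>For an \<open>(R,S)\<close>-bimodule \<open>M\<close> and an \<open>(S,T)\<close>-bimodule \<open>N\<close>, the \<open>(R,T)\<close>-bimodule
  \<open>M \<otimes>\<^sub>S N\<close> is the free abelian group on \<open>M \<times> N\<close> modulo the subgroup generated by the
  relations of biadditivity and \<open>S\<close>-balancedness; its elements are cosets of that subgroup.\<close>

definition tensor_relations ::
  "('s, 'k) ring_scheme \<Rightarrow> ('r, 's, 'm, 'x) bimodule_scheme \<Rightarrow> ('s, 't, 'n, 'y) bimodule_scheme
    \<Rightarrow> ('m \<times> 'n \<Rightarrow>\<^sub>0 int) set"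
  where "tensor_relations S M N =
    {frag_of (x \<oplus>\<^bsub>M\<^esub> x', y) - frag_of (x, y) - frag_of (x', y) | x x' y.
       x \<in> carrier M \<and> x' \<in> carrier M \<and> y \<in> carrier N} \<union>
    {frag_of (x, y \<oplus>\<^bsub>N\<^esub> y') - frag_of (x, y) - frag_of (x, y') | x y y'.
       x \<in> carrier M \<and> y \<in> carrier N \<and> y' \<in> carrier N} \<union>
    {frag_of (x \<bullet>\<^bsub>M\<^esub> s, y) - frag_of (x, s \<odot>\<^bsub>N\<^esub> y) | x s y.
       x \<in> carrier M \<and> s \<in> carrier S \<and> y \<in> carrier N}"

text \<open>Each of the two actions is applied to the generators \<open>(x, y)\<close> and extended additively. It
  maps the relation subgroup \<open>K\<close> into itself, hence a coset of \<open>K\<close> into a coset of \<open>K\<close>;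
  adding \<open>K\<close> yields all of the latter.\<close>

definition tensor_product ::
  "('s, 'k) ring_scheme \<Rightarrow> ('r, 's, 'm, 'x) bimodule_scheme \<Rightarrow> ('s, 't, 'n, 'y) bimodule_scheme
    \<Rightarrow> ('r, 't, ('m \<times> 'n \<Rightarrow>\<^sub>0 int) set) bimodule"
  where "tensor_product S M N =
    (let F = free_Abelian_group (carrier M \<times> carrier N);
         K = generate F (tensor_relations S M N)
     in \<lparr>carrier = carrier (F Mod K),
         monoid.mult = undefined, one = undefined,
         ring.zero = \<one>\<^bsub>F Mod K\<^esub>,
         ring.add = (\<otimes>\<^bsub>F Mod K\<^esub>),
         smult = (\<lambda>r C. K <#>\<^bsub>F\<^esub> frag_extend (\<lambda>(x, y). frag_of (r \<odot>\<^bsub>M\<^esub> x, y)) ` C),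
         rsmult = (\<lambda>C t. K <#>\<^bsub>F\<^esub> frag_extend (\<lambda>(x, y). frag_of (x, y \<bullet>\<^bsub>N\<^esub> t)) ` C)\<rparr>)"


section \<open>Finitely generated projective modules and generators\<close>

definition finitely_generated :: "('r, 'k) ring_scheme \<Rightarrow> ('r, 'm, 'x) module_scheme \<Rightarrow> bool"
  where "finitely_generated R M \<longleftrightarrow>
    (\<exists>G. finite G \<and> G \<subseteq> carrier M \<and>
      (\<forall>x\<in>carrier M. \<exists>c\<in>G \<rightarrow> carrier R. x = (\<Oplus>\<^bsub>M\<^esub>g\<in>G. c g \<odot>\<^bsub>M\<^esub> g)))"

text \<open>HOL cannot quantify over modules on all types. In the lifting property below, lifting the
  identity of \<open>P\<close> along the surjection onto \<open>P\<close> from the free module on its elements already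
  gives projectivity in the full sense, and that free module lives on \<open>'m \<Rightarrow> 'r\<close>.\<close>

definition projective :: "('r, 'k) ring_scheme \<Rightarrow> ('r, 'm, 'x) module_scheme \<Rightarrow> bool"
  where "projective R P \<longleftrightarrow>
    (\<forall>(M :: ('r, 'm \<Rightarrow> 'r) module) (N :: ('r, 'm) module). \<forall>p\<in>left_hom R M N. \<forall>f\<in>left_hom R P N.
      left_module R M \<longrightarrow> left_module R N \<longrightarrow> p ` carrier M = carrier N \<longrightarrow>
      (\<exists>h\<in>left_hom R P M. \<forall>x\<in>carrier P. p (h x) = f x))"

text \<open>A generator is a module \<open>G\<close> for which \<open>Hom(G, -)\<close> is faithful. Again the types of \<open>M\<close> and
  \<open>N\<close> are large enough: \<open>M = R\<close> and \<open>N\<close> the quotient of \<open>R\<close> by the trace ideal of \<open>G\<close>, whose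
  elements are cosets, suffice to conclude that the trace ideal is \<open>R\<close>.\<close>

definition generator :: "('r, 'k) ring_scheme \<Rightarrow> ('r, 'm, 'x) module_scheme \<Rightarrow> bool"
  where "generator R G \<longleftrightarrow>
    (\<forall>(M :: ('r, 'r) module) (N :: ('r, 'r set) module). \<forall>f\<in>left_hom R M N. \<forall>g\<in>left_hom R M N.
      left_module R M \<longrightarrow> left_module R N \<longrightarrow>
      (\<forall>h\<in>left_hom R G M. \<forall>z\<in>carrier G. f (h z) = g (h z)) \<longrightarrow>
      (\<forall>x\<in>carrier M. f x = g x))"

text \<open>Right \<open>S\<close>-modules are handled as left modules over the opposite ring.\<close>

definition opposite_ring :: "('r, 'k) ring_scheme \<Rightarrow> ('r, 'k) ring_scheme"
  where "opposite_ring R = R\<lparr>monoid.mult := (\<lambda>x y. y \<otimes>\<^bsub>R\<^esub> x)\<rparr>"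

definition right_as_left :: "('r, 's, 'm, 'x) bimodule_scheme \<Rightarrow> ('s, 'm) module"
  where "right_as_left M =
    \<lparr>carrier = carrier M, monoid.mult = undefined, one = undefined,
     ring.zero = \<zero>\<^bsub>M\<^esub>, ring.add = ring.add M, smult = (\<lambda>s x. x \<bullet>\<^bsub>M\<^esub> s)\<rparr>"

definition left_fg_projective :: "('r, 'k) ring_scheme \<Rightarrow> ('r, 's, 'm, 'x) bimodule_scheme \<Rightarrow> bool"
  where "left_fg_projective R M \<longleftrightarrow> finitely_generated R M \<and> projective R M"

definition right_fg_projective :: "('s, 'k) ring_scheme \<Rightarrow> ('r, 's, 'm, 'x) bimodule_scheme \<Rightarrow> bool"
  where "right_fg_projective S M \<longleftrightarrow>
    finitely_generated (opposite_ring S) (right_as_left M) \<and>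
    projective (opposite_ring S) (right_as_left M)"

definition right_generator :: "('s, 'k) ring_scheme \<Rightarrow> ('r, 's, 'm, 'x) bimodule_scheme \<Rightarrow> bool"
  where "right_generator S M \<longleftrightarrow> generator (opposite_ring S) (right_as_left M)"


section \<open>Ring extensions\<close>

locale ring_extension = A?: ring A + B?: ring B
  for A :: "('a, 'k) ring_scheme" (structure) and B :: "('b, 'l) ring_scheme" (structure)
    and \<phi> :: "'b \<Rightarrow> 'a" +
  assumes hom: "\<phi> \<in> ring_hom B A"

text \<open>\<open>A\<close> as an \<open>(R,S)\<close>-bimodule via ring homomorphisms \<open>f: R \<rightarrow> A\<close> and \<open>g: S \<rightarrow> A\<close>.\<close>

definition ring_bimodule ::
  "('a, 'k) ring_scheme \<Rightarrow> ('r \<Rightarrow> 'a) \<Rightarrow> ('s \<Rightarrow> 'a) \<Rightarrow> ('r, 's, 'a) bimodule"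
  where "ring_bimodule A f g =
    \<lparr>carrier = carrier A, monoid.mult = undefined, one = undefined,
     ring.zero = \<zero>\<^bsub>A\<^esub>, ring.add = ring.add A,
     smult = (\<lambda>r x. f r \<otimes>\<^bsub>A\<^esub> x), rsmult = (\<lambda>x s. x \<otimes>\<^bsub>A\<^esub> g s)\<rparr>"

text \<open>The duals of an \<open>(R,S)\<close>-bimodule \<open>M\<close>: \<open>Hom(\<^sub>RM, \<^sub>RR)\<close> is an \<open>(S,R)\<close>-bimodule with
  \<open>(s f r)(x) = f(x s) r\<close>, and \<open>Hom(M\<^sub>S, S\<^sub>S)\<close> is an \<open>(S,R)\<close>-bimodule with
  \<open>(s g r)(x) = s g(r x)\<close>. Homomorphisms are made extensional, so that they are determined by
  their values on \<open>M\<close>.\<close>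

definition left_dual ::
  "('r, 'k) ring_scheme \<Rightarrow> ('r, 's, 'm, 'x) bimodule_scheme \<Rightarrow> ('s, 'r, 'm \<Rightarrow> 'r) bimodule"
  where "left_dual R M =
    \<lparr>carrier = left_hom R M (ring_bimodule R id id) \<inter> extensional (carrier M),
     monoid.mult = undefined, one = undefined,
     ring.zero = (\<lambda>x\<in>carrier M. \<zero>\<^bsub>R\<^esub>),
     ring.add = (\<lambda>f g. \<lambda>x\<in>carrier M. f x \<oplus>\<^bsub>R\<^esub> g x),
     smult = (\<lambda>s f. \<lambda>x\<in>carrier M. f (x \<bullet>\<^bsub>M\<^esub> s)),
     rsmult = (\<lambda>f r. \<lambda>x\<in>carrier M. f x \<otimes>\<^bsub>R\<^esub> r)\<rparr>"

definition right_dual ::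
  "('s, 'k) ring_scheme \<Rightarrow> ('r, 's, 'm, 'x) bimodule_scheme \<Rightarrow> ('s, 'r, 'm \<Rightarrow> 's) bimodule"
  where "right_dual S M =
    \<lparr>carrier = right_hom S M (ring_bimodule S id id) \<inter> extensional (carrier M),
     monoid.mult = undefined, one = undefined,
     ring.zero = (\<lambda>x\<in>carrier M. \<zero>\<^bsub>S\<^esub>),
     ring.add = (\<lambda>f g. \<lambda>x\<in>carrier M. f x \<oplus>\<^bsub>S\<^esub> g x),
     smult = (\<lambda>s f. \<lambda>x\<in>carrier M. s \<otimes>\<^bsub>S\<^esub> f x),
     rsmult = (\<lambda>f r. \<lambda>x\<in>carrier M. f (r \<odot>\<^bsub>M\<^esub> x))\<rparr>"

definition left_QF :: "('a, 'k) ring_scheme \<Rightarrow> ('b, 'l) ring_scheme \<Rightarrow> ('b \<Rightarrow> 'a) \<Rightarrow> bool"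
  where "left_QF A B \<phi> \<longleftrightarrow>
    left_fg_projective B (ring_bimodule A \<phi> \<phi>) \<and>
    bimodule_divides A B (ring_bimodule A id \<phi>) (left_dual B (ring_bimodule A \<phi> id))"

definition right_QF :: "('a, 'k) ring_scheme \<Rightarrow> ('b, 'l) ring_scheme \<Rightarrow> ('b \<Rightarrow> 'a) \<Rightarrow> bool"
  where "right_QF A B \<phi> \<longleftrightarrow>
    right_fg_projective B (ring_bimodule A \<phi> \<phi>) \<and>
    bimodule_divides B A (ring_bimodule A \<phi> id) (right_dual B (ring_bimodule A id \<phi>))"

definition QF_extension :: "('a, 'k) ring_scheme \<Rightarrow> ('b, 'l) ring_scheme \<Rightarrow> ('b \<Rightarrow> 'a) \<Rightarrow> bool"
  where "QF_extension A B \<phi> \<longleftrightarrow> ring_extension A B \<phi> \<and> left_QF A B \<phi> \<and> right_QF A B \<phi>"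

definition right_D2 :: "('a, 'k) ring_scheme \<Rightarrow> ('b, 'l) ring_scheme \<Rightarrow> ('b \<Rightarrow> 'a) \<Rightarrow> bool"
  where "right_D2 A B \<phi> \<longleftrightarrow>
    bimodule_similar A B
      (tensor_product B (ring_bimodule A id \<phi>) (ring_bimodule A \<phi> \<phi>)) (ring_bimodule A id \<phi>)"

definition left_D2 :: "('a, 'k) ring_scheme \<Rightarrow> ('b, 'l) ring_scheme \<Rightarrow> ('b \<Rightarrow> 'a) \<Rightarrow> bool"
  where "left_D2 A B \<phi> \<longleftrightarrow>
    bimodule_similar B A
      (tensor_product B (ring_bimodule A \<phi> \<phi>) (ring_bimodule A \<phi> id)) (ring_bimodule A \<phi> id)"

definition D2_extension :: "('a, 'k) ring_scheme \<Rightarrow> ('b, 'l) ring_scheme \<Rightarrow> ('b \<Rightarrow> 'a) \<Rightarrow> bool"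
  where "D2_extension A B \<phi> \<longleftrightarrow> ring_extension A B \<phi> \<and> right_D2 A B \<phi> \<and> left_D2 A B \<phi>"

definition right_End ::
  "('s, 'k) ring_scheme \<Rightarrow> ('r, 's, 'm, 'x) bimodule_scheme \<Rightarrow> ('m \<Rightarrow> 'm) ring"
  where "right_End S M =
    \<lparr>carrier = right_hom S M M \<inter> extensional (carrier M),
     monoid.mult = (\<lambda>f g. compose (carrier M) f g),
     one = (\<lambda>x\<in>carrier M. x),
     ring.zero = (\<lambda>x\<in>carrier M. \<zero>\<^bsub>M\<^esub>),
     ring.add = (\<lambda>f g. \<lambda>x\<in>carrier M. f x \<oplus>\<^bsub>M\<^esub> g x)\<rparr>"

definition left_mult :: "('a, 'k) ring_scheme \<Rightarrow> 'a \<Rightarrow> 'a \<Rightarrow> 'a"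
  where "left_mult A a = (\<lambda>x\<in>carrier A. a \<otimes>\<^bsub>A\<^esub> x)"

end

theory Submission
  imports Defs
begin

text \<open>Divisibility \<open>X | Y\<close> means that \<open>id\<^sub>X\<close> is a finite sum of endomorphisms factoring through
  \<open>Y\<close>, hence is transitive and preserved by additive functors. Write \<open>A\<^sup>*\<close> for \<open>(A\<^sub>B)\<^sup>*\<close>. As \<open>A\<^sub>B\<close>
  is finitely generated projective, \<open>E \<cong> A \<otimes>\<^sub>B A\<^sup>*\<close>, and right QF gives \<open>A \<otimes>\<^sub>B A | E\<close> as
  \<open>(A,A)\<close>-bimodules.

  If \<open>E \<otimes>\<^sub>A E | E\<close> as \<open>(A,E)\<close>-bimodules, then applying \<open>- \<otimes>\<^sub>E A\<close> yields \<open>E | A\<close>, whence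
  \<open>A \<otimes>\<^sub>B A | E | A\<close> as \<open>(A,B)\<close>-bimodules.

  If \<open>E \<otimes>\<^sub>A E | E\<close> as \<open>(E,A)\<close>-bimodules, then applying \<open>A\<^sup>* \<otimes>\<^sub>E -\<close> yields \<open>A\<^sup>* \<otimes>\<^sub>A E | A\<^sup>*\<close>. Now
  \<open>A \<otimes>\<^sub>B A | A\<^sup>* \<otimes>\<^sub>A (A \<otimes>\<^sub>B A) | A\<^sup>* \<otimes>\<^sub>A E\<close>, and left QF dualizes to \<open>A\<^sup>* | A\<close>; together,
  \<open>A \<otimes>\<^sub>B A | A\<close> as \<open>(B,A)\<close>-bimodules.\<close>

section \<open>Additive maps and bimodule homomorphisms\<close>

text \<open>Right QF enters twice. Besides \<open>A \<otimes>\<^sub>B A | E\<close> it gives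
  \<open>A | D\<close>, where \<open>D\<close> is the dual of \<open>A\<^sub>B\<close>. Tensoring
  this over \<open>A\<close> with the tensor square yields \<open>A \<otimes>\<^sub>B A | D
  \<otimes>\<^sub>A (A \<otimes>\<^sub>B A)\<close>, so the second half carries two QF indices
  besides the depth two index. Dualizing left QF works because \<open>\<^sub>BA\<close>, being
  finitely generated projective, is its own double dual.

  No functor and no iterated tensor product is formed: these would live on ever larger types and
  need associativity isomorphisms. Every functor is applied to explicit maps and the result is
  written as a formula on elements. The isomorphism of \<open>E\<close> with
  \<open>A \<otimes>\<^sub>B D\<close> is present only through its two directions,
  \<open>a \<otimes> \<beta>\<close> to the map \<open>x \<mapsto> a \<phi>(\<beta> x)\<close>, and
  \<open>e\<close> to the sum of \<open>e(j) \<otimes> \<alpha> j\<close> over a dual basis, each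
  composed at once with the maps from right QF. A map out of \<open>E\<close> that is linear over
  \<open>E\<close> on one side is determined by its value at the unit; this is how
  \<open>- \<otimes>\<^sub>E A\<close> and \<open>D \<otimes>\<^sub>E -\<close> turn into
  evaluations.\<close>

definition additive_maps :: "('m, 'x) ring_scheme \<Rightarrow> ('n, 'y) ring_scheme \<Rightarrow> ('m \<Rightarrow> 'n) set"
  where "additive_maps M N =
    {h \<in> carrier M \<rightarrow> carrier N.
      \<forall>x\<in>carrier M. \<forall>y\<in>carrier M. h (x \<oplus>\<^bsub>M\<^esub> y) = h x \<oplus>\<^bsub>N\<^esub> h y}"

lemma additive_mapsI:
  assumes "\<And>x. x \<in> carrier M \<Longrightarrow> h x \<in> carrier N"
    and "\<And>x y. \<lbrakk>x \<in> carrier M; y \<in> carrier M\<rbrakk> \<Longrightarrow> h (x \<oplus>\<^bsub>M\<^esub> y) = h x \<oplus>\<^bsub>N\<^esub> h y"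
  shows "h \<in> additive_maps M N"
  using assms by (auto simp: additive_maps_def)

lemma additive_maps_closed:
  "\<lbrakk>h \<in> additive_maps M N; x \<in> carrier M\<rbrakk> \<Longrightarrow> h x \<in> carrier N"
  by (auto simp: additive_maps_def)

lemma additive_maps_add:
  "\<lbrakk>h \<in> additive_maps M N; x \<in> carrier M; y \<in> carrier M\<rbrakk> \<Longrightarrow> h (x \<oplus>\<^bsub>M\<^esub> y) = h x \<oplus>\<^bsub>N\<^esub> h y"
  by (auto simp: additive_maps_def)

lemma additive_maps_zero:
  assumes "abelian_group M" "abelian_group N" "h \<in> additive_maps M N"
  shows "h \<zero>\<^bsub>M\<^esub> = \<zero>\<^bsub>N\<^esub>"
proof -
  interpret M: abelian_group M by fact
  interpret N: abelian_group N by fact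
  have "h \<zero>\<^bsub>M\<^esub> \<oplus>\<^bsub>N\<^esub> h \<zero>\<^bsub>M\<^esub> = h \<zero>\<^bsub>M\<^esub>"
    using additive_maps_add[OF assms(3) M.zero_closed M.zero_closed] by simp
  then show ?thesis
    using additive_maps_closed[OF assms(3) M.zero_closed] N.add.l_cancel_one by blast
qed

lemma additive_maps_minus:
  assumes "abelian_group M" "abelian_group N" "h \<in> additive_maps M N" "x \<in> carrier M"
  shows "h (\<ominus>\<^bsub>M\<^esub> x) = \<ominus>\<^bsub>N\<^esub> h x"
proof -
  interpret M: abelian_group M by fact
  interpret N: abelian_group N by fact
  have "h (\<ominus>\<^bsub>M\<^esub> x) \<oplus>\<^bsub>N\<^esub> h x = \<zero>\<^bsub>N\<^esub>"
    using additive_maps_add[OF assms(3), of "\<ominus>\<^bsub>M\<^esub> x" x] additive_maps_zero[OF assms(1-3)] assms(4)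
    by (simp add: M.l_neg)
  then show ?thesis
    using additive_maps_closed[OF assms(3)] assms(4)
    by (simp add: N.minus_equality)
qed

lemma additive_maps_finsum:
  assumes "abelian_group M" "abelian_group N" "h \<in> additive_maps M N" "f \<in> I \<rightarrow> carrier M"
  shows "h (finsum M f I) = finsum N (\<lambda>i. h (f i)) I"
proof -
  interpret M: abelian_group M by fact
  interpret N: abelian_group N by fact
  note hc = additive_maps_closed[OF assms(3)]
  show ?thesis
    using assms(4)
  proof (induction I rule: infinite_finite_induct)
    case (infinite I)
    then show ?case
      by (simp add: M.finsum_infinite N.finsum_infinite additive_maps_zero[OF assms(1-3)])
  next
    case empty
    then show ?case by (simp add: additive_maps_zero[OF assms(1-3)])
  next
    case (insert i I)
    then have "f \<in> I \<rightarrow> carrier M" "f i \<in> carrier M" by auto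
    moreover from this have "(\<lambda>i. h (f i)) \<in> I \<rightarrow> carrier N" using hc by auto
    ultimately show ?case
      using insert by (simp add: M.finsum_insert N.finsum_insert additive_maps_add[OF assms(3)] hc)
  qed
qed

text \<open>An infinite \<open>J\<close> is allowed because \<open>finsum\<close> over an infinite
  set is zero, so that both sides vanish.\<close>

lemma (in abelian_group) finsum_swap:
  assumes "finite I" "\<And>i j. \<lbrakk>i \<in> I; j \<in> J\<rbrakk> \<Longrightarrow> f i j \<in> carrier G"
  shows "(\<Oplus>i\<in>I. \<Oplus>j\<in>J. f i j) = (\<Oplus>j\<in>J. \<Oplus>i\<in>I. f i j)"
  using assms
proof (induction I rule: finite_induct)
  case empty
  then show ?case by simp
next
  case (insert k I)
  have "(\<Oplus>i\<in>insert k I. \<Oplus>j\<in>J. f i j) = (\<Oplus>j\<in>J. f k j) \<oplus> (\<Oplus>j\<in>J. \<Oplus>i\<in>I. f i j)"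
    using insert by (subst finsum_insert) (auto intro!: finsum_closed)
  also have "\<dots> = (\<Oplus>j\<in>J. f k j \<oplus> (\<Oplus>i\<in>I. f i j))"
    using insert.prems by (intro finsum_addf[symmetric]) (auto intro!: finsum_closed)
  also have "\<dots> = (\<Oplus>j\<in>J. \<Oplus>i\<in>insert k I. f i j)"
  proof (intro finsum_cong' refl)
    fix j assume j: "j \<in> J"
    show "f k j \<oplus> (\<Oplus>i\<in>I. f i j) = (\<Oplus>i\<in>insert k I. f i j)"
      using insert.prems insert.hyps j by (subst finsum_insert) auto
  qed (use insert.prems in \<open>auto intro!: finsum_closed\<close>)
  finally show ?case .
qed

section \<open>Homomorphisms of bimodules\<close>

abbreviation bimodule_hom ::
  "('r, 'k) ring_scheme \<Rightarrow> ('s, 'l) ring_scheme \<Rightarrow> ('r, 's, 'm, 'x) bimodule_scheme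
    \<Rightarrow> ('r, 's, 'n, 'y) bimodule_scheme \<Rightarrow> ('m \<Rightarrow> 'n) set"
  where "bimodule_hom R S M N \<equiv> left_hom R M N \<inter> right_hom S M N"

lemma left_hom_additive: "h \<in> left_hom R M N \<Longrightarrow> h \<in> additive_maps M N"
  by (auto simp: left_hom_def additive_maps_def)

lemma left_hom_smult:
  "\<lbrakk>h \<in> left_hom R M N; r \<in> carrier R; x \<in> carrier M\<rbrakk> \<Longrightarrow> h (r \<odot>\<^bsub>M\<^esub> x) = r \<odot>\<^bsub>N\<^esub> h x"
  by (auto simp: left_hom_def)

lemma right_hom_rsmult:
  "\<lbrakk>h \<in> right_hom S M N; x \<in> carrier M; s \<in> carrier S\<rbrakk> \<Longrightarrow> h (x \<bullet>\<^bsub>M\<^esub> s) = h x \<bullet>\<^bsub>N\<^esub> s"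
  by (auto simp: right_hom_def)

lemma left_homI:
  assumes "h \<in> additive_maps M N"
    and "\<And>r x. \<lbrakk>r \<in> carrier R; x \<in> carrier M\<rbrakk> \<Longrightarrow> h (r \<odot>\<^bsub>M\<^esub> x) = r \<odot>\<^bsub>N\<^esub> h x"
  shows "h \<in> left_hom R M N"
  using assms by (auto simp: left_hom_def additive_maps_def)

lemma right_homI:
  assumes "h \<in> additive_maps M N"
    and "\<And>x s. \<lbrakk>x \<in> carrier M; s \<in> carrier S\<rbrakk> \<Longrightarrow> h (x \<bullet>\<^bsub>M\<^esub> s) = h x \<bullet>\<^bsub>N\<^esub> s"
  shows "h \<in> right_hom S M N"
  using assms by (auto simp: right_hom_def additive_maps_def)

lemma bimodule_homI:
  assumes "h \<in> additive_maps M N"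
    and "\<And>r x. \<lbrakk>r \<in> carrier R; x \<in> carrier M\<rbrakk> \<Longrightarrow> h (r \<odot>\<^bsub>M\<^esub> x) = r \<odot>\<^bsub>N\<^esub> h x"
    and "\<And>x s. \<lbrakk>x \<in> carrier M; s \<in> carrier S\<rbrakk> \<Longrightarrow> h (x \<bullet>\<^bsub>M\<^esub> s) = h x \<bullet>\<^bsub>N\<^esub> s"
  shows "h \<in> bimodule_hom R S M N"
  using assms by (auto intro: left_homI right_homI)

lemma bimodule_hom_comp:
  assumes "f \<in> bimodule_hom R S M N" "g \<in> bimodule_hom R S N L"
  shows "(\<lambda>x. g (f x)) \<in> bimodule_hom R S M L"
  using assms by (auto simp: left_hom_def right_hom_def Pi_def)

lemma bimodule_abelian_group: "bimodule R S M \<Longrightarrow> abelian_group M"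
  by (simp add: bimodule_def left_module_def)

lemma bimoduleI:
  assumes "ring R" "ring S" "abelian_group M"
    and "\<And>r x. \<lbrakk>r \<in> carrier R; x \<in> carrier M\<rbrakk> \<Longrightarrow> r \<odot>\<^bsub>M\<^esub> x \<in> carrier M"
    and "\<And>r s x. \<lbrakk>r \<in> carrier R; s \<in> carrier R; x \<in> carrier M\<rbrakk>
        \<Longrightarrow> (r \<oplus>\<^bsub>R\<^esub> s) \<odot>\<^bsub>M\<^esub> x = r \<odot>\<^bsub>M\<^esub> x \<oplus>\<^bsub>M\<^esub> s \<odot>\<^bsub>M\<^esub> x"
    and "\<And>r x y. \<lbrakk>r \<in> carrier R; x \<in> carrier M; y \<in> carrier M\<rbrakk>
        \<Longrightarrow> r \<odot>\<^bsub>M\<^esub> (x \<oplus>\<^bsub>M\<^esub> y) = r \<odot>\<^bsub>M\<^esub> x \<oplus>\<^bsub>M\<^esub> r \<odot>\<^bsub>M\<^esub> y"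
    and "\<And>r s x. \<lbrakk>r \<in> carrier R; s \<in> carrier R; x \<in> carrier M\<rbrakk>
        \<Longrightarrow> (r \<otimes>\<^bsub>R\<^esub> s) \<odot>\<^bsub>M\<^esub> x = r \<odot>\<^bsub>M\<^esub> (s \<odot>\<^bsub>M\<^esub> x)"
    and "\<And>x. x \<in> carrier M \<Longrightarrow> \<one>\<^bsub>R\<^esub> \<odot>\<^bsub>M\<^esub> x = x"
    and "\<And>x s. \<lbrakk>x \<in> carrier M; s \<in> carrier S\<rbrakk> \<Longrightarrow> x \<bullet>\<^bsub>M\<^esub> s \<in> carrier M"
    and "\<And>x y s. \<lbrakk>x \<in> carrier M; y \<in> carrier M; s \<in> carrier S\<rbrakk>
        \<Longrightarrow> (x \<oplus>\<^bsub>M\<^esub> y) \<bullet>\<^bsub>M\<^esub> s = x \<bullet>\<^bsub>M\<^esub> s \<oplus>\<^bsub>M\<^esub> y \<bullet>\<^bsub>M\<^esub> s"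
    and "\<And>x s t. \<lbrakk>x \<in> carrier M; s \<in> carrier S; t \<in> carrier S\<rbrakk>
        \<Longrightarrow> x \<bullet>\<^bsub>M\<^esub> (s \<oplus>\<^bsub>S\<^esub> t) = x \<bullet>\<^bsub>M\<^esub> s \<oplus>\<^bsub>M\<^esub> x \<bullet>\<^bsub>M\<^esub> t"
    and "\<And>x s t. \<lbrakk>x \<in> carrier M; s \<in> carrier S; t \<in> carrier S\<rbrakk>
        \<Longrightarrow> x \<bullet>\<^bsub>M\<^esub> (s \<otimes>\<^bsub>S\<^esub> t) = (x \<bullet>\<^bsub>M\<^esub> s) \<bullet>\<^bsub>M\<^esub> t"
    and "\<And>x. x \<in> carrier M \<Longrightarrow> x \<bullet>\<^bsub>M\<^esub> \<one>\<^bsub>S\<^esub> = x"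
    and "\<And>r x s. \<lbrakk>r \<in> carrier R; x \<in> carrier M; s \<in> carrier S\<rbrakk>
        \<Longrightarrow> (r \<odot>\<^bsub>M\<^esub> x) \<bullet>\<^bsub>M\<^esub> s = r \<odot>\<^bsub>M\<^esub> (x \<bullet>\<^bsub>M\<^esub> s)"
  shows "bimodule R S M"
  unfolding bimodule_def bimodule_axioms_def left_module_def left_module_axioms_def
  using assms by blast

lemma bimodule_smult_additive:
  assumes "bimodule R S M" "r \<in> carrier R"
  shows "(\<lambda>x. r \<odot>\<^bsub>M\<^esub> x) \<in> additive_maps M M"
proof -
  interpret bimodule R S M by fact
  show ?thesis by (rule additive_mapsI) (simp_all add: assms(2) smult_closed smult_r_distr)
qed

lemma bimodule_rsmult_additive:
  assumes "bimodule R S M" "s \<in> carrier S"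
  shows "(\<lambda>x. x \<bullet>\<^bsub>M\<^esub> s) \<in> additive_maps M M"
proof -
  interpret bimodule R S M by fact
  show ?thesis by (rule additive_mapsI) (simp_all add: assms(2) rsmult_closed rsmult_l_distr)
qed


section \<open>Divisibility of bimodules as factorization of the identity\<close>

lemma copies_simps:
  "carrier (copies n M) = {..<n} \<rightarrow>\<^sub>E carrier M"
  "\<zero>\<^bsub>copies n M\<^esub> = (\<lambda>i\<in>{..<n}. \<zero>\<^bsub>M\<^esub>)"
  "u \<oplus>\<^bsub>copies n M\<^esub> v = (\<lambda>i\<in>{..<n}. u i \<oplus>\<^bsub>M\<^esub> v i)"
  "r \<odot>\<^bsub>copies n M\<^esub> u = (\<lambda>i\<in>{..<n}. r \<odot>\<^bsub>M\<^esub> u i)"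
  "u \<bullet>\<^bsub>copies n M\<^esub> s = (\<lambda>i\<in>{..<n}. u i \<bullet>\<^bsub>M\<^esub> s)"
  by (simp_all add: copies_def)

lemma direct_sum_simps:
  "carrier (direct_sum M N) = carrier M \<times> carrier N"
  "\<zero>\<^bsub>direct_sum M N\<^esub> = (\<zero>\<^bsub>M\<^esub>, \<zero>\<^bsub>N\<^esub>)"
  "(x, y) \<oplus>\<^bsub>direct_sum M N\<^esub> (x', y') = (x \<oplus>\<^bsub>M\<^esub> x', y \<oplus>\<^bsub>N\<^esub> y')"
  "r \<odot>\<^bsub>direct_sum M N\<^esub> (x, y) = (r \<odot>\<^bsub>M\<^esub> x, r \<odot>\<^bsub>N\<^esub> y)"
  "(x, y) \<bullet>\<^bsub>direct_sum M N\<^esub> s = (x \<bullet>\<^bsub>M\<^esub> s, y \<bullet>\<^bsub>N\<^esub> s)"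
  by (simp_all add: direct_sum_def)

lemma bimodule_copies:
  fixes M :: "('r, 's, 'm, 'x) bimodule_scheme"
  assumes "bimodule R S M"
  shows "bimodule R S (copies n M)"
proof -
  interpret M: bimodule R S M by fact
  let ?C = "copies n M"
  have eqI: "u = v" if "u \<in> extensional {..<n}" "v \<in> extensional {..<n}" "\<And>i. i < n \<Longrightarrow> u i = v i"
    for u v :: "nat \<Rightarrow> 'm"
    using that by (auto intro: extensionalityI)
  have ag: "abelian_group (?C)"
  proof (rule abelian_groupI)
    fix x assume x: "x \<in> carrier (?C)"
    show "\<exists>y\<in>carrier (?C). y \<oplus>\<^bsub>?C\<^esub> x = \<zero>\<^bsub>?C\<^esub>"
      by (rule bexI[of _ "\<lambda>i\<in>{..<n}. \<ominus>\<^bsub>M\<^esub> x i"], rule eqI)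
        (use x in \<open>auto simp: copies_simps PiE_iff M.M.l_neg\<close>)
  next
    fix x y z assume "x \<in> carrier (?C)" "y \<in> carrier (?C)" "z \<in> carrier (?C)"
    then show "(x \<oplus>\<^bsub>?C\<^esub> y) \<oplus>\<^bsub>?C\<^esub> z = x \<oplus>\<^bsub>?C\<^esub> (y \<oplus>\<^bsub>?C\<^esub> z)"
      by (intro eqI) (simp_all add: copies_simps PiE_iff M.M.a_assoc)
  next
    fix x y assume "x \<in> carrier (?C)" "y \<in> carrier (?C)"
    then show "x \<oplus>\<^bsub>?C\<^esub> y = y \<oplus>\<^bsub>?C\<^esub> x"
      by (intro eqI) (simp_all add: copies_simps PiE_iff M.M.a_comm)
  next
    fix x assume "x \<in> carrier (?C)"
    then show "\<zero>\<^bsub>?C\<^esub> \<oplus>\<^bsub>?C\<^esub> x = x"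
      by (intro eqI) (simp_all add: copies_simps PiE_iff)
  qed (auto simp: copies_simps PiE_iff)
  show ?thesis
  proof (rule bimoduleI[OF _ _ ag])
    show "ring R" "ring S" by (fact M.R.ring_axioms M.S.ring_axioms)+
  qed ((auto simp: copies_simps PiE_iff M.smult_closed M.rsmult_closed; fail) |
      (rule eqI; simp add: copies_simps PiE_iff M.smult_closed M.smult_l_distr M.smult_r_distr
        M.smult_assoc M.smult_one M.rsmult_closed M.rsmult_l_distr M.rsmult_r_distr M.rsmult_assoc
        M.rsmult_one M.smult_rsmult_assoc))+
qed

text \<open>The finite sums of composites \<open>M \<rightarrow> N \<rightarrow> M\<close>. The
  inductive form allows sums to be built by induction, without merging two indexed families. Members
  are functions on the whole type, so membership is not stable under changes off the carrier; the
  closure properties below therefore assert a member that agrees on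
  \<open>carrier M\<close>.\<close>

inductive factors ::
  "('r, 'k) ring_scheme \<Rightarrow> ('s, 'l) ring_scheme \<Rightarrow> ('r, 's, 'm, 'x) bimodule_scheme
    \<Rightarrow> ('r, 's, 'n, 'y) bimodule_scheme \<Rightarrow> ('m \<Rightarrow> 'm) \<Rightarrow> bool"
  for R S M N where
  zero: "factors R S M N (\<lambda>x. \<zero>\<^bsub>M\<^esub>)"
| step: "\<lbrakk>factors R S M N h; f \<in> bimodule_hom R S M N; g \<in> bimodule_hom R S N M\<rbrakk>
    \<Longrightarrow> factors R S M N (\<lambda>x. h x \<oplus>\<^bsub>M\<^esub> g (f x))"

lemma factors_closed:
  assumes "abelian_group M" "factors R S M N h" "x \<in> carrier M"
  shows "h x \<in> carrier M"
proof -
  interpret M: abelian_group M by fact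
  show ?thesis using assms(2)
    by induction (auto simp: left_hom_def Pi_def assms(3))
qed

text \<open>Returns from the inductive form to families over \<open>{..<n}\<close>, the index set of
  the coordinates of \<open>copies n N\<close>.\<close>

lemma factors_indexed:
  assumes M: "abelian_group M" and "factors R S M N h"
  obtains n :: nat and f g where "\<And>k. k < n \<Longrightarrow> f k \<in> bimodule_hom R S M N"
    and "\<And>k. k < n \<Longrightarrow> g k \<in> bimodule_hom R S N M"
    and "\<And>x. x \<in> carrier M \<Longrightarrow> h x = (\<Oplus>\<^bsub>M\<^esub>k\<in>{..<n}. g k (f k x))"
proof -
  interpret M: abelian_group M by fact
  have "\<exists>n f g. (\<forall>k<n. f k \<in> bimodule_hom R S M N) \<and> (\<forall>k<n. g k \<in> bimodule_hom R S N M) \<and>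
    (\<forall>x\<in>carrier M. h x = (\<Oplus>\<^bsub>M\<^esub>k\<in>{..<n::nat}. g k (f k x)))"
    using assms(2)
  proof induction
    case zero
    show ?case by (intro exI[of _ 0]) auto
  next
    case (step h f' g')
    then obtain n f g where *: "\<forall>k<n. f k \<in> bimodule_hom R S M N"
      "\<forall>k<n. g k \<in> bimodule_hom R S N M"
      "\<forall>x\<in>carrier M. h x = (\<Oplus>\<^bsub>M\<^esub>k\<in>{..<n::nat}. g k (f k x))" by blast
    have cl: "g k (f k x) \<in> carrier M" if "k < n" "x \<in> carrier M" for k x
      using *(1,2) that by (auto simp: left_hom_def Pi_def)
    have cl': "g' (f' x) \<in> carrier M" if "x \<in> carrier M" for x
      using step(2,3) that by (auto simp: left_hom_def Pi_def)
    show ?case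
    proof (intro exI conjI ballI allI impI)
      fix k assume "k < Suc n"
      then show "(f(n := f')) k \<in> bimodule_hom R S M N" "(g(n := g')) k \<in> bimodule_hom R S N M"
        using * step(2,3) by auto
    next
      fix x assume x: "x \<in> carrier M"
      have "(\<Oplus>\<^bsub>M\<^esub>k\<in>{..<Suc n}. (g(n := g')) k ((f(n := f')) k x)) =
        g' (f' x) \<oplus>\<^bsub>M\<^esub> (\<Oplus>\<^bsub>M\<^esub>k\<in>{..<n}. (g(n := g')) k ((f(n := f')) k x))"
        unfolding lessThan_Suc by (subst M.finsum_insert) (use x cl cl' in auto)
      also have "(\<Oplus>\<^bsub>M\<^esub>k\<in>{..<n}. (g(n := g')) k ((f(n := f')) k x)) = h x"
        unfolding bspec[OF *(3) x] by (rule M.finsum_cong') (use x cl in auto)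
      finally show "h x \<oplus>\<^bsub>M\<^esub> g' (f' x) =
          (\<Oplus>\<^bsub>M\<^esub>k\<in>{..<Suc n}. (g(n := g')) k ((f(n := f')) k x))"
        using x cl' factors_closed[OF M step(1)] by (simp add: M.a_comm)
    qed
  qed
  then show ?thesis using that by blast
qed

text \<open>Given an isomorphism \<theta> from \<open>M \<oplus> P\<close> onto the
  \<open>n\<close>-fold power of \<open>N\<close>, the map \<open>f k\<close> is the
  \<open>k\<close>-th coordinate of \<open>\<theta> (x, 0)\<close>, and \<open>g k\<close> is the
  \<open>k\<close>-th coordinate inclusion followed by the inverse of \<theta> and the projection to
  \<open>M\<close>.\<close>

lemma bimodule_dividesD:
  assumes M: "bimodule R S M" and N: "bimodule R S N" and "bimodule_divides R S M N"
  obtains n :: nat and f g where "\<And>k. k < n \<Longrightarrow> f k \<in> bimodule_hom R S M N"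
    and "\<And>k. k < n \<Longrightarrow> g k \<in> bimodule_hom R S N M"
    and "\<And>x. x \<in> carrier M \<Longrightarrow> (\<Oplus>\<^bsub>M\<^esub>k\<in>{..<n}. g k (f k x)) = x"
proof -
  interpret M: bimodule R S M by fact
  interpret N: bimodule R S N by fact
  obtain n and P :: "('a, 'c, nat \<Rightarrow> 'f) bimodule" and \<theta> where P: "bimodule R S P"
    and th: "\<theta> \<in> bimodule_iso R S (direct_sum M P) (copies n N)"
    using assms(3) unfolding bimodule_divides_def by blast
  interpret P: bimodule R S P by fact
  let ?C = "copies n N" and ?S = "direct_sum M P"
  interpret C: bimodule R S ?C by (rule bimodule_copies[OF N])
  have bij: "bij_betw \<theta> (carrier ?S) (carrier ?C)"
    and lh: "\<theta> \<in> left_hom R ?S ?C"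
    and rh: "\<theta> \<in> right_hom S ?S ?C"
    using th by (auto simp: bimodule_iso_def)
  \<comment> \<open>The retraction onto \<open>M\<close>: the inverse of \<theta> followed by the
    first projection.\<close>
  define \<psi> where "\<psi> u = fst (inv_into (carrier ?S) \<theta> u)" for u
  have psi: "\<psi> (\<theta> (x, p)) = x" if "x \<in> carrier M" "p \<in> carrier P" for x p
    using bij_betw_inv_into_left[OF bij, of "(x, p)"] that by (simp add: direct_sum_simps \<psi>_def)
  \<comment> \<open>Writing each element as some \<open>\<theta> (x, p)\<close> lets \<psi> inherit
    linearity from \<theta>, without first showing that the inverse of \<theta> is a
    homomorphism.\<close>
  have surj: "\<exists>x p. x \<in> carrier M \<and> p \<in> carrier P \<and> u = \<theta> (x, p)"
    if "u \<in> carrier ?C" for u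
    using bij that unfolding bij_betw_def direct_sum_simps by blast
  have th_add: "\<theta> (x, p) \<oplus>\<^bsub>?C\<^esub> \<theta> (x', p') = \<theta> (x \<oplus>\<^bsub>M\<^esub> x', p \<oplus>\<^bsub>P\<^esub> p')"
    if "x \<in> carrier M" "x' \<in> carrier M" "p \<in> carrier P" "p' \<in> carrier P" for x x' p p'
    using additive_maps_add[OF left_hom_additive[OF lh], of "(x, p)" "(x', p')"] that
    by (simp add: direct_sum_simps)
  have th_cl: "\<theta> (x, p) \<in> carrier ?C" if "x \<in> carrier M" "p \<in> carrier P" for x p
    using additive_maps_closed[OF left_hom_additive[OF lh], of "(x, p)"] that
    by (simp add: direct_sum_simps)
  have psi_add: "\<psi> \<in> additive_maps ?C M"
  proof (rule additive_mapsI)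
    fix u v assume "u \<in> carrier ?C" "v \<in> carrier ?C"
    then obtain x p x' p' where "x \<in> carrier M" "p \<in> carrier P" "u = \<theta> (x, p)"
      "x' \<in> carrier M" "p' \<in> carrier P" "v = \<theta> (x', p')" using surj by meson
    then show "\<psi> (u \<oplus>\<^bsub>?C\<^esub> v) = \<psi> u \<oplus>\<^bsub>M\<^esub> \<psi> v"
      by (simp add: th_add psi)
  qed (use surj psi in force)
  have psi_hom: "\<psi> \<in> bimodule_hom R S ?C M"
  proof (rule bimodule_homI[OF psi_add])
    fix r u assume r: "r \<in> carrier R" and "u \<in> carrier ?C"
    then obtain x p where "x \<in> carrier M" "p \<in> carrier P" "u = \<theta> (x, p)" using surj by meson
    then show "\<psi> (r \<odot>\<^bsub>?C\<^esub> u) = r \<odot>\<^bsub>M\<^esub> \<psi> u"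
      using left_hom_smult[OF lh r, of "(x, p)", symmetric] r
      by (simp add: direct_sum_simps psi M.smult_closed P.smult_closed)
  next
    fix u s assume s: "s \<in> carrier S" and "u \<in> carrier ?C"
    then obtain x p where "x \<in> carrier M" "p \<in> carrier P" "u = \<theta> (x, p)" using surj by meson
    then show "\<psi> (u \<bullet>\<^bsub>?C\<^esub> s) = \<psi> u \<bullet>\<^bsub>M\<^esub> s"
      using right_hom_rsmult[OF rh, of "(x, p)" s, symmetric] s
      by (simp add: direct_sum_simps psi M.rsmult_closed P.rsmult_closed)
  qed
  define \<iota> where "\<iota> k y = (\<lambda>i\<in>{..<n}. if i = k then y else \<zero>\<^bsub>N\<^esub>)" for k y
  \<comment> \<open>Truncation to the first \<open>m\<close> coordinates. It makes the decomposition
    of a tuple into its coordinate inclusions accessible to induction on \<open>m\<close>; at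
    \<open>m = n\<close> it is the identity.\<close>
  define \<tau> where "\<tau> m u = (\<lambda>i\<in>{..<n}. if i < m then u i else \<zero>\<^bsub>N\<^esub>)" for m :: nat and u
  have iota_cl: "\<iota> k y \<in> carrier ?C" if "y \<in> carrier N" for k y
    using that by (auto simp: copies_simps \<iota>_def)
  have r0: "r \<odot>\<^bsub>N\<^esub> \<zero>\<^bsub>N\<^esub> = \<zero>\<^bsub>N\<^esub>" if "r \<in> carrier R" for r
    using additive_maps_zero[OF _ _ bimodule_smult_additive[OF N that]] N.M.abelian_group_axioms by simp
  have s0: "\<zero>\<^bsub>N\<^esub> \<bullet>\<^bsub>N\<^esub> s = \<zero>\<^bsub>N\<^esub>" if "s \<in> carrier S" for s
    using additive_maps_zero[OF _ _ bimodule_rsmult_additive[OF N that]] N.M.abelian_group_axioms by simp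
  have iota_hom: "\<iota> k \<in> bimodule_hom R S N ?C" for k
    by (rule bimodule_homI, rule additive_mapsI)
      (auto simp: iota_cl copies_simps \<iota>_def fun_eq_iff r0 s0)
  have psi0: "\<psi> \<zero>\<^bsub>?C\<^esub> = \<zero>\<^bsub>M\<^esub>"
    by (rule additive_maps_zero[OF C.M.abelian_group_axioms M.M.abelian_group_axioms psi_add])
  have sum: "\<psi> (\<tau> m u) = (\<Oplus>\<^bsub>M\<^esub>k\<in>{..<m}. \<psi> (\<iota> k (u k)))"
    if u: "u \<in> carrier ?C" and "m \<le> n" for m u
    using \<open>m \<le> n\<close>
  proof (induction m)
    case 0
    have "\<tau> 0 u = \<zero>\<^bsub>?C\<^esub>" by (simp add: \<tau>_def copies_simps)
    then show ?case by (simp add: psi0)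
  next
    case (Suc m)
    have ui: "u i \<in> carrier N" if "i < n" for i using u that by (auto simp: copies_simps)
    have cl: "\<psi> (\<iota> k (u k)) \<in> carrier M" if "k < n" for k
      using additive_maps_closed[OF psi_add] iota_cl ui that by blast
    have "\<tau> (Suc m) u = \<iota> m (u m) \<oplus>\<^bsub>?C\<^esub> \<tau> m u"
      using Suc.prems by (auto simp: \<tau>_def \<iota>_def copies_simps fun_eq_iff ui less_Suc_eq)
    moreover have "\<tau> m u \<in> carrier ?C" using ui by (auto simp: \<tau>_def copies_simps)
    ultimately have "\<psi> (\<tau> (Suc m) u) = \<psi> (\<iota> m (u m)) \<oplus>\<^bsub>M\<^esub> \<psi> (\<tau> m u)"
      using Suc.prems by (simp add: additive_maps_add[OF psi_add] iota_cl ui)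
    also have "\<dots> = (\<Oplus>\<^bsub>M\<^esub>k\<in>{..<Suc m}. \<psi> (\<iota> k (u k)))"
      unfolding lessThan_Suc using Suc cl by (subst M.M.finsum_insert) auto
    finally show ?case .
  qed
  show ?thesis
  proof (rule that[of n "\<lambda>k x. \<theta> (x, \<zero>\<^bsub>P\<^esub>) k" "\<lambda>k y. \<psi> (\<iota> k y)"])
    fix k assume k: "k < n"
    have th0: "\<theta> (x, \<zero>\<^bsub>P\<^esub>) k \<in> carrier N" if "x \<in> carrier M" for x
      using th_cl[OF that P.M.zero_closed] k by (auto simp: copies_simps)
    have rP: "r \<odot>\<^bsub>P\<^esub> \<zero>\<^bsub>P\<^esub> = \<zero>\<^bsub>P\<^esub>" if "r \<in> carrier R" for r
      using additive_maps_zero[OF _ _ bimodule_smult_additive[OF P that]] P.M.abelian_group_axioms by simp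
    have sP: "\<zero>\<^bsub>P\<^esub> \<bullet>\<^bsub>P\<^esub> s = \<zero>\<^bsub>P\<^esub>" if "s \<in> carrier S" for s
      using additive_maps_zero[OF _ _ bimodule_rsmult_additive[OF P that]] P.M.abelian_group_axioms by simp
    show "(\<lambda>x. \<theta> (x, \<zero>\<^bsub>P\<^esub>) k) \<in> bimodule_hom R S M N"
    proof (rule bimodule_homI, rule additive_mapsI)
      fix x y assume "x \<in> carrier M" "y \<in> carrier M"
      then show "\<theta> (x \<oplus>\<^bsub>M\<^esub> y, \<zero>\<^bsub>P\<^esub>) k = \<theta> (x, \<zero>\<^bsub>P\<^esub>) k \<oplus>\<^bsub>N\<^esub> \<theta> (y, \<zero>\<^bsub>P\<^esub>) k"
        using th_add[of x y "\<zero>\<^bsub>P\<^esub>" "\<zero>\<^bsub>P\<^esub>", symmetric] k by (simp add: copies_simps)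
    next
      fix r x assume "r \<in> carrier R" "x \<in> carrier M"
      then show "\<theta> (r \<odot>\<^bsub>M\<^esub> x, \<zero>\<^bsub>P\<^esub>) k = r \<odot>\<^bsub>N\<^esub> \<theta> (x, \<zero>\<^bsub>P\<^esub>) k"
        using left_hom_smult[OF lh, of r "(x, \<zero>\<^bsub>P\<^esub>)"] k by (simp add: copies_simps direct_sum_simps rP)
    next
      fix x s assume "s \<in> carrier S" "x \<in> carrier M"
      then show "\<theta> (x \<bullet>\<^bsub>M\<^esub> s, \<zero>\<^bsub>P\<^esub>) k = \<theta> (x, \<zero>\<^bsub>P\<^esub>) k \<bullet>\<^bsub>N\<^esub> s"
        using right_hom_rsmult[OF rh, of "(x, \<zero>\<^bsub>P\<^esub>)" s] k by (simp add: copies_simps direct_sum_simps sP)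
    qed (rule th0)
    show "(\<lambda>y. \<psi> (\<iota> k y)) \<in> bimodule_hom R S N M"
      by (rule bimodule_hom_comp[OF iota_hom psi_hom])
  next
    fix x assume x: "x \<in> carrier M"
    let ?u = "\<theta> (x, \<zero>\<^bsub>P\<^esub>)"
    have u: "?u \<in> carrier ?C" using th_cl x by simp
    then have "\<tau> n ?u = ?u" unfolding \<tau>_def copies_simps
      by (auto simp: fun_eq_iff PiE_def extensional_def)
    then show "(\<Oplus>\<^bsub>M\<^esub>k\<in>{..<n}. \<psi> (\<iota> k (?u k))) = x"
      using sum[OF u order_refl] psi[OF x P.M.zero_closed] by simp
  qed
qed

text \<open>The maps \<open>f k\<close> assemble to \<open>F\<close> from \<open>M\<close> into the
  power of \<open>N\<close>, the maps \<open>g k\<close> to a retraction \<open>G\<close>. As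
  \<open>G\<close> after \<open>F\<close> is the identity, the power is the direct sum of the image
  of \<open>F\<close> and the kernel of \<open>G\<close>.\<close>

lemma bimodule_dividesI:
  fixes M :: "('r, 's, 'm) bimodule" and N :: "('r, 's, 'n) bimodule"
  assumes M: "bimodule R S M" and N: "bimodule R S N" and "factors R S M N h"
    and h: "\<And>x. x \<in> carrier M \<Longrightarrow> h x = x"
  shows "bimodule_divides R S M N"
proof -
  interpret M: bimodule R S M by fact
  interpret N: bimodule R S N by fact
  note Mg = M.M.abelian_group_axioms
  obtain n :: nat and f g where f: "\<And>k. k < n \<Longrightarrow> f k \<in> bimodule_hom R S M N"
    and g: "\<And>k. k < n \<Longrightarrow> g k \<in> bimodule_hom R S N M"
    and id: "\<And>x. x \<in> carrier M \<Longrightarrow> h x = (\<Oplus>\<^bsub>M\<^esub>k\<in>{..<n}. g k (f k x))"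
    by (rule factors_indexed[OF Mg assms(3)]) (rule that)
  let ?C = "copies n N"
  have bC: "bimodule R S ?C" by (rule bimodule_copies[OF N])
  interpret C: bimodule R S ?C by (rule bC)
  have g_cl: "g k y \<in> carrier M" if "k < n" "y \<in> carrier N" for k y
    using g[OF that(1)] that(2) by (auto simp: left_hom_def)
  have f_cl: "f k x \<in> carrier N" if "k < n" "x \<in> carrier M" for k x
    using f[OF that(1)] that(2) by (auto simp: left_hom_def)
  have C_cl: "u k \<in> carrier N" if "u \<in> carrier ?C" "k < n" for u k
    using that by (auto simp: copies_simps)
  define G where "G u = (\<Oplus>\<^bsub>M\<^esub>k\<in>{..<n}. g k (u k))" for u
  define F where "F x = (\<lambda>k\<in>{..<n}. f k x)" for x
  have G: "G \<in> bimodule_hom R S ?C M"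
  proof (rule bimodule_homI, rule additive_mapsI)
    show "G u \<in> carrier M" if "u \<in> carrier ?C" for u
      unfolding G_def using that g_cl C_cl by (auto intro!: M.M.finsum_closed)
  next
    fix u v assume u: "u \<in> carrier ?C" and v: "v \<in> carrier ?C"
    have "G (u \<oplus>\<^bsub>?C\<^esub> v) = (\<Oplus>\<^bsub>M\<^esub>k\<in>{..<n}. g k (u k) \<oplus>\<^bsub>M\<^esub> g k (v k))"
      unfolding G_def
      by (rule M.M.finsum_cong')
        (use u v g g_cl C_cl in \<open>auto simp: copies_simps intro!: additive_maps_add left_hom_additive\<close>)
    also have "\<dots> = G u \<oplus>\<^bsub>M\<^esub> G v"
      unfolding G_def by (rule M.M.finsum_addf) (use u v g_cl C_cl in auto)
    finally show "G (u \<oplus>\<^bsub>?C\<^esub> v) = G u \<oplus>\<^bsub>M\<^esub> G v" .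
  next
    fix r u assume r: "r \<in> carrier R" and u: "u \<in> carrier ?C"
    have "G (r \<odot>\<^bsub>?C\<^esub> u) = (\<Oplus>\<^bsub>M\<^esub>k\<in>{..<n}. r \<odot>\<^bsub>M\<^esub> g k (u k))"
      unfolding G_def
      by (rule M.M.finsum_cong')
        (use r u g g_cl C_cl in \<open>auto simp: copies_simps intro!: left_hom_smult M.smult_closed\<close>)
    also have "\<dots> = r \<odot>\<^bsub>M\<^esub> G u"
      unfolding G_def
      by (rule additive_maps_finsum[OF Mg Mg bimodule_smult_additive[OF M r], symmetric])
        (use u g_cl C_cl in auto)
    finally show "G (r \<odot>\<^bsub>?C\<^esub> u) = r \<odot>\<^bsub>M\<^esub> G u" .
  next
    fix s u assume s: "s \<in> carrier S" and u: "u \<in> carrier ?C"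
    have "G (u \<bullet>\<^bsub>?C\<^esub> s) = (\<Oplus>\<^bsub>M\<^esub>k\<in>{..<n}. g k (u k) \<bullet>\<^bsub>M\<^esub> s)"
      unfolding G_def
      by (rule M.M.finsum_cong')
        (use s u g g_cl C_cl in \<open>auto simp: copies_simps intro!: right_hom_rsmult M.rsmult_closed\<close>)
    also have "\<dots> = G u \<bullet>\<^bsub>M\<^esub> s"
      unfolding G_def
      by (rule additive_maps_finsum[OF Mg Mg bimodule_rsmult_additive[OF M s], symmetric])
        (use u g_cl C_cl in auto)
    finally show "G (u \<bullet>\<^bsub>?C\<^esub> s) = G u \<bullet>\<^bsub>M\<^esub> s" .
  qed
  then have G_add: "G \<in> additive_maps ?C M" by (auto intro: left_hom_additive)
  have F: "F \<in> bimodule_hom R S M ?C"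
  proof (rule bimodule_homI, rule additive_mapsI)
    fix x y assume "x \<in> carrier M" "y \<in> carrier M"
    then show "F (x \<oplus>\<^bsub>M\<^esub> y) = F x \<oplus>\<^bsub>?C\<^esub> F y"
      using f by (auto simp: F_def copies_simps fun_eq_iff intro!: additive_maps_add left_hom_additive)
  next
    fix r x assume "r \<in> carrier R" "x \<in> carrier M"
    then show "F (r \<odot>\<^bsub>M\<^esub> x) = r \<odot>\<^bsub>?C\<^esub> F x"
      using f by (auto simp: F_def copies_simps fun_eq_iff intro!: left_hom_smult)
  next
    fix s x assume "s \<in> carrier S" "x \<in> carrier M"
    then show "F (x \<bullet>\<^bsub>M\<^esub> s) = F x \<bullet>\<^bsub>?C\<^esub> s"
      using f by (auto simp: F_def copies_simps fun_eq_iff intro!: right_hom_rsmult)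
  qed (auto simp: F_def copies_simps f_cl)
  then have F_add: "F \<in> additive_maps M ?C" by (auto intro: left_hom_additive)
  have GF: "G (F x) = x" if "x \<in> carrier M" for x
  proof -
    have "G (F x) = (\<Oplus>\<^bsub>M\<^esub>k\<in>{..<n}. g k (f k x))"
      unfolding G_def F_def
      by (rule M.M.finsum_cong') (use that g_cl f_cl in auto)
    then show ?thesis using id[OF that] h[OF that] by simp
  qed
  \<comment> \<open>The complement is the kernel of \<open>G\<close> with the operations of
    \<open>copies n N\<close>, so it lives on the type over which \<open>bimodule_divides\<close>
    quantifies.\<close>
  define P where "P = ?C\<lparr>carrier := {u \<in> carrier ?C. G u = \<zero>\<^bsub>M\<^esub>}\<rparr>"
  have P_simps: "carrier P = {u \<in> carrier ?C. G u = \<zero>\<^bsub>M\<^esub>}" "\<zero>\<^bsub>P\<^esub> = \<zero>\<^bsub>?C\<^esub>"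
    "u \<oplus>\<^bsub>P\<^esub> v = u \<oplus>\<^bsub>?C\<^esub> v" "r \<odot>\<^bsub>P\<^esub> u = r \<odot>\<^bsub>?C\<^esub> u" "u \<bullet>\<^bsub>P\<^esub> s = u \<bullet>\<^bsub>?C\<^esub> s" for u v r s
    by (simp_all add: P_def)
  note G0 = additive_maps_zero[OF C.M.abelian_group_axioms Mg G_add]
  note Gneg = additive_maps_minus[OF C.M.abelian_group_axioms Mg G_add]
  have Gadd: "G (u \<oplus>\<^bsub>?C\<^esub> v) = G u \<oplus>\<^bsub>M\<^esub> G v" if "u \<in> carrier ?C" "v \<in> carrier ?C" for u v
    using additive_maps_add[OF G_add that] .
  have Gsm: "G (r \<odot>\<^bsub>?C\<^esub> u) = r \<odot>\<^bsub>M\<^esub> G u" if "r \<in> carrier R" "u \<in> carrier ?C" for r u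
    using left_hom_smult[of G R ?C M] G that by blast
  have Grm: "G (u \<bullet>\<^bsub>?C\<^esub> s) = G u \<bullet>\<^bsub>M\<^esub> s" if "s \<in> carrier S" "u \<in> carrier ?C" for s u
    using right_hom_rsmult[of G S ?C M] G that by blast
  have r0: "r \<odot>\<^bsub>M\<^esub> \<zero>\<^bsub>M\<^esub> = \<zero>\<^bsub>M\<^esub>" if "r \<in> carrier R" for r
    using additive_maps_zero[OF Mg Mg bimodule_smult_additive[OF M that]] .
  have s0: "\<zero>\<^bsub>M\<^esub> \<bullet>\<^bsub>M\<^esub> s = \<zero>\<^bsub>M\<^esub>" if "s \<in> carrier S" for s
    using additive_maps_zero[OF Mg Mg bimodule_rsmult_additive[OF M that]] .
  have agP: "abelian_group P"
  proof (rule abelian_groupI)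
    fix u assume "u \<in> carrier P"
    then show "\<exists>v\<in>carrier P. v \<oplus>\<^bsub>P\<^esub> u = \<zero>\<^bsub>P\<^esub>"
      by (intro bexI[of _ "\<ominus>\<^bsub>?C\<^esub> u"]) (auto simp: P_simps Gneg C.M.l_neg)
  next
    fix u v assume "u \<in> carrier P" "v \<in> carrier P"
    then show "u \<oplus>\<^bsub>P\<^esub> v = v \<oplus>\<^bsub>P\<^esub> u" by (simp add: P_simps C.M.a_comm)
  qed (simp_all add: P_simps Gadd G0 C.M.a_assoc)
  have bP: "bimodule R S P"
    by (rule bimoduleI[OF M.R.ring_axioms M.S.ring_axioms agP])
      (simp_all add: P_simps Gsm Grm r0 s0 C.smult_closed C.smult_l_distr C.smult_r_distr
        C.smult_assoc C.smult_one C.rsmult_closed C.rsmult_l_distr C.rsmult_r_distr C.rsmult_assoc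
        C.rsmult_one C.smult_rsmult_assoc)
  let ?S = "direct_sum M P"
  \<comment> \<open>The inverse sends \<open>u\<close> to \<open>(G u, u - F (G u))\<close>; the
    second entry lies in the kernel because \<open>G (F x) = x\<close>.\<close>
  define \<theta> where "\<theta> = (\<lambda>(x, u). F x \<oplus>\<^bsub>?C\<^esub> u)"
  have F_cl: "F x \<in> carrier ?C" if "x \<in> carrier M" for x
    using additive_maps_closed[OF F_add that] .
  have G_cl: "G u \<in> carrier M" if "u \<in> carrier ?C" for u
    using additive_maps_closed[OF G_add that] .
  have th_hom: "\<theta> \<in> bimodule_hom R S ?S ?C"
  proof (rule bimodule_homI, rule additive_mapsI)
    fix p q assume "p \<in> carrier ?S" "q \<in> carrier ?S"
    then show "\<theta> (p \<oplus>\<^bsub>?S\<^esub> q) = \<theta> p \<oplus>\<^bsub>?C\<^esub> \<theta> q"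
      by (auto simp: \<theta>_def direct_sum_simps P_simps F_cl additive_maps_add[OF F_add]
          C.M.a_assoc C.M.a_comm C.M.a_lcomm)
  next
    fix r p assume "r \<in> carrier R" "p \<in> carrier ?S"
    then show "\<theta> (r \<odot>\<^bsub>?S\<^esub> p) = r \<odot>\<^bsub>?C\<^esub> \<theta> p"
      using F by (auto simp: \<theta>_def direct_sum_simps P_simps F_cl C.smult_r_distr left_hom_smult)
  next
    fix s p assume "s \<in> carrier S" "p \<in> carrier ?S"
    then show "\<theta> (p \<bullet>\<^bsub>?S\<^esub> s) = \<theta> p \<bullet>\<^bsub>?C\<^esub> s"
      using F by (auto simp: \<theta>_def direct_sum_simps P_simps F_cl C.rsmult_l_distr right_hom_rsmult)
  qed (auto simp: \<theta>_def direct_sum_simps P_simps F_cl)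
  have "bij_betw \<theta> (carrier ?S) (carrier ?C)"
  proof (rule bij_betw_byWitness[where f' = "\<lambda>u. (G u, u \<ominus>\<^bsub>?C\<^esub> F (G u))"])
    show "\<forall>p\<in>carrier ?S. (G (\<theta> p), \<theta> p \<ominus>\<^bsub>?C\<^esub> F (G (\<theta> p))) = p"
    proof
      fix p assume "p \<in> carrier ?S"
      then obtain x u where p: "p = (x, u)" "x \<in> carrier M" "u \<in> carrier ?C" "G u = \<zero>\<^bsub>M\<^esub>"
        by (auto simp: direct_sum_simps P_simps)
      have "G (\<theta> p) = x" using p by (simp add: \<theta>_def Gadd F_cl GF)
      moreover have "(F x \<oplus>\<^bsub>?C\<^esub> u) \<ominus>\<^bsub>?C\<^esub> F x = u"
        using p F_cl[of x] C.M.a_comm[of "F x" u]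
        by (simp add: C.M.minus_eq C.M.a_assoc C.M.r_neg)
      ultimately show "(G (\<theta> p), \<theta> p \<ominus>\<^bsub>?C\<^esub> F (G (\<theta> p))) = p"
        by (simp add: p(1) \<theta>_def)
    qed
    show "\<forall>u\<in>carrier ?C. \<theta> (G u, u \<ominus>\<^bsub>?C\<^esub> F (G u)) = u"
    proof
      fix u assume u: "u \<in> carrier ?C"
      then show "\<theta> (G u, u \<ominus>\<^bsub>?C\<^esub> F (G u)) = u"
        using F_cl[OF G_cl[OF u]] C.M.a_comm[of u "\<ominus>\<^bsub>?C\<^esub> F (G u)"]
        by (simp add: \<theta>_def C.M.minus_eq C.M.r_neg2)
    qed
    show "\<theta> ` carrier ?S \<subseteq> carrier ?C"
      by (auto simp: \<theta>_def direct_sum_simps P_simps F_cl)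
    show "(\<lambda>u. (G u, u \<ominus>\<^bsub>?C\<^esub> F (G u))) ` carrier ?C \<subseteq> carrier ?S"
      by (auto simp: direct_sum_simps P_simps G_cl F_cl C.M.minus_eq Gadd Gneg GF M.M.r_neg)
  qed
  with th_hom have "\<theta> \<in> bimodule_iso R S (direct_sum M P) ?C" by (simp add: bimodule_iso_def)
  with bP show ?thesis unfolding bimodule_divides_def by blast
qed

text \<open>Induction on the second summand \<open>h'\<close> appends its composites one at a time
  to \<open>h\<close>. Reassociating the sum is legitimate only on the carrier, hence the auxiliary
  \<open>k\<close>.\<close>

lemma factors_add:
  assumes M: "abelian_group M" and "factors R S M N h'" "factors R S M N h"
  shows "\<exists>k. factors R S M N k \<and> (\<forall>x\<in>carrier M. k x = h x \<oplus>\<^bsub>M\<^esub> h' x)"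
proof -
  interpret M: abelian_group M by fact
  note cl = factors_closed[OF M]
  show ?thesis
    using assms(2)
  proof induction
    case zero
    then show ?case using assms(3) cl[OF assms(3)] by (intro exI[of _ h]) auto
  next
    case (step h' f g)
    then obtain k where k: "factors R S M N k" "\<forall>x\<in>carrier M. k x = h x \<oplus>\<^bsub>M\<^esub> h' x" by blast
    have "g (f x) \<in> carrier M" if "x \<in> carrier M" for x
      using that step(2,3) by (auto simp: left_hom_def Pi_def)
    then show ?case
      using factors.step[OF k(1) step(2,3)] k(2) cl[OF assms(3)] cl[OF step(1)]
      by (intro exI[of _ "\<lambda>x. k x \<oplus>\<^bsub>M\<^esub> g (f x)"]) (auto simp: M.a_assoc)
  qed
qed

text \<open>Hypothesis and conclusion have the same shape, so the lemma can be iterated over nested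
  sums.\<close>

lemma factors_finsum:
  assumes M: "abelian_group M" and "finite I"
    and "\<And>i. i \<in> I \<Longrightarrow> \<exists>k. factors R S M N k \<and> (\<forall>x\<in>carrier M. k x = h i x)"
  shows "\<exists>k. factors R S M N k \<and> (\<forall>x\<in>carrier M. k x = (\<Oplus>\<^bsub>M\<^esub>i\<in>I. h i x))"
proof -
  interpret M: abelian_group M by fact
  show ?thesis
    using assms(2,3)
  proof (induction I rule: finite_induct)
    case empty
    then show ?case using factors.zero by fastforce
  next
    case (insert i I)
    obtain k where k: "factors R S M N k" "\<forall>x\<in>carrier M. k x = h i x"
      using insert.prems by blast
    obtain k' where k': "factors R S M N k'" "\<forall>x\<in>carrier M. k' x = (\<Oplus>\<^bsub>M\<^esub>i\<in>I. h i x)"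
      using insert by blast
    have cl: "h j x \<in> carrier M" if j: "j \<in> insert i I" and x: "x \<in> carrier M" for j x
    proof -
      obtain k where "factors R S M N k" "k x = h j x" using insert.prems[OF j] x by blast
      then show ?thesis using factors_closed[OF M _ x, of R S N k] by simp
    qed
    obtain k'' where "factors R S M N k''" "\<forall>x\<in>carrier M. k'' x = k x \<oplus>\<^bsub>M\<^esub> k' x"
      using factors_add[OF M k'(1) k(1)] by blast
    then show ?case
      using k k' cl insert.hyps by (intro exI[of _ k'']) (auto simp: M.finsum_insert)
  qed
qed

lemma factors_single:
  assumes M: "abelian_group M" and f: "f \<in> bimodule_hom R S M N" and g: "g \<in> bimodule_hom R S N M"
  shows "\<exists>k. factors R S M N k \<and> (\<forall>x\<in>carrier M. k x = g (f x))"
proof -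
  interpret M: abelian_group M by fact
  have "g (f x) \<in> carrier M" if "x \<in> carrier M" for x
    using that f g by (auto simp: left_hom_def Pi_def)
  then show ?thesis
    using factors.step[OF factors.zero f g]
    by (intro exI[of _ "\<lambda>x. \<zero>\<^bsub>M\<^esub> \<oplus>\<^bsub>M\<^esub> g (f x)"]) auto
qed

lemma bimodule_dividesI_finsum:
  fixes M :: "('r, 's, 'm) bimodule" and N :: "('r, 's, 'n) bimodule"
  assumes M: "bimodule R S M" and N: "bimodule R S N" and "finite I"
    and f: "\<And>i. i \<in> I \<Longrightarrow> f i \<in> bimodule_hom R S M N"
    and g: "\<And>i. i \<in> I \<Longrightarrow> g i \<in> bimodule_hom R S N M"
    and id: "\<And>x. x \<in> carrier M \<Longrightarrow> (\<Oplus>\<^bsub>M\<^esub>i\<in>I. g i (f i x)) = x"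
  shows "bimodule_divides R S M N"
proof -
  note Mg = bimodule_abelian_group[OF M]
  have "\<exists>k. factors R S M N k \<and> (\<forall>x\<in>carrier M. k x = (\<Oplus>\<^bsub>M\<^esub>i\<in>I. g i (f i x)))"
    by (intro factors_finsum[OF Mg \<open>finite I\<close>] factors_single[OF Mg] f g)
  then show ?thesis using bimodule_dividesI[OF M N] id by auto
qed

text \<open>Inserting the decomposition of the identity of \<open>N\<close> between
  \<open>f k\<close> and \<open>g k\<close> turns each summand into a sum of composites through
  \<open>L\<close>.\<close>

lemma bimodule_divides_trans:
  fixes M :: "('r, 's, 'm) bimodule" and N :: "('r, 's, 'n) bimodule" and L :: "('r, 's, 'p) bimodule"
  assumes M: "bimodule R S M" and N: "bimodule R S N" and L: "bimodule R S L"
    and "bimodule_divides R S M N" "bimodule_divides R S N L"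
  shows "bimodule_divides R S M L"
proof -
  note Mg = bimodule_abelian_group[OF M] and Ng = bimodule_abelian_group[OF N]
  obtain n :: nat and f g where f: "\<And>k. k < n \<Longrightarrow> f k \<in> bimodule_hom R S M N"
    and g: "\<And>k. k < n \<Longrightarrow> g k \<in> bimodule_hom R S N M"
    and id: "\<And>x. x \<in> carrier M \<Longrightarrow> (\<Oplus>\<^bsub>M\<^esub>k\<in>{..<n}. g k (f k x)) = x"
    by (rule bimodule_dividesD[OF M N assms(4)]) (rule that)
  obtain m :: nat and f' g' where f': "\<And>k. k < m \<Longrightarrow> f' k \<in> bimodule_hom R S N L"
    and g': "\<And>k. k < m \<Longrightarrow> g' k \<in> bimodule_hom R S L N"
    and id': "\<And>x. x \<in> carrier N \<Longrightarrow> (\<Oplus>\<^bsub>N\<^esub>k\<in>{..<m}. g' k (f' k x)) = x"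
    by (rule bimodule_dividesD[OF N L assms(5)]) (rule that)
  have step: "\<exists>h. factors R S M L h \<and> (\<forall>x\<in>carrier M. h x = g k (f k x))" if k: "k < n" for k
  proof -
    have "g k (f k x) = (\<Oplus>\<^bsub>M\<^esub>j\<in>{..<m}. g k (g' j (f' j (f k x))))" if x: "x \<in> carrier M" for x
    proof -
      have fx: "f k x \<in> carrier N" using f[OF k] x by (auto simp: left_hom_def)
      have "g' j (f' j y) \<in> carrier N" if "j < m" "y \<in> carrier N" for j y
        using f'[OF that(1)] g'[OF that(1)] that(2) by (auto simp: left_hom_def Pi_def)
      then have "g k (\<Oplus>\<^bsub>N\<^esub>j\<in>{..<m}. g' j (f' j (f k x))) =
          (\<Oplus>\<^bsub>M\<^esub>j\<in>{..<m}. g k (g' j (f' j (f k x))))"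
        using g[OF k] fx by (intro additive_maps_finsum[OF Ng Mg]) (auto intro: left_hom_additive)
      then show ?thesis using id'[OF fx] by simp
    qed
    moreover have "\<exists>h. factors R S M L h \<and>
        (\<forall>x\<in>carrier M. h x = (\<Oplus>\<^bsub>M\<^esub>j\<in>{..<m}. g k (g' j (f' j (f k x)))))"
      by (intro factors_finsum[OF Mg] factors_single[OF Mg]
          bimodule_hom_comp[OF f[OF k] f'] bimodule_hom_comp[OF g' g[OF k]]) auto
    ultimately show ?thesis by auto
  qed
  have "\<exists>h. factors R S M L h \<and> (\<forall>x\<in>carrier M. h x = (\<Oplus>\<^bsub>M\<^esub>k\<in>{..<n}. g k (f k x)))"
    by (rule factors_finsum[OF Mg]) (auto intro: step)
  then show ?thesis using bimodule_dividesI[OF M L] id by auto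
qed

section \<open>The tensor product and its universal property\<close>

lemma additive_maps_comp:
  "\<lbrakk>f \<in> additive_maps M N; g \<in> additive_maps N L\<rbrakk> \<Longrightarrow> (\<lambda>x. g (f x)) \<in> additive_maps M L"
  by (auto simp: additive_maps_def Pi_def)

lemma additive_maps_sum:
  assumes "abelian_group N" "f \<in> additive_maps M N" "g \<in> additive_maps M N"
  shows "(\<lambda>x. f x \<oplus>\<^bsub>N\<^esub> g x) \<in> additive_maps M N"
proof -
  interpret N: abelian_group N by fact
  show ?thesis
    using assms(2,3) by (intro additive_mapsI)
      (simp_all add: additive_maps_closed additive_maps_add N.a_assoc N.a_lcomm)
qed

lemma additive_maps_finsum_closed:
  assumes "abelian_group N" "finite I" "\<And>i. i \<in> I \<Longrightarrow> f i \<in> additive_maps M N"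
  shows "(\<lambda>x. \<Oplus>\<^bsub>N\<^esub>i\<in>I. f i x) \<in> additive_maps M N"
proof -
  interpret N: abelian_group N by fact
  have cl: "f i x \<in> carrier N" if "i \<in> I" "x \<in> carrier M" for i x
    using additive_maps_closed[OF assms(3)] that by blast
  show ?thesis
  proof (rule additive_mapsI)
    fix x y assume xy: "x \<in> carrier M" "y \<in> carrier M"
    have "(\<Oplus>\<^bsub>N\<^esub>i\<in>I. f i (x \<oplus>\<^bsub>M\<^esub> y)) = (\<Oplus>\<^bsub>N\<^esub>i\<in>I. f i x \<oplus>\<^bsub>N\<^esub> f i y)"
      using xy cl by (intro N.finsum_cong') (auto intro: additive_maps_add[OF assms(3)])
    also have "\<dots> = (\<Oplus>\<^bsub>N\<^esub>i\<in>I. f i x) \<oplus>\<^bsub>N\<^esub> (\<Oplus>\<^bsub>N\<^esub>i\<in>I. f i y)"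
      using xy cl by (intro N.finsum_addf) auto
    finally show "(\<Oplus>\<^bsub>N\<^esub>i\<in>I. f i (x \<oplus>\<^bsub>M\<^esub> y)) =
      (\<Oplus>\<^bsub>N\<^esub>i\<in>I. f i x) \<oplus>\<^bsub>N\<^esub> (\<Oplus>\<^bsub>N\<^esub>i\<in>I. f i y)" .
  qed (use cl in \<open>auto intro!: N.finsum_closed\<close>)
qed

definition pure_tensor ::
  "('s, 'k) ring_scheme \<Rightarrow> ('r, 's, 'm, 'x) bimodule_scheme \<Rightarrow> ('s, 't, 'n, 'y) bimodule_scheme
    \<Rightarrow> 'm \<Rightarrow> 'n \<Rightarrow> ('m \<times> 'n \<Rightarrow>\<^sub>0 int) set"
  where "pure_tensor S M N x y =
    (let F = free_Abelian_group (carrier M \<times> carrier N)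
     in generate F (tensor_relations S M N) #>\<^bsub>F\<^esub> frag_of (x, y))"

definition balanced ::
  "('s, 'k) ring_scheme \<Rightarrow> ('r, 's, 'm, 'x) bimodule_scheme \<Rightarrow> ('s, 't, 'n, 'y) bimodule_scheme
    \<Rightarrow> ('p, 'z) ring_scheme \<Rightarrow> ('m \<Rightarrow> 'n \<Rightarrow> 'p) \<Rightarrow> bool"
  where "balanced S M N L h \<longleftrightarrow>
    (\<forall>y\<in>carrier N. (\<lambda>x. h x y) \<in> additive_maps M L) \<and>
    (\<forall>x\<in>carrier M. h x \<in> additive_maps N L) \<and>
    (\<forall>x\<in>carrier M. \<forall>s\<in>carrier S. \<forall>y\<in>carrier N. h (x \<bullet>\<^bsub>M\<^esub> s) y = h x (s \<odot>\<^bsub>N\<^esub> y))"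

lemma balancedI:
  assumes "\<And>x y. \<lbrakk>x \<in> carrier M; y \<in> carrier N\<rbrakk> \<Longrightarrow> h x y \<in> carrier L"
    and "\<And>x x' y. \<lbrakk>x \<in> carrier M; x' \<in> carrier M; y \<in> carrier N\<rbrakk>
      \<Longrightarrow> h (x \<oplus>\<^bsub>M\<^esub> x') y = h x y \<oplus>\<^bsub>L\<^esub> h x' y"
    and "\<And>x y y'. \<lbrakk>x \<in> carrier M; y \<in> carrier N; y' \<in> carrier N\<rbrakk>
      \<Longrightarrow> h x (y \<oplus>\<^bsub>N\<^esub> y') = h x y \<oplus>\<^bsub>L\<^esub> h x y'"
    and "\<And>x s y. \<lbrakk>x \<in> carrier M; s \<in> carrier S; y \<in> carrier N\<rbrakk>
      \<Longrightarrow> h (x \<bullet>\<^bsub>M\<^esub> s) y = h x (s \<odot>\<^bsub>N\<^esub> y)"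
  shows "balanced S M N L h"
  unfolding balanced_def by (intro conjI ballI additive_mapsI assms)

text \<open>A choice among all additive maps with the prescribed values on pure tensors; for
  balanced \<open>h\<close> such a map exists, and its values on the carrier are forced by
  \<open>additive_maps_tensor_eqI\<close>. Choice makes the map a function of \<open>h\<close>, so
  that lifts depending on parameters can be compared.\<close>

definition tensor_lift ::
  "('s, 'k) ring_scheme \<Rightarrow> ('r, 's, 'm, 'x) bimodule_scheme \<Rightarrow> ('s, 't, 'n, 'y) bimodule_scheme
    \<Rightarrow> ('p, 'z) ring_scheme \<Rightarrow> ('m \<Rightarrow> 'n \<Rightarrow> 'p) \<Rightarrow> ('m \<times> 'n \<Rightarrow>\<^sub>0 int) set \<Rightarrow> 'p"
  where "tensor_lift S M N L h =
    (SOME g. g \<in> additive_maps (tensor_product S M N) L \<and>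
      (\<forall>x\<in>carrier M. \<forall>y\<in>carrier N. g (pure_tensor S M N x y) = h x y))"

text \<open>This evaluates the scalar actions of \<open>tensor_product\<close> on a coset: the image
  of \<open>K #> c\<close> lies in the coset of \<open>f c\<close>, and multiplying by
  \<open>K\<close> fills that coset.\<close>

lemma (in group) set_mult_image_r_coset:
  assumes f: "f \<in> hom G G" and K: "subgroup K G" and fK: "f ` K \<subseteq> K" and c: "c \<in> carrier G"
  shows "K <#> f ` (K #> c) = K #> f c"
proof -
  interpret K: subgroup K G by fact
  have fc: "f c \<in> carrier G" using f c by (auto simp: hom_def)
  have Kc: "k \<in> carrier G" if "k \<in> K" for k using that K.subset by blast
  have fm: "f (k \<otimes> c) = f k \<otimes> f c" if "k \<in> K" for k
    using f c Kc[OF that] by (simp add: hom_mult)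
  show ?thesis
  proof (intro equalityI subsetI)
    fix z assume "z \<in> K <#> f ` (K #> c)"
    then obtain k k' where kk: "k \<in> K" "k' \<in> K" "z = k \<otimes> f (k' \<otimes> c)"
      by (auto simp: set_mult_def r_coset_def)
    have fk: "f k' \<in> K" using fK kk(2) by blast
    have "z = (k \<otimes> f k') \<otimes> f c"
      using kk fm[OF kk(2)] Kc[OF kk(1)] Kc[OF fk] fc by (simp add: m_assoc)
    then show "z \<in> K #> f c" using K.m_closed[OF kk(1) fk] by (auto simp: r_coset_def)
  next
    fix z assume "z \<in> K #> f c"
    then obtain k where k: "k \<in> K" "z = k \<otimes> f c" by (auto simp: r_coset_def)
    have "c \<in> K #> c" using rcos_self[OF c K] .
    with k show "z \<in> K <#> f ` (K #> c)" by (auto simp: set_mult_def)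
  qed
qed

locale tensor_factors =
  fixes R :: "('r, 'j) ring_scheme" and S :: "('s, 'k) ring_scheme" and Q :: "('t, 'l) ring_scheme"
    and M :: "('r, 's, 'm, 'x) bimodule_scheme" and N :: "('s, 't, 'n, 'y) bimodule_scheme"
  assumes M: "bimodule R S M" and N: "bimodule S Q N"
begin

sublocale M: bimodule R S M by (rule M)
sublocale N: bimodule S Q N by (rule N)

abbreviation F where "F \<equiv> free_Abelian_group (carrier M \<times> carrier N)"
abbreviation K where "K \<equiv> generate F (tensor_relations S M N)"
abbreviation T where "T \<equiv> tensor_product S M N"
abbreviation tensor (infixl "\<otimes>\<^sub>T" 75) where "x \<otimes>\<^sub>T y \<equiv> pure_tensor S M N x y"

sublocale F: comm_group F
  by (rule abelian_free_Abelian_group)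

section \<open>The defining relations and the group of cosets\<close>

lemma relationI:
  "\<lbrakk>x \<in> carrier M; x' \<in> carrier M; y \<in> carrier N\<rbrakk> \<Longrightarrow>
    frag_of (x \<oplus>\<^bsub>M\<^esub> x', y) - frag_of (x, y) - frag_of (x', y) \<in> tensor_relations S M N"
  "\<lbrakk>x \<in> carrier M; y \<in> carrier N; y' \<in> carrier N\<rbrakk> \<Longrightarrow>
    frag_of (x, y \<oplus>\<^bsub>N\<^esub> y') - frag_of (x, y) - frag_of (x, y') \<in> tensor_relations S M N"
  "\<lbrakk>x \<in> carrier M; s \<in> carrier S; y \<in> carrier N\<rbrakk> \<Longrightarrow>
    frag_of (x \<bullet>\<^bsub>M\<^esub> s, y) - frag_of (x, s \<odot>\<^bsub>N\<^esub> y) \<in> tensor_relations S M N"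
  unfolding tensor_relations_def by blast+

lemma relations_cases [consumes 1]:
  assumes "c \<in> tensor_relations S M N"
  obtains x x' y where "c = frag_of (x \<oplus>\<^bsub>M\<^esub> x', y) - frag_of (x, y) - frag_of (x', y)"
      "x \<in> carrier M" "x' \<in> carrier M" "y \<in> carrier N"
  | x y y' where "c = frag_of (x, y \<oplus>\<^bsub>N\<^esub> y') - frag_of (x, y) - frag_of (x, y')"
      "x \<in> carrier M" "y \<in> carrier N" "y' \<in> carrier N"
  | x s y where "c = frag_of (x \<bullet>\<^bsub>M\<^esub> s, y) - frag_of (x, s \<odot>\<^bsub>N\<^esub> y)"
      "x \<in> carrier M" "s \<in> carrier S" "y \<in> carrier N"
  using assms unfolding tensor_relations_def by blast

lemma relations_carrier: "tensor_relations S M N \<subseteq> carrier F"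
proof
  fix c assume "c \<in> tensor_relations S M N"
  moreover have "c - d \<in> carrier F" if "c \<in> carrier F" "d \<in> carrier F" for c d
    using that keys_diff[of c d] by auto
  ultimately show "c \<in> carrier F"
    by (cases rule: relations_cases)
      (simp_all add: M.rsmult_closed N.smult_closed del: carrier_free_Abelian_group_iff)
qed

lemma subgroup_K: "subgroup K F"
  by (rule F.generate_is_subgroup[OF relations_carrier])

lemma normal_K: "K \<lhd> F"
  by (rule F.subgroup_imp_normal[OF subgroup_K])

lemma tensor_simps:
  "carrier T = carrier (F Mod K)" "\<zero>\<^bsub>T\<^esub> = K" "ring.add T = (\<otimes>\<^bsub>F Mod K\<^esub>)"
  "r \<odot>\<^bsub>T\<^esub> C = K <#>\<^bsub>F\<^esub> frag_extend (\<lambda>(x, y). frag_of (r \<odot>\<^bsub>M\<^esub> x, y)) ` C"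
  "C \<bullet>\<^bsub>T\<^esub> t = K <#>\<^bsub>F\<^esub> frag_extend (\<lambda>(x, y). frag_of (x, y \<bullet>\<^bsub>N\<^esub> t)) ` C"
  by (simp_all add: tensor_product_def Let_def)

lemma carrier_T: "carrier T = (\<lambda>c. K #>\<^bsub>F\<^esub> c) ` carrier F"
  by (simp only: tensor_simps carrier_FactGroup)

lemma add_T: "\<lbrakk>c \<in> carrier F; d \<in> carrier F\<rbrakk> \<Longrightarrow> (K #>\<^bsub>F\<^esub> c) \<oplus>\<^bsub>T\<^esub> (K #>\<^bsub>F\<^esub> d) = K #>\<^bsub>F\<^esub> (c + d)"
  using normal.rcos_sum[OF normal_K, of c d] by (simp add: tensor_simps)

lemma abelian_group_T: "abelian_group T"
proof -
  interpret Q: comm_group "F Mod K"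
    by (rule F.abelian_FactGroup[OF subgroup_K])
  have simps: "carrier T = carrier (F Mod K)" "\<zero>\<^bsub>T\<^esub> = \<one>\<^bsub>F Mod K\<^esub>" "ring.add T = (\<otimes>\<^bsub>F Mod K\<^esub>)"
    by (simp_all only: tensor_simps one_FactGroup)
  show ?thesis
    by (rule abelian_groupI; unfold simps)
      (fact Q.m_closed Q.one_closed Q.m_assoc Q.m_comm Q.l_one Q.l_inv_ex)+
qed

sublocale T: abelian_group T
  by (rule abelian_group_T)

lemma tensor_eq: "x \<otimes>\<^sub>T y = K #>\<^bsub>F\<^esub> frag_of (x, y)"
  by (simp add: pure_tensor_def Let_def)

lemma tensor_closed: "\<lbrakk>x \<in> carrier M; y \<in> carrier N\<rbrakk> \<Longrightarrow> x \<otimes>\<^sub>T y \<in> carrier T"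
  by (auto simp: tensor_eq carrier_T simp del: carrier_free_Abelian_group_iff)

lemma coset_eqI:
  assumes "c \<in> carrier F" "d \<in> carrier F" "c - d \<in> K"
  shows "K #>\<^bsub>F\<^esub> c = K #>\<^bsub>F\<^esub> d"
proof -
  have "c \<in> K #>\<^bsub>F\<^esub> d"
    using assms(3) by (auto simp: r_coset_def intro!: bexI[of _ "c - d"])
  then show ?thesis
    using F.repr_independence[OF _ assms(2) subgroup_K] by simp
qed

lemma tensor_add_left:
  assumes "x \<in> carrier M" "x' \<in> carrier M" "y \<in> carrier N"
  shows "(x \<oplus>\<^bsub>M\<^esub> x') \<otimes>\<^sub>T y = x \<otimes>\<^sub>T y \<oplus>\<^bsub>T\<^esub> x' \<otimes>\<^sub>T y"
proof -
  have "frag_of (x \<oplus>\<^bsub>M\<^esub> x', y) - (frag_of (x, y) + frag_of (x', y)) \<in> tensor_relations S M N"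
    using relationI assms by (simp add: algebra_simps)
  then have "frag_of (x \<oplus>\<^bsub>M\<^esub> x', y) - (frag_of (x, y) + frag_of (x', y)) \<in> K"
    by (rule generate.incl)
  then have "K #>\<^bsub>F\<^esub> frag_of (x \<oplus>\<^bsub>M\<^esub> x', y) = K #>\<^bsub>F\<^esub> (frag_of (x, y) + frag_of (x', y))"
    using assms F.m_closed[of "frag_of (x, y)" "frag_of (x', y)"] by (intro coset_eqI) simp_all
  then show ?thesis using assms by (simp add: tensor_eq add_T)
qed

lemma tensor_add_right:
  assumes "x \<in> carrier M" "y \<in> carrier N" "y' \<in> carrier N"
  shows "x \<otimes>\<^sub>T (y \<oplus>\<^bsub>N\<^esub> y') = x \<otimes>\<^sub>T y \<oplus>\<^bsub>T\<^esub> x \<otimes>\<^sub>T y'"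
proof -
  have "frag_of (x, y \<oplus>\<^bsub>N\<^esub> y') - (frag_of (x, y) + frag_of (x, y')) \<in> tensor_relations S M N"
    using relationI assms by (simp add: algebra_simps)
  then have "frag_of (x, y \<oplus>\<^bsub>N\<^esub> y') - (frag_of (x, y) + frag_of (x, y')) \<in> K"
    by (rule generate.incl)
  then have "K #>\<^bsub>F\<^esub> frag_of (x, y \<oplus>\<^bsub>N\<^esub> y') = K #>\<^bsub>F\<^esub> (frag_of (x, y) + frag_of (x, y'))"
    using assms F.m_closed[of "frag_of (x, y)" "frag_of (x, y')"] by (intro coset_eqI) simp_all
  then show ?thesis using assms by (simp add: tensor_eq add_T)
qed

lemma tensor_balanced:
  assumes "x \<in> carrier M" "s \<in> carrier S" "y \<in> carrier N"
  shows "(x \<bullet>\<^bsub>M\<^esub> s) \<otimes>\<^sub>T y = x \<otimes>\<^sub>T (s \<odot>\<^bsub>N\<^esub> y)"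
proof -
  have "frag_of (x \<bullet>\<^bsub>M\<^esub> s, y) - frag_of (x, s \<odot>\<^bsub>N\<^esub> y) \<in> tensor_relations S M N"
    by (rule relationI(3)[OF assms])
  then have "frag_of (x \<bullet>\<^bsub>M\<^esub> s, y) - frag_of (x, s \<odot>\<^bsub>N\<^esub> y) \<in> K"
    by (rule generate.incl)
  then show ?thesis
    unfolding tensor_eq using assms M.rsmult_closed N.smult_closed by (intro coset_eqI) simp_all
qed

text \<open>Pure tensors generate the quotient, because the generators \<open>frag_of\<close>
  generate the free group. Every identity between maps out of a tensor product is checked through
  this lemma.\<close>

lemma additive_maps_tensor_eqI:
  assumes L: "abelian_group L" and f: "f \<in> additive_maps T L" and g: "g \<in> additive_maps T L"
    and eq: "\<And>x y. \<lbrakk>x \<in> carrier M; y \<in> carrier N\<rbrakk> \<Longrightarrow> f (x \<otimes>\<^sub>T y) = g (x \<otimes>\<^sub>T y)"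
    and "t \<in> carrier T"
  shows "f t = g t"
proof -
  interpret L: abelian_group L by fact
  obtain c where c: "Poly_Mapping.keys c \<subseteq> carrier M \<times> carrier N" "t = K #>\<^bsub>F\<^esub> c"
    using assms(5) by (auto simp: carrier_T)
  have cl: "K #>\<^bsub>F\<^esub> d \<in> carrier T" if "Poly_Mapping.keys d \<subseteq> carrier M \<times> carrier N" for d
    using that by (simp add: carrier_T)
  have K0: "K #>\<^bsub>F\<^esub> 0 = \<zero>\<^bsub>T\<^esub>"
    using F.coset_mult_one[OF subgroup.subset[OF subgroup_K]] by (simp add: tensor_simps)
  \<comment> \<open>The induction principle for the free group asks for closure under
    differences.\<close>
  have minus: "h (K #>\<^bsub>F\<^esub> (c - d)) = h (K #>\<^bsub>F\<^esub> c) \<ominus>\<^bsub>L\<^esub> h (K #>\<^bsub>F\<^esub> d)"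
    if h: "h \<in> additive_maps T L" and "Poly_Mapping.keys c \<subseteq> carrier M \<times> carrier N"
      "Poly_Mapping.keys d \<subseteq> carrier M \<times> carrier N" for h c d
  proof -
    have k: "Poly_Mapping.keys (c - d) \<subseteq> carrier M \<times> carrier N"
      using that keys_diff[of c d] by blast
    have "h (K #>\<^bsub>F\<^esub> c) = h (K #>\<^bsub>F\<^esub> (c - d)) \<oplus>\<^bsub>L\<^esub> h (K #>\<^bsub>F\<^esub> d)"
      using add_T[of "c - d" d] that k additive_maps_add[OF h cl cl, of "c - d" d] by simp
    then show ?thesis
      using additive_maps_closed[OF h cl] k that by (simp add: L.minus_eq L.a_assoc L.r_neg)
  qed
  have "f (K #>\<^bsub>F\<^esub> c) = g (K #>\<^bsub>F\<^esub> c)"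
  proof (rule free_Abelian_group_induct[OF c(1)])
    show "f (K #>\<^bsub>F\<^esub> 0) = g (K #>\<^bsub>F\<^esub> 0)"
      using additive_maps_zero[OF abelian_group_T L f] additive_maps_zero[OF abelian_group_T L g]
      by (simp add: K0)
  next
    fix a assume "a \<in> carrier M \<times> carrier N"
    then show "f (K #>\<^bsub>F\<^esub> frag_of a) = g (K #>\<^bsub>F\<^esub> frag_of a)"
      using eq by (auto simp: tensor_eq)
  qed (simp add: minus f g)
  then show ?thesis by (simp add: c(2))
qed

text \<open>Two universal properties in a row: \<open>h\<close> extends to a homomorphism on the
  free group, and since that extension kills the three kinds of relations it kills the subgroup they
  generate and factors through the quotient.\<close>

lemma tensor_lift_exists:
  assumes L: "abelian_group L" and h: "balanced S M N L h"
  shows "\<exists>g. g \<in> additive_maps T L \<and>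
    (\<forall>x\<in>carrier M. \<forall>y\<in>carrier N. g (x \<otimes>\<^sub>T y) = h x y)"
proof -
  interpret L: abelian_group L by fact
  have h_cl: "h x y \<in> carrier L" if "x \<in> carrier M" "y \<in> carrier N" for x y
    using h that additive_maps_closed[of "h x" N L y] unfolding balanced_def by blast
  have h_l: "h (x \<oplus>\<^bsub>M\<^esub> x') y = h x y \<oplus>\<^bsub>L\<^esub> h x' y"
    if "x \<in> carrier M" "x' \<in> carrier M" "y \<in> carrier N" for x x' y
    using h that additive_maps_add[of "\<lambda>x. h x y" M L x x'] unfolding balanced_def by blast
  have h_r: "h x (y \<oplus>\<^bsub>N\<^esub> y') = h x y \<oplus>\<^bsub>L\<^esub> h x y'"
    if "x \<in> carrier M" "y \<in> carrier N" "y' \<in> carrier N" for x y y'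
    using h that additive_maps_add[of "h x" N L y y'] unfolding balanced_def by blast
  have h_b: "h (x \<bullet>\<^bsub>M\<^esub> s) y = h x (s \<odot>\<^bsub>N\<^esub> y)"
    if "x \<in> carrier M" "s \<in> carrier S" "y \<in> carrier N" for x s y
    using h that unfolding balanced_def by blast
  have "(\<lambda>(x, y). h x y) ` (carrier M \<times> carrier N) \<subseteq> carrier (add_monoid L)"
    using h_cl by auto
  from comm_group.free_Abelian_group_universal[OF L.a_comm_group this]
  obtain g where g: "g \<in> hom F (add_monoid L)"
    and g_of: "\<And>p. p \<in> carrier M \<times> carrier N \<Longrightarrow> g (frag_of p) = (\<lambda>(x, y). h x y) p" by blast
  interpret g: group_hom F "add_monoid L" g
    using g L.a_group by (auto simp: group_hom_def group_hom_axioms_def)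
  have g_minus: "g (c - d) = g c \<ominus>\<^bsub>L\<^esub> g d"
    if "Poly_Mapping.keys c \<subseteq> carrier M \<times> carrier N" "Poly_Mapping.keys d \<subseteq> carrier M \<times> carrier N" for c d
  proof -
    have k: "Poly_Mapping.keys (c - d) \<subseteq> carrier M \<times> carrier N"
      using that keys_diff[of c d] by blast
    have cl: "g e \<in> carrier L" if "Poly_Mapping.keys e \<subseteq> carrier M \<times> carrier N" for e
      using g.hom_closed[of e] that by simp
    have "g c = g (c - d) \<oplus>\<^bsub>L\<^esub> g d"
      using g.hom_mult[of "c - d" d] that k by simp
    then show ?thesis
      using cl[OF k] cl[OF that(2)] by (simp add: L.minus_eq L.a_assoc L.r_neg)
  qed
  have "tensor_relations S M N \<subseteq> kernel F (add_monoid L) g"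
  proof
    fix c assume c: "c \<in> tensor_relations S M N"
    then have cF: "c \<in> carrier F" using relations_carrier by blast
    have keys: "Poly_Mapping.keys (frag_of (x, y) - frag_of (x', y')) \<subseteq> carrier M \<times> carrier N"
      if "x \<in> carrier M" "x' \<in> carrier M" "y \<in> carrier N" "y' \<in> carrier N" for x x' y y'
      using keys_diff[of "frag_of (x, y)" "frag_of (x', y')"] that by auto
    have canc: "(a \<oplus>\<^bsub>L\<^esub> b) \<ominus>\<^bsub>L\<^esub> a \<ominus>\<^bsub>L\<^esub> b = \<zero>\<^bsub>L\<^esub>" if "a \<in> carrier L" "b \<in> carrier L" for a b
      using that L.a_assoc[of "a \<oplus>\<^bsub>L\<^esub> b" "\<ominus>\<^bsub>L\<^esub> a" "\<ominus>\<^bsub>L\<^esub> b"] L.r_neg[of "a \<oplus>\<^bsub>L\<^esub> b"]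
      by (simp add: L.minus_eq L.minus_add)
    have self: "a \<ominus>\<^bsub>L\<^esub> a = \<zero>\<^bsub>L\<^esub>" if "a \<in> carrier L" for a
      using that by (simp add: L.minus_eq L.r_neg)
    from c have "g c = \<zero>\<^bsub>L\<^esub>"
      by (cases rule: relations_cases)
        (simp_all add: g_minus g_of keys M.rsmult_closed N.smult_closed h_cl h_l h_r h_b canc self)
    with cF show "c \<in> kernel F (add_monoid L) g" by (simp add: kernel_def)
  qed
  then have "K \<subseteq> kernel F (add_monoid L) g"
    by (rule F.generate_subgroup_incl[OF _ g.subgroup_kernel])
  from g.FactGroup_universal_kernel[OF normal_K this]
  obtain k where k: "k \<in> hom (F Mod K) (add_monoid L)" and
    k_of: "\<And>c. c \<in> carrier F \<Longrightarrow> k (K #>\<^bsub>F\<^esub> c) = g c" by blast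
  have "k \<in> additive_maps T L"
    using k by (auto simp: additive_maps_def hom_def tensor_simps)
  then show ?thesis using k_of g_of by (intro exI[of _ k]) (auto simp: tensor_eq)
qed

lemma
  assumes "abelian_group L" "balanced S M N L h"
  shows tensor_lift_additive: "tensor_lift S M N L h \<in> additive_maps T L"
    and tensor_lift_tensor:
      "\<And>x y. \<lbrakk>x \<in> carrier M; y \<in> carrier N\<rbrakk> \<Longrightarrow> tensor_lift S M N L h (x \<otimes>\<^sub>T y) = h x y"
  using someI_ex[OF tensor_lift_exists[OF assms]] unfolding tensor_lift_def by blast+

text \<open>The common source of the left and the right action. It is enough to treat maps that send
  each defining relation to a defining relation, since either action takes a relation to one of the
  same kind.\<close>

lemma
  assumes keys: "\<And>p. p \<in> carrier M \<times> carrier N \<Longrightarrow> Poly_Mapping.keys (h p) \<subseteq> carrier M \<times> carrier N"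
    and rel: "\<And>c. c \<in> tensor_relations S M N \<Longrightarrow> frag_extend h c \<in> tensor_relations S M N"
  shows induced_additive: "(\<lambda>t. K <#>\<^bsub>F\<^esub> frag_extend h ` t) \<in> additive_maps T T"
    and induced_tensor: "\<And>x y. \<lbrakk>x \<in> carrier M; y \<in> carrier N\<rbrakk> \<Longrightarrow>
      K <#>\<^bsub>F\<^esub> frag_extend h ` (x \<otimes>\<^sub>T y) = K #>\<^bsub>F\<^esub> h (x, y)"
proof -
  let ?f = "frag_extend h"
  have "Poly_Mapping.keys (?f c) \<subseteq> carrier M \<times> carrier N"
    if "Poly_Mapping.keys c \<subseteq> carrier M \<times> carrier N" for c
    using keys_frag_extend[of h c] that keys by blast
  then have f: "?f \<in> hom F F" by (auto simp: hom_def frag_extend_add)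
  then interpret f: group_hom F F ?f by (simp add: group_hom_def group_hom_axioms_def)
  have "?f ` tensor_relations S M N \<subseteq> tensor_relations S M N" using rel by blast
  then have fK: "?f ` K \<subseteq> K"
    using f.generate_img[OF relations_carrier] F.mono_generate by blast
  have act: "K <#>\<^bsub>F\<^esub> ?f ` (K #>\<^bsub>F\<^esub> c) = K #>\<^bsub>F\<^esub> ?f c" if "c \<in> carrier F" for c
    by (rule F.set_mult_image_r_coset[OF f subgroup_K fK that])
  show "(\<lambda>t. K <#>\<^bsub>F\<^esub> ?f ` t) \<in> additive_maps T T"
  proof (rule additive_mapsI)
    fix t assume "t \<in> carrier T"
    then show "K <#>\<^bsub>F\<^esub> ?f ` t \<in> carrier T"
      using act f.hom_closed by (force simp: carrier_T simp del: carrier_free_Abelian_group_iff)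
  next
    fix t u assume "t \<in> carrier T" "u \<in> carrier T"
    then obtain c d where "c \<in> carrier F" "d \<in> carrier F" "t = K #>\<^bsub>F\<^esub> c" "u = K #>\<^bsub>F\<^esub> d"
      by (auto simp: carrier_T simp del: carrier_free_Abelian_group_iff)
    then show "K <#>\<^bsub>F\<^esub> ?f ` (t \<oplus>\<^bsub>T\<^esub> u) = (K <#>\<^bsub>F\<^esub> ?f ` t) \<oplus>\<^bsub>T\<^esub> (K <#>\<^bsub>F\<^esub> ?f ` u)"
      using F.m_closed[of c d] f.hom_closed
      by (simp add: act add_T frag_extend_add del: carrier_free_Abelian_group_iff)
  qed
  show "K <#>\<^bsub>F\<^esub> ?f ` (x \<otimes>\<^sub>T y) = K #>\<^bsub>F\<^esub> h (x, y)" if "x \<in> carrier M" "y \<in> carrier N" for x y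
    using that by (simp add: tensor_eq act)
qed

section \<open>The scalar actions on a tensor product\<close>

lemma
  assumes r: "r \<in> carrier R"
  shows smult_T_additive: "(\<lambda>t. r \<odot>\<^bsub>T\<^esub> t) \<in> additive_maps T T"
    and smult_T_tensor:
      "\<And>x y. \<lbrakk>x \<in> carrier M; y \<in> carrier N\<rbrakk> \<Longrightarrow> r \<odot>\<^bsub>T\<^esub> (x \<otimes>\<^sub>T y) = (r \<odot>\<^bsub>M\<^esub> x) \<otimes>\<^sub>T y"
proof -
  let ?h = "\<lambda>(x, y). frag_of (r \<odot>\<^bsub>M\<^esub> x, y)"
  have keys: "Poly_Mapping.keys (?h p) \<subseteq> carrier M \<times> carrier N" if "p \<in> carrier M \<times> carrier N" for p
    using that r by (auto simp: M.smult_closed)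
  have rel: "frag_extend ?h c \<in> tensor_relations S M N" if "c \<in> tensor_relations S M N" for c
    using that by (cases rule: relations_cases)
      (simp_all add: frag_extend_diff r M.smult_r_distr M.smult_rsmult_assoc[symmetric] relationI
        M.smult_closed)
  show "(\<lambda>t. r \<odot>\<^bsub>T\<^esub> t) \<in> additive_maps T T"
    unfolding tensor_simps(4) by (rule induced_additive[OF keys rel])
  show "r \<odot>\<^bsub>T\<^esub> (x \<otimes>\<^sub>T y) = (r \<odot>\<^bsub>M\<^esub> x) \<otimes>\<^sub>T y" if "x \<in> carrier M" "y \<in> carrier N" for x y
    unfolding tensor_simps(4) using induced_tensor[OF keys rel that] by (simp add: tensor_eq)
qed

lemma
  assumes q: "q \<in> carrier Q"
  shows rsmult_T_additive: "(\<lambda>t. t \<bullet>\<^bsub>T\<^esub> q) \<in> additive_maps T T"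
    and rsmult_T_tensor:
      "\<And>x y. \<lbrakk>x \<in> carrier M; y \<in> carrier N\<rbrakk> \<Longrightarrow> (x \<otimes>\<^sub>T y) \<bullet>\<^bsub>T\<^esub> q = x \<otimes>\<^sub>T (y \<bullet>\<^bsub>N\<^esub> q)"
proof -
  let ?h = "\<lambda>(x, y). frag_of (x, y \<bullet>\<^bsub>N\<^esub> q)"
  have keys: "Poly_Mapping.keys (?h p) \<subseteq> carrier M \<times> carrier N" if "p \<in> carrier M \<times> carrier N" for p
    using that q by (auto simp: N.rsmult_closed)
  have rel: "frag_extend ?h c \<in> tensor_relations S M N" if "c \<in> tensor_relations S M N" for c
    using that by (cases rule: relations_cases)
      (simp_all add: frag_extend_diff q N.rsmult_l_distr N.smult_rsmult_assoc relationI N.rsmult_closed)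
  show "(\<lambda>t. t \<bullet>\<^bsub>T\<^esub> q) \<in> additive_maps T T"
    unfolding tensor_simps(5) by (rule induced_additive[OF keys rel])
  show "(x \<otimes>\<^sub>T y) \<bullet>\<^bsub>T\<^esub> q = x \<otimes>\<^sub>T (y \<bullet>\<^bsub>N\<^esub> q)" if "x \<in> carrier M" "y \<in> carrier N" for x y
    unfolding tensor_simps(5) using induced_tensor[OF keys rel that] by (simp add: tensor_eq)
qed

text \<open>Closure and additivity in the tensor hold since each scalar acts by an additive map. In
  the remaining axioms both sides are additive in the tensor, so they reduce to pure tensors, where
  they are axioms for \<open>M\<close> or \<open>N\<close>.\<close>

lemma bimodule_T: "bimodule R Q T"
proof (rule bimoduleI[OF M.R.ring_axioms N.S.ring_axioms abelian_group_T])
  note tens = smult_T_tensor rsmult_T_tensor M.smult_closed N.rsmult_closed M.smult_l_distr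
    M.smult_assoc M.smult_one N.rsmult_r_distr N.rsmult_assoc N.rsmult_one tensor_add_left
    tensor_add_right
  show "r \<odot>\<^bsub>T\<^esub> t \<in> carrier T" if "r \<in> carrier R" "t \<in> carrier T" for r t
    using additive_maps_closed[OF smult_T_additive] that by blast
  show "t \<bullet>\<^bsub>T\<^esub> q \<in> carrier T" if "t \<in> carrier T" "q \<in> carrier Q" for q t
    using additive_maps_closed[OF rsmult_T_additive] that by blast
  show "r \<odot>\<^bsub>T\<^esub> (t \<oplus>\<^bsub>T\<^esub> u) = r \<odot>\<^bsub>T\<^esub> t \<oplus>\<^bsub>T\<^esub> r \<odot>\<^bsub>T\<^esub> u"
    if "r \<in> carrier R" "t \<in> carrier T" "u \<in> carrier T" for r t u
    using additive_maps_add[OF smult_T_additive] that by blast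
  show "(t \<oplus>\<^bsub>T\<^esub> u) \<bullet>\<^bsub>T\<^esub> q = t \<bullet>\<^bsub>T\<^esub> q \<oplus>\<^bsub>T\<^esub> u \<bullet>\<^bsub>T\<^esub> q"
    if "t \<in> carrier T" "u \<in> carrier T" "q \<in> carrier Q" for q t u
    using additive_maps_add[OF rsmult_T_additive] that by blast
  have id: "(\<lambda>t. t) \<in> additive_maps T T" by (simp add: additive_maps_def)
  show "(r \<oplus>\<^bsub>R\<^esub> s) \<odot>\<^bsub>T\<^esub> t = r \<odot>\<^bsub>T\<^esub> t \<oplus>\<^bsub>T\<^esub> s \<odot>\<^bsub>T\<^esub> t"
    if "r \<in> carrier R" "s \<in> carrier R" "t \<in> carrier T" for r s t
    by (rule additive_maps_tensor_eqI[OF abelian_group_T smult_T_additive[OF M.R.a_closed[OF that(1,2)]] 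
      additive_maps_sum[OF abelian_group_T smult_T_additive[OF that(1)] smult_T_additive[OF that(2)]] _ that(3)]) (simp_all add: tens that)
  show "(r \<otimes>\<^bsub>R\<^esub> s) \<odot>\<^bsub>T\<^esub> t = r \<odot>\<^bsub>T\<^esub> (s \<odot>\<^bsub>T\<^esub> t)"
    if "r \<in> carrier R" "s \<in> carrier R" "t \<in> carrier T" for r s t
    by (rule additive_maps_tensor_eqI[OF abelian_group_T smult_T_additive[OF M.R.m_closed[OF that(1,2)]] 
      additive_maps_comp[OF smult_T_additive[OF that(2)] smult_T_additive[OF that(1)]] _ that(3)]) (simp_all add: tens that)
  show "\<one>\<^bsub>R\<^esub> \<odot>\<^bsub>T\<^esub> t = t"
    if "t \<in> carrier T" for t
    by (rule additive_maps_tensor_eqI[OF abelian_group_T smult_T_additive[OF M.R.one_closed] id _ that(1)]) (simp_all add: tens that)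
  show "t \<bullet>\<^bsub>T\<^esub> (q \<oplus>\<^bsub>Q\<^esub> p) = t \<bullet>\<^bsub>T\<^esub> q \<oplus>\<^bsub>T\<^esub> t \<bullet>\<^bsub>T\<^esub> p"
    if "t \<in> carrier T" "q \<in> carrier Q" "p \<in> carrier Q" for q p t
    by (rule additive_maps_tensor_eqI[OF abelian_group_T rsmult_T_additive[OF N.S.a_closed[OF that(2,3)]] 
      additive_maps_sum[OF abelian_group_T rsmult_T_additive[OF that(2)] rsmult_T_additive[OF that(3)]] _ that(1)]) (simp_all add: tens that)
  show "t \<bullet>\<^bsub>T\<^esub> (q \<otimes>\<^bsub>Q\<^esub> p) = (t \<bullet>\<^bsub>T\<^esub> q) \<bullet>\<^bsub>T\<^esub> p"
    if "t \<in> carrier T" "q \<in> carrier Q" "p \<in> carrier Q" for q p t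
    by (rule additive_maps_tensor_eqI[OF abelian_group_T rsmult_T_additive[OF N.S.m_closed[OF that(2,3)]] 
      additive_maps_comp[OF rsmult_T_additive[OF that(2)] rsmult_T_additive[OF that(3)]] _ that(1)]) (simp_all add: tens that)
  show "t \<bullet>\<^bsub>T\<^esub> \<one>\<^bsub>Q\<^esub> = t"
    if "t \<in> carrier T" for t
    by (rule additive_maps_tensor_eqI[OF abelian_group_T rsmult_T_additive[OF N.S.one_closed] id _ that(1)]) (simp_all add: tens that)
  show "(r \<odot>\<^bsub>T\<^esub> t) \<bullet>\<^bsub>T\<^esub> q = r \<odot>\<^bsub>T\<^esub> (t \<bullet>\<^bsub>T\<^esub> q)"
    if "r \<in> carrier R" "t \<in> carrier T" "q \<in> carrier Q" for r t q
    by (rule additive_maps_tensor_eqI[OF abelian_group_T 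
      additive_maps_comp[OF smult_T_additive[OF that(1)] rsmult_T_additive[OF that(3)]] 
      additive_maps_comp[OF rsmult_T_additive[OF that(3)] smult_T_additive[OF that(1)]] _ that(2)]) (simp_all add: tens that)
qed

section \<open>Linearity of maps out of a tensor product\<close>

lemma tensor_lift_left_hom:
  fixes L :: "('r, 'p, 'z) module_scheme"
  assumes L: "left_module R L" and h: "balanced S M N L h"
    and lin: "\<And>r x y. \<lbrakk>r \<in> carrier R; x \<in> carrier M; y \<in> carrier N\<rbrakk> \<Longrightarrow> h (r \<odot>\<^bsub>M\<^esub> x) y = r \<odot>\<^bsub>L\<^esub> h x y"
  shows "tensor_lift S M N L h \<in> left_hom R T L"
proof -
  interpret L: left_module R L by fact
  note Lg = L.M.abelian_group_axioms
  note lift = tensor_lift_additive[OF Lg h] tensor_lift_tensor[OF Lg h]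
  show ?thesis
  proof (rule left_homI[OF lift(1)])
    fix r t assume r: "r \<in> carrier R" and t: "t \<in> carrier T"
    have "(\<lambda>x. r \<odot>\<^bsub>L\<^esub> x) \<in> additive_maps L L"
      by (rule additive_mapsI) (simp_all add: r L.smult_closed L.smult_r_distr)
    then show "tensor_lift S M N L h (r \<odot>\<^bsub>T\<^esub> t) = r \<odot>\<^bsub>L\<^esub> tensor_lift S M N L h t"
      by (intro additive_maps_tensor_eqI[OF Lg additive_maps_comp[OF smult_T_additive[OF r] lift(1)]
            additive_maps_comp[OF lift(1)] _ t])
        (simp_all add: smult_T_tensor lift(2) r M.smult_closed lin)
  qed
qed

lemma tensor_lift_right_hom:
  fixes L :: "('u, 't, 'p, 'z) bimodule_scheme"
  assumes L: "bimodule U Q L" and h: "balanced S M N L h"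
    and lin: "\<And>q x y. \<lbrakk>q \<in> carrier Q; x \<in> carrier M; y \<in> carrier N\<rbrakk> \<Longrightarrow> h x (y \<bullet>\<^bsub>N\<^esub> q) = h x y \<bullet>\<^bsub>L\<^esub> q"
  shows "tensor_lift S M N L h \<in> right_hom Q T L"
proof -
  note Lg = bimodule_abelian_group[OF L]
  note lift = tensor_lift_additive[OF Lg h] tensor_lift_tensor[OF Lg h]
  show ?thesis
  proof (rule right_homI[OF lift(1)])
    fix q t assume q: "q \<in> carrier Q" and t: "t \<in> carrier T"
    show "tensor_lift S M N L h (t \<bullet>\<^bsub>T\<^esub> q) = tensor_lift S M N L h t \<bullet>\<^bsub>L\<^esub> q"
      by (rule additive_maps_tensor_eqI[OF Lg additive_maps_comp[OF rsmult_T_additive[OF q] lift(1)]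
            additive_maps_comp[OF lift(1) bimodule_rsmult_additive[OF L q]] _ t])
        (simp_all add: rsmult_T_tensor lift(2) q N.rsmult_closed lin)
  qed
qed

lemma tensor_lift_bimodule_hom:
  fixes L :: "('r, 't, 'p, 'z) bimodule_scheme"
  assumes L: "bimodule R Q L" and h: "balanced S M N L h"
    and "\<And>r x y. \<lbrakk>r \<in> carrier R; x \<in> carrier M; y \<in> carrier N\<rbrakk> \<Longrightarrow> h (r \<odot>\<^bsub>M\<^esub> x) y = r \<odot>\<^bsub>L\<^esub> h x y"
    and "\<And>q x y. \<lbrakk>q \<in> carrier Q; x \<in> carrier M; y \<in> carrier N\<rbrakk> \<Longrightarrow> h x (y \<bullet>\<^bsub>N\<^esub> q) = h x y \<bullet>\<^bsub>L\<^esub> q"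
  shows "tensor_lift S M N L h \<in> bimodule_hom R Q T L"
  using tensor_lift_left_hom[OF _ h assms(3)] tensor_lift_right_hom[OF L h assms(4)] L
  by (auto simp: bimodule_def)

end

section \<open>Ring bimodules, duals and dual bases\<close>

lemma ring_bimodule_simps [simp]:
  "carrier (ring_bimodule A f g) = carrier A" "\<zero>\<^bsub>ring_bimodule A f g\<^esub> = \<zero>\<^bsub>A\<^esub>"
  "x \<oplus>\<^bsub>ring_bimodule A f g\<^esub> y = x \<oplus>\<^bsub>A\<^esub> y"
  "r \<odot>\<^bsub>ring_bimodule A f g\<^esub> x = f r \<otimes>\<^bsub>A\<^esub> x" "x \<bullet>\<^bsub>ring_bimodule A f g\<^esub> s = x \<otimes>\<^bsub>A\<^esub> g s"
  by (simp_all add: ring_bimodule_def)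

text \<open>A finite sum sees only the additive structure. Thus sums in \<open>A\<close> and in its
  various bimodule structures, or in a tensor square under different outer actions, can be exchanged
  freely.\<close>

lemma finsum_add_monoid_cong:
  assumes "carrier M = carrier N" "\<zero>\<^bsub>M\<^esub> = \<zero>\<^bsub>N\<^esub>" "ring.add M = ring.add N"
  shows "finsum M f I = finsum N f I"
  using assms by (simp add: finsum_def finprod_def)

lemma finsum_ring_bimodule [simp]: "finsum (ring_bimodule A f g) h I = finsum A h I"
  by (rule finsum_add_monoid_cong) (simp_all add: ring_bimodule_def)

lemma additive_maps_ring_bimodule [simp]:
  "additive_maps (ring_bimodule A f g) M = additive_maps A M"
  "additive_maps M (ring_bimodule A f g) = additive_maps M A"
  by (simp_all add: additive_maps_def)

lemma abelian_group_ring_bimodule: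
  assumes "abelian_group A"
  shows "abelian_group (ring_bimodule A f g)"
proof -
  interpret abelian_group A by fact
  show ?thesis
  proof (rule abelian_groupI)
    fix x assume "x \<in> carrier (ring_bimodule A f g)"
    then show "\<exists>y\<in>carrier (ring_bimodule A f g). y \<oplus>\<^bsub>ring_bimodule A f g\<^esub> x = \<zero>\<^bsub>ring_bimodule A f g\<^esub>"
      by (intro bexI[of _ "\<ominus>\<^bsub>A\<^esub> x"]) (simp_all add: l_neg)
  qed (simp_all add: a_ac)
qed

lemma bimodule_ring_bimodule:
  assumes "ring A" "ring R" "ring S" and f: "f \<in> ring_hom R A" and g: "g \<in> ring_hom S A"
  shows "bimodule R S (ring_bimodule A f g)"
proof -
  interpret A: ring A by fact
  note fs = ring_hom_closed[OF f] ring_hom_mult[OF f] ring_hom_add[OF f] ring_hom_one[OF f]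
  note gs = ring_hom_closed[OF g] ring_hom_mult[OF g] ring_hom_add[OF g] ring_hom_one[OF g]
  show ?thesis
    by (rule bimoduleI[OF assms(2,3) abelian_group_ring_bimodule[OF A.is_abelian_group]])
      (simp_all add: fs gs A.l_distr A.r_distr A.m_assoc)
qed

section \<open>Duals of bimodules\<close>

lemma right_dual_simps:
  "carrier (right_dual S M) = right_hom S M (ring_bimodule S id id) \<inter> extensional (carrier M)"
  "\<zero>\<^bsub>right_dual S M\<^esub> = (\<lambda>x\<in>carrier M. \<zero>\<^bsub>S\<^esub>)"
  "f \<oplus>\<^bsub>right_dual S M\<^esub> g = (\<lambda>x\<in>carrier M. f x \<oplus>\<^bsub>S\<^esub> g x)"
  "s \<odot>\<^bsub>right_dual S M\<^esub> f = (\<lambda>x\<in>carrier M. s \<otimes>\<^bsub>S\<^esub> f x)"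
  "f \<bullet>\<^bsub>right_dual S M\<^esub> r = (\<lambda>x\<in>carrier M. f (r \<odot>\<^bsub>M\<^esub> x))"
  by (simp_all add: right_dual_def)

lemma left_dual_simps:
  "carrier (left_dual R M) = left_hom R M (ring_bimodule R id id) \<inter> extensional (carrier M)"
  "\<zero>\<^bsub>left_dual R M\<^esub> = (\<lambda>x\<in>carrier M. \<zero>\<^bsub>R\<^esub>)"
  "f \<oplus>\<^bsub>left_dual R M\<^esub> g = (\<lambda>x\<in>carrier M. f x \<oplus>\<^bsub>R\<^esub> g x)"
  "s \<odot>\<^bsub>left_dual R M\<^esub> f = (\<lambda>x\<in>carrier M. f (x \<bullet>\<^bsub>M\<^esub> s))"
  "f \<bullet>\<^bsub>left_dual R M\<^esub> r = (\<lambda>x\<in>carrier M. f x \<otimes>\<^bsub>R\<^esub> r)"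
  by (simp_all add: left_dual_def)

lemma bimodule_right_dual:
  fixes M :: "('r, 's, 'm, 'x) bimodule_scheme"
  assumes "bimodule R S M"
  shows "bimodule S R (right_dual S M)"
proof -
  interpret bimodule R S M by fact
  interpret S: ring S by (rule S.ring_axioms)
  let ?D = "right_dual S M"
  have memI: "(\<lambda>x\<in>carrier M. h x) \<in> carrier ?D"
    if "\<And>x. x \<in> carrier M \<Longrightarrow> h x \<in> carrier S"
      "\<And>x y. \<lbrakk>x \<in> carrier M; y \<in> carrier M\<rbrakk> \<Longrightarrow> h (x \<oplus>\<^bsub>M\<^esub> y) = h x \<oplus>\<^bsub>S\<^esub> h y"
      "\<And>x s. \<lbrakk>x \<in> carrier M; s \<in> carrier S\<rbrakk> \<Longrightarrow> h (x \<bullet>\<^bsub>M\<^esub> s) = h x \<otimes>\<^bsub>S\<^esub> s" for h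
    using that by (simp add: right_dual_simps right_hom_def rsmult_closed)
  have cl: "f x \<in> carrier S" if "f \<in> carrier ?D" "x \<in> carrier M" for f x
    using that by (auto simp: right_dual_simps right_hom_def)
  have add: "f (x \<oplus>\<^bsub>M\<^esub> y) = f x \<oplus>\<^bsub>S\<^esub> f y" if "f \<in> carrier ?D" "x \<in> carrier M" "y \<in> carrier M" for f x y
    using that by (auto simp: right_dual_simps right_hom_def)
  have lin: "f (x \<bullet>\<^bsub>M\<^esub> s) = f x \<otimes>\<^bsub>S\<^esub> s" if "f \<in> carrier ?D" "x \<in> carrier M" "s \<in> carrier S" for f x s
    using that by (auto simp: right_dual_simps right_hom_def)
  have eqI: "f = g" if "f \<in> extensional (carrier M)" "g \<in> extensional (carrier M)"
    "\<And>x. x \<in> carrier M \<Longrightarrow> f x = g x" for f g :: "'m \<Rightarrow> 's"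
    using that by (rule extensionalityI)
  have ext: "f \<in> extensional (carrier M)" if "f \<in> carrier ?D" for f
    using that by (simp add: right_dual_simps)
  have zero_cl: "\<zero>\<^bsub>?D\<^esub> \<in> carrier ?D"
    unfolding right_dual_simps(2) by (rule memI) simp_all
  have add_cl: "f \<oplus>\<^bsub>?D\<^esub> g \<in> carrier ?D" if "f \<in> carrier ?D" "g \<in> carrier ?D" for f g
    unfolding right_dual_simps(3)
    by (rule memI) (simp_all add: that cl add lin S.a_ac S.l_distr)
  have smult_cl: "s \<odot>\<^bsub>?D\<^esub> f \<in> carrier ?D" if "s \<in> carrier S" "f \<in> carrier ?D" for s f
    unfolding right_dual_simps(4)
    by (rule memI) (simp_all add: that cl add lin S.m_assoc S.r_distr)
  have rsmult_cl: "f \<bullet>\<^bsub>?D\<^esub> r \<in> carrier ?D" if "r \<in> carrier R" "f \<in> carrier ?D" for r f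
    unfolding right_dual_simps(5)
    by (rule memI)
      (simp_all add: that cl add lin smult_closed smult_r_distr smult_rsmult_assoc[symmetric])
  note cls = cl ext memI zero_cl add_cl smult_cl rsmult_cl
  have ag: "abelian_group ?D"
  proof (rule abelian_groupI)
    fix f assume f: "f \<in> carrier ?D"
    have "(\<lambda>x\<in>carrier M. \<ominus>\<^bsub>S\<^esub> f x) \<in> carrier ?D"
      by (rule memI) (simp_all add: f cl add lin S.minus_add S.l_minus)
    moreover have "(\<lambda>x\<in>carrier M. \<ominus>\<^bsub>S\<^esub> f x) \<oplus>\<^bsub>?D\<^esub> f = \<zero>\<^bsub>?D\<^esub>"
      by (rule eqI) (simp_all add: right_dual_simps(2-) f cl S.l_neg)
    ultimately show "\<exists>g\<in>carrier ?D. g \<oplus>\<^bsub>?D\<^esub> f = \<zero>\<^bsub>?D\<^esub>" by blast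
  next
    fix f g h assume "f \<in> carrier ?D" "g \<in> carrier ?D" "h \<in> carrier ?D"
    then show "(f \<oplus>\<^bsub>?D\<^esub> g) \<oplus>\<^bsub>?D\<^esub> h = f \<oplus>\<^bsub>?D\<^esub> (g \<oplus>\<^bsub>?D\<^esub> h)"
      by (intro eqI) (simp_all add: right_dual_simps(2-) cl S.a_assoc)
  next
    fix f g assume "f \<in> carrier ?D" "g \<in> carrier ?D"
    then show "f \<oplus>\<^bsub>?D\<^esub> g = g \<oplus>\<^bsub>?D\<^esub> f"
      by (intro eqI) (simp_all add: right_dual_simps(2-) cl S.a_comm)
  next
    fix f assume f: "f \<in> carrier ?D"
    show "\<zero>\<^bsub>?D\<^esub> \<oplus>\<^bsub>?D\<^esub> f = f"
      by (rule eqI) (simp_all add: right_dual_simps(2-) ext[OF f] cl[OF f])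
  qed (fact zero_cl add_cl)+
  show ?thesis
    by (rule bimoduleI[OF S.ring_axioms R.ring_axioms ag]; (intro smult_cl rsmult_cl; assumption | rule eqI))
      (simp_all add: right_dual_simps(2-) cl add ext smult_closed smult_l_distr smult_assoc smult_one
        S.l_distr S.r_distr S.m_assoc)
qed

lemma bimodule_left_dual:
  fixes M :: "('r, 's, 'm, 'x) bimodule_scheme"
  assumes "bimodule R S M"
  shows "bimodule S R (left_dual R M)"
proof -
  interpret bimodule R S M by fact
  interpret R: ring R by (rule R.ring_axioms)
  let ?D = "left_dual R M"
  have memI: "(\<lambda>x\<in>carrier M. h x) \<in> carrier ?D"
    if "\<And>x. x \<in> carrier M \<Longrightarrow> h x \<in> carrier R"
      "\<And>x y. \<lbrakk>x \<in> carrier M; y \<in> carrier M\<rbrakk> \<Longrightarrow> h (x \<oplus>\<^bsub>M\<^esub> y) = h x \<oplus>\<^bsub>R\<^esub> h y"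
      "\<And>x r. \<lbrakk>x \<in> carrier M; r \<in> carrier R\<rbrakk> \<Longrightarrow> h (r \<odot>\<^bsub>M\<^esub> x) = r \<otimes>\<^bsub>R\<^esub> h x" for h
    using that by (simp add: left_dual_simps left_hom_def smult_closed)
  have cl: "f x \<in> carrier R" if "f \<in> carrier ?D" "x \<in> carrier M" for f x
    using that by (auto simp: left_dual_simps left_hom_def)
  have add: "f (x \<oplus>\<^bsub>M\<^esub> y) = f x \<oplus>\<^bsub>R\<^esub> f y" if "f \<in> carrier ?D" "x \<in> carrier M" "y \<in> carrier M" for f x y
    using that by (auto simp: left_dual_simps left_hom_def)
  have lin: "f (r \<odot>\<^bsub>M\<^esub> x) = r \<otimes>\<^bsub>R\<^esub> f x" if "f \<in> carrier ?D" "x \<in> carrier M" "r \<in> carrier R" for f x r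
    using that by (auto simp: left_dual_simps left_hom_def)
  have eqI: "f = g" if "f \<in> extensional (carrier M)" "g \<in> extensional (carrier M)"
    "\<And>x. x \<in> carrier M \<Longrightarrow> f x = g x" for f g :: "'m \<Rightarrow> 'r"
    using that by (rule extensionalityI)
  have ext: "f \<in> extensional (carrier M)" if "f \<in> carrier ?D" for f
    using that by (simp add: left_dual_simps)
  have zero_cl: "\<zero>\<^bsub>?D\<^esub> \<in> carrier ?D"
    unfolding left_dual_simps(2) by (rule memI) simp_all
  have add_cl: "f \<oplus>\<^bsub>?D\<^esub> g \<in> carrier ?D" if "f \<in> carrier ?D" "g \<in> carrier ?D" for f g
    unfolding left_dual_simps(3)
    by (rule memI) (simp_all add: that cl add lin R.a_ac R.r_distr)
  have smult_cl: "s \<odot>\<^bsub>?D\<^esub> f \<in> carrier ?D" if "s \<in> carrier S" "f \<in> carrier ?D" for s f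
    unfolding left_dual_simps(4)
    by (rule memI) (simp_all add: that cl add lin rsmult_closed rsmult_l_distr smult_rsmult_assoc)
  have rsmult_cl: "f \<bullet>\<^bsub>?D\<^esub> r \<in> carrier ?D" if "r \<in> carrier R" "f \<in> carrier ?D" for r f
    unfolding left_dual_simps(5)
    by (rule memI) (simp_all add: that cl add lin R.m_assoc R.l_distr)
  have ag: "abelian_group ?D"
  proof (rule abelian_groupI)
    fix f assume f: "f \<in> carrier ?D"
    have "(\<lambda>x\<in>carrier M. \<ominus>\<^bsub>R\<^esub> f x) \<in> carrier ?D"
      by (rule memI) (simp_all add: f cl add lin R.minus_add R.r_minus)
    moreover have "(\<lambda>x\<in>carrier M. \<ominus>\<^bsub>R\<^esub> f x) \<oplus>\<^bsub>?D\<^esub> f = \<zero>\<^bsub>?D\<^esub>"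
      by (rule eqI) (simp_all add: left_dual_simps(2-) f cl R.l_neg)
    ultimately show "\<exists>g\<in>carrier ?D. g \<oplus>\<^bsub>?D\<^esub> f = \<zero>\<^bsub>?D\<^esub>" by blast
  next
    fix f g h assume "f \<in> carrier ?D" "g \<in> carrier ?D" "h \<in> carrier ?D"
    then show "(f \<oplus>\<^bsub>?D\<^esub> g) \<oplus>\<^bsub>?D\<^esub> h = f \<oplus>\<^bsub>?D\<^esub> (g \<oplus>\<^bsub>?D\<^esub> h)"
      by (intro eqI) (simp_all add: left_dual_simps(2-) cl R.a_assoc)
  next
    fix f g assume "f \<in> carrier ?D" "g \<in> carrier ?D"
    then show "f \<oplus>\<^bsub>?D\<^esub> g = g \<oplus>\<^bsub>?D\<^esub> f"
      by (intro eqI) (simp_all add: left_dual_simps(2-) cl R.a_comm)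
  next
    fix f assume f: "f \<in> carrier ?D"
    show "\<zero>\<^bsub>?D\<^esub> \<oplus>\<^bsub>?D\<^esub> f = f"
      by (rule eqI) (simp_all add: left_dual_simps(2-) ext[OF f] cl[OF f])
  qed (fact zero_cl add_cl)+
  show ?thesis
    by (rule bimoduleI[OF S.ring_axioms R.ring_axioms ag]; (intro smult_cl rsmult_cl; assumption | rule eqI))
      (simp_all add: left_dual_simps(2-) cl add ext rsmult_closed rsmult_r_distr rsmult_assoc
        rsmult_one R.l_distr R.r_distr R.m_assoc)
qed

text \<open>The identity of \<open>P\<close> is lifted along the surjection onto \<open>P\<close>
  from the free module on a finite generating set \<open>G\<close>; the coordinates of the lift are
  the functionals dual to \<open>G\<close>. The generators serve as their own indices.\<close>

lemma dual_basis:
  fixes P :: "('r, 'm, 'x) module_scheme"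
  assumes "left_module R P" "finitely_generated R P" "projective R P"
  obtains G and f :: "'m \<Rightarrow> 'm \<Rightarrow> 'r" where "finite G" "G \<subseteq> carrier P"
    and "\<And>g. g \<in> G \<Longrightarrow> f g \<in> left_hom R P (ring_bimodule R id id)"
    and "\<And>x. x \<in> carrier P \<Longrightarrow> (\<Oplus>\<^bsub>P\<^esub>g\<in>G. f g x \<odot>\<^bsub>P\<^esub> g) = x"
proof -
  interpret P: left_module R P by fact
  obtain G where G: "finite G" "G \<subseteq> carrier P"
    and gen: "\<And>x. x \<in> carrier P \<Longrightarrow> \<exists>c\<in>G \<rightarrow> carrier R. x = (\<Oplus>\<^bsub>P\<^esub>g\<in>G. c g \<odot>\<^bsub>P\<^esub> g)"
    using assms(2) unfolding finitely_generated_def by blast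
  \<comment> \<open>The free module on \<open>G\<close>, realized by functions on the element type
    of \<open>P\<close> so that it has the type over which \<open>projective\<close>
    quantifies.\<close>
  define L :: "('r, 'm \<Rightarrow> 'r) module" where "L =
    \<lparr>carrier = G \<rightarrow>\<^sub>E carrier R, monoid.mult = undefined, one = undefined,
     ring.zero = (\<lambda>g\<in>G. \<zero>\<^bsub>R\<^esub>), ring.add = (\<lambda>c d. \<lambda>g\<in>G. c g \<oplus>\<^bsub>R\<^esub> d g),
     smult = (\<lambda>r c. \<lambda>g\<in>G. r \<otimes>\<^bsub>R\<^esub> c g)\<rparr>"
  \<comment> \<open>\<open>P\<close> stripped of additional record fields: the target in
    \<open>projective\<close> is a plain \<open>module\<close> record, whereas \<open>P\<close> may
    be a bimodule.\<close>
  define N :: "('r, 'm) module" where "N =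
    \<lparr>carrier = carrier P, monoid.mult = undefined, one = undefined,
     ring.zero = \<zero>\<^bsub>P\<^esub>, ring.add = ring.add P, smult = smult P\<rparr>"
  have L_simps: "carrier L = G \<rightarrow>\<^sub>E carrier R" "\<zero>\<^bsub>L\<^esub> = (\<lambda>g\<in>G. \<zero>\<^bsub>R\<^esub>)"
    "c \<oplus>\<^bsub>L\<^esub> d = (\<lambda>g\<in>G. c g \<oplus>\<^bsub>R\<^esub> d g)" "r \<odot>\<^bsub>L\<^esub> c = (\<lambda>g\<in>G. r \<otimes>\<^bsub>R\<^esub> c g)" for c d r
    by (simp_all add: L_def)
  have N_simps: "carrier N = carrier P" "\<zero>\<^bsub>N\<^esub> = \<zero>\<^bsub>P\<^esub>"
    "x \<oplus>\<^bsub>N\<^esub> y = x \<oplus>\<^bsub>P\<^esub> y" "r \<odot>\<^bsub>N\<^esub> x = r \<odot>\<^bsub>P\<^esub> x" for x y r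
    by (simp_all add: N_def)
  have c_cl: "c g \<in> carrier R" if "c \<in> carrier L" "g \<in> G" for c g
    using that by (auto simp: L_simps)
  have ext: "c \<in> extensional G" if "c \<in> carrier L" for c
    using that by (simp add: L_simps PiE_def)
  have eqI: "c = d" if "c \<in> extensional G" "d \<in> extensional G" "\<And>g. g \<in> G \<Longrightarrow> c g = d g"
    for c d :: "'m \<Rightarrow> 'r"
    using that by (rule extensionalityI)
  have "abelian_group L"
  proof (rule abelian_groupI)
    fix c assume c: "c \<in> carrier L"
    have "(\<lambda>g\<in>G. \<ominus>\<^bsub>R\<^esub> c g) \<in> carrier L" using c c_cl by (auto simp: L_simps)
    moreover have "(\<lambda>g\<in>G. \<ominus>\<^bsub>R\<^esub> c g) \<oplus>\<^bsub>L\<^esub> c = \<zero>\<^bsub>L\<^esub>"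
      by (rule eqI) (simp_all add: L_simps(2-) c_cl[OF c] P.R.l_neg)
    ultimately show "\<exists>d\<in>carrier L. d \<oplus>\<^bsub>L\<^esub> c = \<zero>\<^bsub>L\<^esub>" by blast
  next
    fix c d e assume "c \<in> carrier L" "d \<in> carrier L" "e \<in> carrier L"
    then show "(c \<oplus>\<^bsub>L\<^esub> d) \<oplus>\<^bsub>L\<^esub> e = c \<oplus>\<^bsub>L\<^esub> (d \<oplus>\<^bsub>L\<^esub> e)"
      by (intro eqI) (simp_all add: L_simps(2-) c_cl P.R.a_assoc)
  next
    fix c d assume "c \<in> carrier L" "d \<in> carrier L"
    then show "c \<oplus>\<^bsub>L\<^esub> d = d \<oplus>\<^bsub>L\<^esub> c"
      by (intro eqI) (simp_all add: L_simps(2-) c_cl P.R.a_comm)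
  next
    fix c assume c: "c \<in> carrier L"
    show "\<zero>\<^bsub>L\<^esub> \<oplus>\<^bsub>L\<^esub> c = c"
      by (rule eqI) (simp_all add: L_simps(2-) ext[OF c] c_cl[OF c])
  qed (auto simp: L_simps)
  moreover have "left_module_axioms R L"
  proof
    show "r \<odot>\<^bsub>L\<^esub> c \<in> carrier L" if "r \<in> carrier R" "c \<in> carrier L" for r c
      using that by (auto simp: L_simps)
  qed (rule eqI; simp add: L_simps(2-) c_cl ext P.R.l_distr P.R.r_distr P.R.m_assoc)+
  ultimately have L: "left_module R L"
    by (intro left_module.intro P.R.ring_axioms)
  have "abelian_group N"
  proof (rule abelian_groupI)
    fix x assume "x \<in> carrier N"
    then show "\<exists>y\<in>carrier N. y \<oplus>\<^bsub>N\<^esub> x = \<zero>\<^bsub>N\<^esub>"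
      unfolding N_simps using P.M.l_neg P.M.a_inv_closed by blast
  qed (simp_all add: N_simps P.M.a_ac)
  moreover have "left_module_axioms R N"
    by unfold_locales
      (simp_all add: N_simps P.smult_closed P.smult_l_distr P.smult_r_distr P.smult_assoc P.smult_one)
  ultimately have N: "left_module R N"
    by (intro left_module.intro P.R.ring_axioms)
  have Gc: "g \<in> carrier P" if "g \<in> G" for g using G(2) that by blast
  note Pg = P.M.abelian_group_axioms
  define p where "p c = (\<Oplus>\<^bsub>P\<^esub>g\<in>G. c g \<odot>\<^bsub>P\<^esub> g)" for c
  have p: "p \<in> left_hom R L N"
  proof (rule left_homI, rule additive_mapsI)
    show "p c \<in> carrier N" if "c \<in> carrier L" for c
      unfolding p_def N_simps using that by (intro P.M.finsum_closed) (auto simp: c_cl Gc P.smult_closed)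
  next
    fix c d assume cd: "c \<in> carrier L" "d \<in> carrier L"
    have "p (c \<oplus>\<^bsub>L\<^esub> d) = (\<Oplus>\<^bsub>P\<^esub>g\<in>G. c g \<odot>\<^bsub>P\<^esub> g \<oplus>\<^bsub>P\<^esub> d g \<odot>\<^bsub>P\<^esub> g)"
      unfolding p_def using cd
      by (intro P.M.finsum_cong') (auto simp: L_simps(3) c_cl Gc P.smult_closed P.smult_l_distr)
    also have "\<dots> = p c \<oplus>\<^bsub>P\<^esub> p d"
      unfolding p_def using cd by (intro P.M.finsum_addf) (auto simp: c_cl Gc P.smult_closed)
    finally show "p (c \<oplus>\<^bsub>L\<^esub> d) = p c \<oplus>\<^bsub>N\<^esub> p d" by (simp add: N_simps)
  next
    fix r c assume rc: "r \<in> carrier R" "c \<in> carrier L"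
    have "p (r \<odot>\<^bsub>L\<^esub> c) = (\<Oplus>\<^bsub>P\<^esub>g\<in>G. r \<odot>\<^bsub>P\<^esub> (c g \<odot>\<^bsub>P\<^esub> g))"
      unfolding p_def using rc
      by (intro P.M.finsum_cong') (auto simp: L_simps(4) c_cl Gc P.smult_closed P.smult_assoc)
    also have "\<dots> = r \<odot>\<^bsub>P\<^esub> p c"
      unfolding p_def
      by (rule additive_maps_finsum[OF Pg Pg additive_mapsI, symmetric])
        (use rc in \<open>auto simp: c_cl Gc P.smult_closed P.smult_r_distr\<close>)
    finally show "p (r \<odot>\<^bsub>L\<^esub> c) = r \<odot>\<^bsub>N\<^esub> p c" by (simp add: N_simps)
  qed
  have "p ` carrier L = carrier N"
  proof
    show "p ` carrier L \<subseteq> carrier N" using p by (auto simp: left_hom_def)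
    show "carrier N \<subseteq> p ` carrier L"
    proof
      fix x assume "x \<in> carrier N"
      then obtain c where c: "c \<in> G \<rightarrow> carrier R" "x = (\<Oplus>\<^bsub>P\<^esub>g\<in>G. c g \<odot>\<^bsub>P\<^esub> g)"
        using gen by (auto simp: N_simps)
      \<comment> \<open>Coefficients from \<open>finitely_generated\<close> are arbitrary outside
        \<open>G\<close>, while elements of \<open>L\<close> are extensional.\<close>
      have "p (restrict c G) = x"
        unfolding p_def c(2) using funcset_mem[OF c(1)]
        by (intro P.M.finsum_cong') (auto simp: Gc P.smult_closed)
      moreover have "restrict c G \<in> carrier L" using c(1) by (auto simp: L_simps)
      ultimately show "x \<in> p ` carrier L" by blast
    qed
  qed
  moreover have "(\<lambda>x. x) \<in> left_hom R P N" by (simp add: left_hom_def N_simps)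
  \<comment> \<open>The lifting property is used for the identity of \<open>P\<close>, read as a map
    into \<open>N\<close>.\<close>
  ultimately have "\<exists>h\<in>left_hom R P L. \<forall>x\<in>carrier P. p (h x) = x"
    using assms(3)[unfolded projective_def, THEN spec, THEN spec, THEN bspec, OF p, THEN bspec] L N by simp
  then obtain h where h: "h \<in> left_hom R P L" and ph: "\<And>x. x \<in> carrier P \<Longrightarrow> p (h x) = x"
    by blast
  have h_cl: "h x \<in> carrier L" if "x \<in> carrier P" for x
    using h that by (auto simp: left_hom_def)
  show ?thesis
  proof (rule that[of G "\<lambda>g x. h x g"])
    fix g assume g: "g \<in> G"
    show "(\<lambda>x. h x g) \<in> left_hom R P (ring_bimodule R id id)"
    proof (rule left_homI, rule additive_mapsI)
      show "h x g \<in> carrier (ring_bimodule R id id)" if "x \<in> carrier P" for x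
        using c_cl[OF h_cl[OF that] g] by simp
      show "h (x \<oplus>\<^bsub>P\<^esub> y) g = h x g \<oplus>\<^bsub>ring_bimodule R id id\<^esub> h y g" if "x \<in> carrier P" "y \<in> carrier P" for x y
        using additive_maps_add[OF left_hom_additive[OF h] that] g by (simp add: L_simps)
      show "h (r \<odot>\<^bsub>P\<^esub> x) g = r \<odot>\<^bsub>ring_bimodule R id id\<^esub> h x g" if "r \<in> carrier R" "x \<in> carrier P" for r x
        using left_hom_smult[OF h that] g by (simp add: L_simps)
    qed
  next
    show "(\<Oplus>\<^bsub>P\<^esub>g\<in>G. h x g \<odot>\<^bsub>P\<^esub> g) = x" if "x \<in> carrier P" for x
      using ph[OF that] by (simp add: p_def)
  qed (fact G)+
qed

lemma left_dual_basis:
  fixes M :: "('r, 's, 'm, 'x) bimodule_scheme"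
  assumes M: "bimodule R S M" and "left_fg_projective R M"
  obtains G and \<beta> :: "'m \<Rightarrow> 'm \<Rightarrow> 'r" where "finite G" "G \<subseteq> carrier M"
    and "\<And>g. g \<in> G \<Longrightarrow> \<beta> g \<in> carrier (left_dual R M)"
    and "\<And>x. x \<in> carrier M \<Longrightarrow> (\<Oplus>\<^bsub>M\<^esub>g\<in>G. \<beta> g x \<odot>\<^bsub>M\<^esub> g) = x"
proof -
  interpret M: bimodule R S M by fact
  obtain G and f :: "'m \<Rightarrow> 'm \<Rightarrow> 'r" where G: "finite G" "G \<subseteq> carrier M"
    and f: "\<And>g. g \<in> G \<Longrightarrow> f g \<in> left_hom R M (ring_bimodule R id id)"
    and eq: "\<And>x. x \<in> carrier M \<Longrightarrow> (\<Oplus>\<^bsub>M\<^esub>g\<in>G. f g x \<odot>\<^bsub>M\<^esub> g) = x"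
    using dual_basis[of R M] assms unfolding left_fg_projective_def bimodule_def by blast
  have f_cl: "f g x \<in> carrier R" if "g \<in> G" "x \<in> carrier M" for g x
    using f[OF that(1)] that(2) by (auto simp: left_hom_def)
  show ?thesis
  proof (rule that[OF G, of "\<lambda>g. restrict (f g) (carrier M)"])
    show "restrict (f g) (carrier M) \<in> carrier (left_dual R M)" if "g \<in> G" for g
      using f[OF that] by (auto simp: left_dual_simps left_hom_def M.smult_closed)
    show "(\<Oplus>\<^bsub>M\<^esub>g\<in>G. restrict (f g) (carrier M) x \<odot>\<^bsub>M\<^esub> g) = x" if x: "x \<in> carrier M" for x
      using eq[OF x] x by simp
  qed
qed

lemma opposite_ring_simps [simp]:
  "carrier (opposite_ring R) = carrier R" "\<zero>\<^bsub>opposite_ring R\<^esub> = \<zero>\<^bsub>R\<^esub>" "\<one>\<^bsub>opposite_ring R\<^esub> = \<one>\<^bsub>R\<^esub>"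
  "x \<oplus>\<^bsub>opposite_ring R\<^esub> y = x \<oplus>\<^bsub>R\<^esub> y" "x \<otimes>\<^bsub>opposite_ring R\<^esub> y = y \<otimes>\<^bsub>R\<^esub> x"
  by (simp_all add: opposite_ring_def)

lemma ring_opposite_ring:
  assumes "ring R"
  shows "ring (opposite_ring R)"
proof -
  interpret ring R by fact
  have "abelian_group (opposite_ring R)"
  proof (rule abelian_groupI)
    fix x assume "x \<in> carrier (opposite_ring R)"
    then show "\<exists>y\<in>carrier (opposite_ring R). y \<oplus>\<^bsub>opposite_ring R\<^esub> x = \<zero>\<^bsub>opposite_ring R\<^esub>"
      by (intro bexI[of _ "\<ominus>\<^bsub>R\<^esub> x"]) (simp_all add: l_neg)
  qed (simp_all add: a_ac)
  moreover have "monoid (opposite_ring R)"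
    by (rule monoidI) (simp_all add: m_assoc)
  ultimately show ?thesis
    by (rule ringI) (simp_all add: l_distr r_distr)
qed

text \<open>The dual basis of the corresponding left module over the opposite ring; a left linear
  functional there is a right linear functional here, and restricting it to the carrier makes it an
  element of \<open>right_dual\<close>.\<close>

lemma right_dual_basis:
  fixes M :: "('r, 's, 'm, 'x) bimodule_scheme"
  assumes M: "bimodule R S M" and "right_fg_projective S M"
  obtains G and \<alpha> :: "'m \<Rightarrow> 'm \<Rightarrow> 's" where "finite G" "G \<subseteq> carrier M"
    and "\<And>g. g \<in> G \<Longrightarrow> \<alpha> g \<in> carrier (right_dual S M)"
    and "\<And>x. x \<in> carrier M \<Longrightarrow> (\<Oplus>\<^bsub>M\<^esub>g\<in>G. g \<bullet>\<^bsub>M\<^esub> \<alpha> g x) = x"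
proof -
  interpret M: bimodule R S M by fact
  let ?S = "opposite_ring S" and ?M = "right_as_left M"
  have simps: "carrier ?M = carrier M" "\<zero>\<^bsub>?M\<^esub> = \<zero>\<^bsub>M\<^esub>" "ring.add ?M = ring.add M"
    "s \<odot>\<^bsub>?M\<^esub> x = x \<bullet>\<^bsub>M\<^esub> s" for s x
    by (simp_all add: right_as_left_def)
  have fs: "finsum ?M f I = finsum M f I" for f :: "'m \<Rightarrow> 'm" and I
    by (rule finsum_add_monoid_cong) (simp_all add: simps)
  have "abelian_group ?M"
  proof (rule abelian_groupI)
    fix x assume "x \<in> carrier ?M"
    then show "\<exists>y\<in>carrier ?M. y \<oplus>\<^bsub>?M\<^esub> x = \<zero>\<^bsub>?M\<^esub>"
      unfolding simps using M.M.l_neg M.M.a_inv_closed by blast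
  qed (simp_all add: simps M.M.a_ac)
  moreover have "left_module_axioms ?S ?M"
    by unfold_locales
      (simp_all add: simps M.rsmult_closed M.rsmult_l_distr M.rsmult_r_distr M.rsmult_assoc M.rsmult_one)
  ultimately have lm: "left_module ?S ?M"
    by (intro left_module.intro ring_opposite_ring M.S.ring_axioms)
  obtain G and f :: "'m \<Rightarrow> 'm \<Rightarrow> 's" where G: "finite G" "G \<subseteq> carrier M"
    and f: "\<And>g. g \<in> G \<Longrightarrow> f g \<in> left_hom ?S ?M (ring_bimodule ?S id id)"
    and eq: "\<And>x. x \<in> carrier M \<Longrightarrow> (\<Oplus>\<^bsub>M\<^esub>g\<in>G. g \<bullet>\<^bsub>M\<^esub> f g x) = x"
    using dual_basis[OF lm] assms(2) unfolding right_fg_projective_def simps fs by blast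
  show ?thesis
  proof (rule that[OF G, of "\<lambda>g. restrict (f g) (carrier M)"])
    show "restrict (f g) (carrier M) \<in> carrier (right_dual S M)" if "g \<in> G" for g
      using f[OF that] by (auto simp: right_dual_simps left_hom_def right_hom_def M.rsmult_closed simps)
    show "(\<Oplus>\<^bsub>M\<^esub>g\<in>G. g \<bullet>\<^bsub>M\<^esub> restrict (f g) (carrier M) x) = x" if x: "x \<in> carrier M" for x
      using eq[OF x] x by simp
  qed
qed

section \<open>The endomorphism ring, the dual and the tensor square of a ring extension\<close>

context ring_extension
begin

abbreviation AB where "AB \<equiv> ring_bimodule A id \<phi>"
abbreviation BA where "BA \<equiv> ring_bimodule A \<phi> id"
abbreviation T where "T \<equiv> tensor_product B AB BA"
abbreviation tens where "tens \<equiv> pure_tensor B AB BA"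
abbreviation T_AB where "T_AB \<equiv> tensor_product B AB (ring_bimodule A \<phi> \<phi>)"
abbreviation T_BA where "T_BA \<equiv> tensor_product B (ring_bimodule A \<phi> \<phi>) BA"
abbreviation D where "D \<equiv> right_dual B AB"
abbreviation E where "E \<equiv> right_End B (ring_bimodule A \<phi> \<phi>)"

lemmas phi_simps = ring_hom_closed[OF hom] ring_hom_mult[OF hom] ring_hom_add[OF hom] ring_hom_one[OF hom]

lemma id_ring_hom: "id \<in> ring_hom A A"
  by (auto intro!: ring_hom_memI)

lemma bimodule_AB: "bimodule A B AB" and bimodule_BA: "bimodule B A BA"
  by (intro bimodule_ring_bimodule A.ring_axioms B.ring_axioms hom id_ring_hom)+

lemma additive_maps_phi: "\<phi> \<in> additive_maps B A"
  by (rule additive_mapsI) (simp_all add: phi_simps)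

lemma additive_maps_lmult: "a \<in> carrier A \<Longrightarrow> (\<lambda>x. a \<otimes>\<^bsub>A\<^esub> x) \<in> additive_maps A A"
  by (rule additive_mapsI) (simp_all add: A.r_distr)

lemma additive_maps_rmult: "a \<in> carrier A \<Longrightarrow> (\<lambda>x. x \<otimes>\<^bsub>A\<^esub> a) \<in> additive_maps A A"
  by (rule additive_mapsI) (simp_all add: A.l_distr)

sublocale TT: tensor_factors A B A AB BA
  by (rule tensor_factors.intro[OF bimodule_AB bimodule_BA])

lemma bimodule_T: "bimodule A A T"
  by (rule TT.bimodule_T)

section \<open>Calculation in the tensor square\<close>

lemma tens_closed: "\<lbrakk>x \<in> carrier A; y \<in> carrier A\<rbrakk> \<Longrightarrow> tens x y \<in> carrier T"
  using TT.tensor_closed by simp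

lemma tens_add_left: "\<lbrakk>x \<in> carrier A; x' \<in> carrier A; y \<in> carrier A\<rbrakk>
    \<Longrightarrow> tens (x \<oplus>\<^bsub>A\<^esub> x') y = tens x y \<oplus>\<^bsub>T\<^esub> tens x' y"
  using TT.tensor_add_left by simp

lemma tens_add_right: "\<lbrakk>x \<in> carrier A; y \<in> carrier A; y' \<in> carrier A\<rbrakk>
    \<Longrightarrow> tens x (y \<oplus>\<^bsub>A\<^esub> y') = tens x y \<oplus>\<^bsub>T\<^esub> tens x y'"
  using TT.tensor_add_right by simp

lemma tens_balanced: "\<lbrakk>x \<in> carrier A; b \<in> carrier B; y \<in> carrier A\<rbrakk>
    \<Longrightarrow> tens (x \<otimes>\<^bsub>A\<^esub> \<phi> b) y = tens x (\<phi> b \<otimes>\<^bsub>A\<^esub> y)"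
  using TT.tensor_balanced by simp

lemma smult_tens: "\<lbrakk>a \<in> carrier A; x \<in> carrier A; y \<in> carrier A\<rbrakk>
    \<Longrightarrow> a \<odot>\<^bsub>T\<^esub> tens x y = tens (a \<otimes>\<^bsub>A\<^esub> x) y"
  using TT.smult_T_tensor by simp

lemma rsmult_tens: "\<lbrakk>a \<in> carrier A; x \<in> carrier A; y \<in> carrier A\<rbrakk>
    \<Longrightarrow> tens x y \<bullet>\<^bsub>T\<^esub> a = tens x (y \<otimes>\<^bsub>A\<^esub> a)"
  using TT.rsmult_T_tensor by simp

lemma T_eqI:
  assumes "abelian_group L" "f \<in> additive_maps T L" "g \<in> additive_maps T L"
    and "\<And>x y. \<lbrakk>x \<in> carrier A; y \<in> carrier A\<rbrakk> \<Longrightarrow> f (tens x y) = g (tens x y)"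
    and "t \<in> carrier T"
  shows "f t = g t"
  using TT.additive_maps_tensor_eqI[OF assms(1-3) _ assms(5)] assms(4) by simp

text \<open>The relations mention only the additions and the two inner actions through \<phi>, never
  the outer actions \<open>f\<close> and \<open>g\<close>. Hence all tensor squares of
  \<open>A\<close> over \<open>B\<close> share one underlying group, and everything can be computed
  in \<open>T\<close>, where \<open>A\<close> acts on both sides.\<close>

lemma tensor_square_relations:
  "tensor_relations B (ring_bimodule A f \<phi>) (ring_bimodule A \<phi> g) = tensor_relations B AB BA"
  unfolding tensor_relations_def ring_bimodule_simps by (rule refl)

lemma tensor_square_restrict:
  "carrier (tensor_product B (ring_bimodule A f \<phi>) (ring_bimodule A \<phi> g)) = carrier T"
  "\<zero>\<^bsub>tensor_product B (ring_bimodule A f \<phi>) (ring_bimodule A \<phi> g)\<^esub> = \<zero>\<^bsub>T\<^esub>"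
  "ring.add (tensor_product B (ring_bimodule A f \<phi>) (ring_bimodule A \<phi> g)) = ring.add T"
  "r \<odot>\<^bsub>tensor_product B (ring_bimodule A f \<phi>) (ring_bimodule A \<phi> g)\<^esub> t = f r \<odot>\<^bsub>T\<^esub> t"
  "t \<bullet>\<^bsub>tensor_product B (ring_bimodule A f \<phi>) (ring_bimodule A \<phi> g)\<^esub> s = t \<bullet>\<^bsub>T\<^esub> g s"
  unfolding tensor_product_def Let_def tensor_square_relations[of f g] ring_bimodule_simps id_apply
    partial_object.select_convs monoid.select_convs ring.select_convs module.select_convs
    bimodule.select_convs
  by (rule refl)+

text \<open>Stated for the two required cases only, since the general rules would loop on \<open>T\<close>.\<close>

lemmas tensor_square_simps =
  tensor_square_restrict[where f = id and g = \<phi>] tensor_square_restrict[where f = \<phi> and g = id]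

lemma finsum_tensor_square:
  "finsum T_AB h I = finsum T h I"
  "finsum T_BA h I = finsum T h I"
  by (intro finsum_add_monoid_cong tensor_square_restrict)+

lemma additive_maps_tensor_square:
  "additive_maps T_AB L = additive_maps T L"
  "additive_maps L T_AB = additive_maps L T"
  "additive_maps T_BA L = additive_maps T L"
  "additive_maps L T_BA = additive_maps L T"
  by (simp_all only: additive_maps_def tensor_square_simps)

lemma bimodule_tensor_square:
  assumes "ring R" "ring S" "f \<in> ring_hom R A" "g \<in> ring_hom S A"
  shows "bimodule R S (tensor_product B (ring_bimodule A f \<phi>) (ring_bimodule A \<phi> g))"
proof -
  interpret X: tensor_factors R B S "ring_bimodule A f \<phi>" "ring_bimodule A \<phi> g"
    by (intro tensor_factors.intro bimodule_ring_bimodule A.ring_axioms B.ring_axioms hom assms)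
  show ?thesis by (rule X.bimodule_T)
qed

section \<open>Elements of the dual and of the endomorphism ring\<close>

lemma D_additive: "\<alpha> \<in> carrier D \<Longrightarrow> \<alpha> \<in> additive_maps A B"
  by (auto simp: right_dual_simps right_hom_def additive_maps_def)

lemma D_closed: "\<lbrakk>\<alpha> \<in> carrier D; x \<in> carrier A\<rbrakk> \<Longrightarrow> \<alpha> x \<in> carrier B"
  using additive_maps_closed[OF D_additive] .

lemma D_linear: "\<lbrakk>\<alpha> \<in> carrier D; x \<in> carrier A; b \<in> carrier B\<rbrakk> \<Longrightarrow> \<alpha> (x \<otimes>\<^bsub>A\<^esub> \<phi> b) = \<alpha> x \<otimes>\<^bsub>B\<^esub> b"
  by (auto simp: right_dual_simps right_hom_def)

lemma D_memI:
  assumes "h \<in> additive_maps A B"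
    and "\<And>x b. \<lbrakk>x \<in> carrier A; b \<in> carrier B\<rbrakk> \<Longrightarrow> h (x \<otimes>\<^bsub>A\<^esub> \<phi> b) = h x \<otimes>\<^bsub>B\<^esub> b"
  shows "(\<lambda>x\<in>carrier A. h x) \<in> carrier D"
  using assms by (auto simp: right_dual_simps right_hom_def additive_maps_def phi_simps)

lemma D_eqI:
  assumes "\<alpha> \<in> carrier D" "\<beta> \<in> carrier D" "\<And>x. x \<in> carrier A \<Longrightarrow> \<alpha> x = \<beta> x"
  shows "\<alpha> = \<beta>"
  using assms by (auto simp: right_dual_simps intro: extensionalityI)

lemma D_simps:
  assumes "x \<in> carrier A"
  shows "(b \<odot>\<^bsub>D\<^esub> \<alpha>) x = b \<otimes>\<^bsub>B\<^esub> \<alpha> x" "(\<alpha> \<bullet>\<^bsub>D\<^esub> a) x = \<alpha> (a \<otimes>\<^bsub>A\<^esub> x)"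
    "(\<alpha> \<oplus>\<^bsub>D\<^esub> \<beta>) x = \<alpha> x \<oplus>\<^bsub>B\<^esub> \<beta> x"
  using assms by (simp_all add: right_dual_simps)

lemma bimodule_D: "bimodule B A D"
  by (rule bimodule_right_dual[OF bimodule_AB])

lemma D_eval: "x \<in> carrier A \<Longrightarrow> (\<lambda>\<alpha>. \<alpha> x) \<in> additive_maps D B"
  by (rule additive_mapsI) (simp_all add: D_closed D_simps)

lemma E_additive: "e \<in> carrier E \<Longrightarrow> e \<in> additive_maps A A"
  by (auto simp: right_End_def right_hom_def additive_maps_def)

lemma E_closed: "\<lbrakk>e \<in> carrier E; x \<in> carrier A\<rbrakk> \<Longrightarrow> e x \<in> carrier A"
  using additive_maps_closed[OF E_additive] .

lemma E_linear: "\<lbrakk>e \<in> carrier E; x \<in> carrier A; b \<in> carrier B\<rbrakk> \<Longrightarrow> e (x \<otimes>\<^bsub>A\<^esub> \<phi> b) = e x \<otimes>\<^bsub>A\<^esub> \<phi> b"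
  by (auto simp: right_End_def right_hom_def)

lemma E_memI:
  assumes "h \<in> additive_maps A A"
    and "\<And>x b. \<lbrakk>x \<in> carrier A; b \<in> carrier B\<rbrakk> \<Longrightarrow> h (x \<otimes>\<^bsub>A\<^esub> \<phi> b) = h x \<otimes>\<^bsub>A\<^esub> \<phi> b"
  shows "(\<lambda>x\<in>carrier A. h x) \<in> carrier E"
  using assms by (auto simp: right_End_def right_hom_def additive_maps_def phi_simps)

lemma E_eqI:
  assumes "e \<in> carrier E" "e' \<in> carrier E" "\<And>x. x \<in> carrier A \<Longrightarrow> e x = e' x"
  shows "e = e'"
  using assms by (auto simp: right_End_def intro: extensionalityI)

lemma E_simps:
  assumes "x \<in> carrier A"
  shows "(e \<otimes>\<^bsub>E\<^esub> e') x = e (e' x)" "(e \<oplus>\<^bsub>E\<^esub> e') x = e x \<oplus>\<^bsub>A\<^esub> e' x" "\<one>\<^bsub>E\<^esub> x = x"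
    "left_mult A a x = a \<otimes>\<^bsub>A\<^esub> x"
  using assms by (simp_all add: right_End_def compose_def left_mult_def)

lemma E_eval: "x \<in> carrier A \<Longrightarrow> (\<lambda>e. e x) \<in> additive_maps E A"
  by (rule additive_mapsI) (simp_all add: E_closed E_simps)

text \<open>The homomorphisms are transported to \<open>T\<close>, with the smaller ring acting
  through \<phi>, so that linearity over it and the full actions of the larger ring are available
  together. The lemma is applied to the extension \<open>E\<close> over \<open>A\<close>.\<close>

lemma right_D2_data:
  assumes "right_D2 A B \<phi>"
  obtains n :: nat and p q where
    "\<And>k. k < n \<Longrightarrow> p k \<in> additive_maps T A"
    "\<And>k a t. \<lbrakk>k < n; a \<in> carrier A; t \<in> carrier T\<rbrakk> \<Longrightarrow> p k (a \<odot>\<^bsub>T\<^esub> t) = a \<otimes>\<^bsub>A\<^esub> p k t"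
    "\<And>k t b. \<lbrakk>k < n; t \<in> carrier T; b \<in> carrier B\<rbrakk> \<Longrightarrow> p k (t \<bullet>\<^bsub>T\<^esub> \<phi> b) = p k t \<otimes>\<^bsub>A\<^esub> \<phi> b"
    "\<And>k. k < n \<Longrightarrow> q k \<in> additive_maps A T"
    "\<And>k a x. \<lbrakk>k < n; a \<in> carrier A; x \<in> carrier A\<rbrakk> \<Longrightarrow> q k (a \<otimes>\<^bsub>A\<^esub> x) = a \<odot>\<^bsub>T\<^esub> q k x"
    "\<And>k x b. \<lbrakk>k < n; x \<in> carrier A; b \<in> carrier B\<rbrakk> \<Longrightarrow> q k (x \<otimes>\<^bsub>A\<^esub> \<phi> b) = q k x \<bullet>\<^bsub>T\<^esub> \<phi> b"
    "\<And>t. t \<in> carrier T \<Longrightarrow> (\<Oplus>\<^bsub>T\<^esub>k\<in>{..<n}. q k (p k t)) = t"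
proof -
  have b: "bimodule A B T_AB"
    by (intro bimodule_tensor_square A.ring_axioms B.ring_axioms hom id_ring_hom)
  have d: "bimodule_divides A B T_AB AB"
    using assms by (simp add: right_D2_def bimodule_similar_def)
  obtain n :: nat and p q where p: "\<And>k. k < n \<Longrightarrow> p k \<in> bimodule_hom A B T_AB AB"
    and q: "\<And>k. k < n \<Longrightarrow> q k \<in> bimodule_hom A B AB T_AB"
    and eq: "\<And>t. t \<in> carrier T_AB \<Longrightarrow> (\<Oplus>\<^bsub>T_AB\<^esub>k\<in>{..<n}. q k (p k t)) = t"
    by (rule bimodule_dividesD[OF b bimodule_AB d]) (rule that)
  show ?thesis
  proof (rule that[of n p q])
    show "p k \<in> additive_maps T A" "q k \<in> additive_maps A T" if "k < n" for k
      using left_hom_additive[of "p k" A T_AB AB] left_hom_additive[of "q k" A AB T_AB] p[OF that] q[OF that]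
      by (simp_all add: additive_maps_tensor_square)
    show "p k (a \<odot>\<^bsub>T\<^esub> t) = a \<otimes>\<^bsub>A\<^esub> p k t" if "k < n" "a \<in> carrier A" "t \<in> carrier T" for k a t
      using left_hom_smult[of "p k" A T_AB AB a t] p[OF that(1)] that by (simp add: tensor_square_simps)
    show "p k (t \<bullet>\<^bsub>T\<^esub> \<phi> b) = p k t \<otimes>\<^bsub>A\<^esub> \<phi> b" if "k < n" "t \<in> carrier T" "b \<in> carrier B" for k t b
      using right_hom_rsmult[of "p k" B T_AB AB t b] p[OF that(1)] that by (simp add: tensor_square_simps)
    show "q k (a \<otimes>\<^bsub>A\<^esub> t) = a \<odot>\<^bsub>T\<^esub> q k t" if "k < n" "a \<in> carrier A" "t \<in> carrier A" for k a t
      using left_hom_smult[of "q k" A AB T_AB a t] q[OF that(1)] that by (simp add: tensor_square_simps)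
    show "q k (t \<otimes>\<^bsub>A\<^esub> \<phi> b) = q k t \<bullet>\<^bsub>T\<^esub> \<phi> b" if "k < n" "t \<in> carrier A" "b \<in> carrier B" for k t b
      using right_hom_rsmult[of "q k" B AB T_AB t b] q[OF that(1)] that by (simp add: tensor_square_simps)
    show "(\<Oplus>\<^bsub>T\<^esub>k\<in>{..<n}. q k (p k t)) = t" if "t \<in> carrier T" for t
      using eq[of t] that by (simp add: tensor_square_simps finsum_tensor_square)
  qed
qed

lemma left_D2_data:
  assumes "left_D2 A B \<phi>"
  obtains n :: nat and p q where
    "\<And>k. k < n \<Longrightarrow> p k \<in> additive_maps T A"
    "\<And>k b t. \<lbrakk>k < n; b \<in> carrier B; t \<in> carrier T\<rbrakk> \<Longrightarrow> p k (\<phi> b \<odot>\<^bsub>T\<^esub> t) = \<phi> b \<otimes>\<^bsub>A\<^esub> p k t"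
    "\<And>k t a. \<lbrakk>k < n; t \<in> carrier T; a \<in> carrier A\<rbrakk> \<Longrightarrow> p k (t \<bullet>\<^bsub>T\<^esub> a) = p k t \<otimes>\<^bsub>A\<^esub> a"
    "\<And>k. k < n \<Longrightarrow> q k \<in> additive_maps A T"
    "\<And>k b x. \<lbrakk>k < n; b \<in> carrier B; x \<in> carrier A\<rbrakk> \<Longrightarrow> q k (\<phi> b \<otimes>\<^bsub>A\<^esub> x) = \<phi> b \<odot>\<^bsub>T\<^esub> q k x"
    "\<And>k x a. \<lbrakk>k < n; x \<in> carrier A; a \<in> carrier A\<rbrakk> \<Longrightarrow> q k (x \<otimes>\<^bsub>A\<^esub> a) = q k x \<bullet>\<^bsub>T\<^esub> a"
    "\<And>t. t \<in> carrier T \<Longrightarrow> (\<Oplus>\<^bsub>T\<^esub>k\<in>{..<n}. q k (p k t)) = t"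
proof -
  have b: "bimodule B A T_BA"
    by (intro bimodule_tensor_square A.ring_axioms B.ring_axioms hom id_ring_hom)
  have d: "bimodule_divides B A T_BA BA"
    using assms by (simp add: left_D2_def bimodule_similar_def)
  obtain n :: nat and p q where p: "\<And>k. k < n \<Longrightarrow> p k \<in> bimodule_hom B A T_BA BA"
    and q: "\<And>k. k < n \<Longrightarrow> q k \<in> bimodule_hom B A BA T_BA"
    and eq: "\<And>t. t \<in> carrier T_BA \<Longrightarrow> (\<Oplus>\<^bsub>T_BA\<^esub>k\<in>{..<n}. q k (p k t)) = t"
    by (rule bimodule_dividesD[OF b bimodule_BA d]) (rule that)
  show ?thesis
  proof (rule that[of n p q])
    show "p k \<in> additive_maps T A" "q k \<in> additive_maps A T" if "k < n" for k
      using left_hom_additive[of "p k" B T_BA BA] left_hom_additive[of "q k" B BA T_BA] p[OF that] q[OF that]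
      by (simp_all add: additive_maps_tensor_square)
    show "p k (\<phi> b \<odot>\<^bsub>T\<^esub> t) = \<phi> b \<otimes>\<^bsub>A\<^esub> p k t" if "k < n" "b \<in> carrier B" "t \<in> carrier T" for k b t
      using left_hom_smult[of "p k" B T_BA BA b t] p[OF that(1)] that by (simp add: tensor_square_simps)
    show "p k (t \<bullet>\<^bsub>T\<^esub> a) = p k t \<otimes>\<^bsub>A\<^esub> a" if "k < n" "t \<in> carrier T" "a \<in> carrier A" for k t a
      using right_hom_rsmult[of "p k" A T_BA BA t a] p[OF that(1)] that by (simp add: tensor_square_simps)
    show "q k (\<phi> b \<otimes>\<^bsub>A\<^esub> t) = \<phi> b \<odot>\<^bsub>T\<^esub> q k t" if "k < n" "b \<in> carrier B" "t \<in> carrier A" for k b t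
      using left_hom_smult[of "q k" B BA T_BA b t] q[OF that(1)] that by (simp add: tensor_square_simps)
    show "q k (t \<otimes>\<^bsub>A\<^esub> a) = q k t \<bullet>\<^bsub>T\<^esub> a" if "k < n" "t \<in> carrier A" "a \<in> carrier A" for k t a
      using right_hom_rsmult[of "q k" A BA T_BA t a] q[OF that(1)] that by (simp add: tensor_square_simps)
    show "(\<Oplus>\<^bsub>T\<^esub>k\<in>{..<n}. q k (p k t)) = t" if "t \<in> carrier T" for t
      using eq[of t] that by (simp add: tensor_square_simps finsum_tensor_square)
  qed
qed

text \<open>The inclusion into the tensor square is \<open>x \<mapsto> x \<otimes> 1\<close> for the first statement,
  \<open>x \<mapsto> 1 \<otimes> x\<close> for the second; multiplication splits both.\<close>

lemma divides_tensor_square: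
  shows "bimodule_divides A B AB T_AB"
    and "bimodule_divides B A BA T_BA"
proof -
  let ?\<mu> = "tensor_lift B AB BA A (\<lambda>x y. x \<otimes>\<^bsub>A\<^esub> y)"
  have bal: "balanced B AB BA A (\<lambda>x y. x \<otimes>\<^bsub>A\<^esub> y)"
    by (rule balancedI) (simp_all add: A.l_distr A.r_distr A.m_assoc phi_simps)
  note Ag = A.is_abelian_group
  have mu_tens: "?\<mu> (tens x y) = x \<otimes>\<^bsub>A\<^esub> y" if "x \<in> carrier A" "y \<in> carrier A" for x y
    using TT.tensor_lift_tensor[OF Ag bal] that by simp
  have mu: "?\<mu> \<in> additive_maps T A"
    by (rule TT.tensor_lift_additive[OF Ag bal])
  have mu_l: "?\<mu> (a \<odot>\<^bsub>T\<^esub> t) = a \<otimes>\<^bsub>A\<^esub> ?\<mu> t" if a: "a \<in> carrier A" and t: "t \<in> carrier T" for a t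
    by (rule T_eqI[OF Ag additive_maps_comp[OF TT.smult_T_additive[OF a] mu]
          additive_maps_comp[OF mu additive_maps_lmult[OF a]] _ t])
      (simp add: smult_tens mu_tens a A.m_assoc)
  have mu_r: "?\<mu> (t \<bullet>\<^bsub>T\<^esub> a) = ?\<mu> t \<otimes>\<^bsub>A\<^esub> a" if a: "a \<in> carrier A" and t: "t \<in> carrier T" for a t
    by (rule T_eqI[OF Ag additive_maps_comp[OF TT.rsmult_T_additive[OF a] mu]
          additive_maps_comp[OF mu additive_maps_rmult[OF a]] _ t])
      (simp add: rsmult_tens mu_tens a A.m_assoc)
  have bT: "bimodule A B T_AB"
    "bimodule B A T_BA"
    by (intro bimodule_tensor_square A.ring_axioms B.ring_axioms hom id_ring_hom)+
  have i1: "(\<lambda>x. tens x \<one>\<^bsub>A\<^esub>) \<in> additive_maps A T" and i2: "tens \<one>\<^bsub>A\<^esub> \<in> additive_maps A T"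
    by (rule additive_mapsI; simp add: tens_closed tens_add_left tens_add_right)+
  show "bimodule_divides A B AB T_AB"
  proof (rule bimodule_dividesI_finsum[OF bimodule_AB bT(1), of "{()}" "\<lambda>_ x. tens x \<one>\<^bsub>A\<^esub>" "\<lambda>_. ?\<mu>"])
    show "(\<lambda>x. tens x \<one>\<^bsub>A\<^esub>) \<in> bimodule_hom A B AB T_AB"
      using tens_balanced[of _ _ "\<one>\<^bsub>A\<^esub>"] i1
      by (intro bimodule_homI)
        (simp_all add: additive_maps_tensor_square tensor_square_simps smult_tens rsmult_tens phi_simps)
    show "?\<mu> \<in> bimodule_hom A B T_AB AB"
      using mu by (intro bimodule_homI)
        (simp_all add: additive_maps_tensor_square tensor_square_simps mu_l mu_r phi_simps)
  qed (simp_all add: mu_tens)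
  show "bimodule_divides B A BA T_BA"
  proof (rule bimodule_dividesI_finsum[OF bimodule_BA bT(2), of "{()}" "\<lambda>_ x. tens \<one>\<^bsub>A\<^esub> x" "\<lambda>_. ?\<mu>"])
    show "(\<lambda>x. tens \<one>\<^bsub>A\<^esub> x) \<in> bimodule_hom B A BA T_BA"
      using tens_balanced[of "\<one>\<^bsub>A\<^esub>"] i2
      by (intro bimodule_homI)
        (simp_all add: additive_maps_tensor_square tensor_square_simps smult_tens rsmult_tens phi_simps)
    show "?\<mu> \<in> bimodule_hom B A T_BA BA"
      using mu by (intro bimodule_homI)
        (simp_all add: additive_maps_tensor_square tensor_square_simps mu_l mu_r phi_simps)
  qed (simp_all add: mu_tens)
qed

text \<open>Applying \<open>Hom(-, B\<^sub>B)\<close> to \<open>A | (\<^sub>BA)\<^sup>*\<close> and identifying \<open>A\<close> with its double dual.\<close>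

lemma right_dual_divides:
  assumes "left_QF A B \<phi>"
  shows "bimodule_divides B A D BA"
proof -
  let ?L = "left_dual B BA"
  have bL: "bimodule A B ?L" by (rule bimodule_left_dual[OF bimodule_BA])
  have bAA: "bimodule B B (ring_bimodule A \<phi> \<phi>)"
    by (intro bimodule_ring_bimodule A.ring_axioms B.ring_axioms hom)
  have "left_fg_projective B (ring_bimodule A \<phi> \<phi>)"
    using assms by (simp add: left_QF_def)
  from left_dual_basis[OF bAA this]
  obtain J \<beta> where J: "finite J" "J \<subseteq> carrier A"
    and be: "\<And>j. j \<in> J \<Longrightarrow> \<beta> j \<in> carrier (left_dual B (ring_bimodule A \<phi> \<phi>))"
    and be_eq: "\<And>x. x \<in> carrier A \<Longrightarrow> (\<Oplus>\<^bsub>A\<^esub>j\<in>J. \<phi> (\<beta> j x) \<otimes>\<^bsub>A\<^esub> j) = x"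
    by (auto simp: subset_iff)
  \<comment> \<open>The functionals come from \<open>ring_bimodule A \<phi> \<phi>\<close>, but left
    linearity does not involve the right action, so they also lie in the dual of
    \<open>BA\<close>.\<close>
  have be: "\<beta> j \<in> carrier ?L" if "j \<in> J" for j
    using be[OF that] by (simp add: left_dual_simps left_hom_def)
  have jA: "j \<in> carrier A" if "j \<in> J" for j using J(2) that by blast
  have "bimodule_divides A B AB ?L"
    using assms by (simp add: left_QF_def)
  from bimodule_dividesD[OF bimodule_AB bL this]
  obtain n :: nat and f g where f: "\<And>k. k < n \<Longrightarrow> f k \<in> bimodule_hom A B AB ?L"
    and g: "\<And>k. k < n \<Longrightarrow> g k \<in> bimodule_hom A B ?L AB"
    and gf: "\<And>x. x \<in> carrier A \<Longrightarrow> (\<Oplus>\<^bsub>A\<^esub>k\<in>{..<n}. g k (f k x)) = x"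
    by auto
  have L_add: "F \<in> additive_maps A B" if "F \<in> carrier ?L" for F
    using that by (auto simp: left_dual_simps left_hom_def additive_maps_def)
  have L_cl: "F x \<in> carrier B" if "F \<in> carrier ?L" "x \<in> carrier A" for F x
    using additive_maps_closed[OF L_add] that .
  have L_lin: "F (\<phi> b \<otimes>\<^bsub>A\<^esub> x) = b \<otimes>\<^bsub>B\<^esub> F x" if "F \<in> carrier ?L" "b \<in> carrier B" "x \<in> carrier A" for F b x
    using that by (auto simp: left_dual_simps left_hom_def)
  have L_eqI: "F = F'" if "F \<in> carrier ?L" "F' \<in> carrier ?L" "\<And>x. x \<in> carrier A \<Longrightarrow> F x = F' x" for F F'
    using that by (auto simp: left_dual_simps intro: extensionalityI)
  have L_simps: "(a \<odot>\<^bsub>?L\<^esub> F) x = F (x \<otimes>\<^bsub>A\<^esub> a)" "(F \<bullet>\<^bsub>?L\<^esub> b) x = F x \<otimes>\<^bsub>B\<^esub> b"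
    "(F \<oplus>\<^bsub>?L\<^esub> F') x = F x \<oplus>\<^bsub>B\<^esub> F' x" if "x \<in> carrier A" for a b F F' x
    using that by (simp_all add: left_dual_simps)
  interpret L: bimodule A B ?L by (rule bL)
  note Lg = bimodule_abelian_group[OF bL] and Ag = A.is_abelian_group and Bg = B.is_abelian_group
  have L_eval: "(\<lambda>F. F x) \<in> additive_maps ?L B" if "x \<in> carrier A" for x
    by (rule additive_mapsI) (simp_all add: that L_cl L_simps)
  \<comment> \<open>The \<beta> \<open>j\<close> generate the dual as a right module: apply
    \<open>F\<close> to the expansion \<open>be_eq\<close> and use left linearity.\<close>
  have L_expand: "(\<Oplus>\<^bsub>?L\<^esub>j\<in>J. \<beta> j \<bullet>\<^bsub>?L\<^esub> F j) = F" if F: "F \<in> carrier ?L" for F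
  proof (rule L_eqI[OF _ F])
    have cl: "\<beta> j \<bullet>\<^bsub>?L\<^esub> F j \<in> carrier ?L" if "j \<in> J" for j
      by (intro L.rsmult_closed be that L_cl[OF F] jA)
    then show "(\<Oplus>\<^bsub>?L\<^esub>j\<in>J. \<beta> j \<bullet>\<^bsub>?L\<^esub> F j) \<in> carrier ?L" by (intro L.M.finsum_closed) auto
    fix x assume x: "x \<in> carrier A"
    have "(\<Oplus>\<^bsub>?L\<^esub>j\<in>J. \<beta> j \<bullet>\<^bsub>?L\<^esub> F j) x = (\<Oplus>\<^bsub>B\<^esub>j\<in>J. (\<beta> j \<bullet>\<^bsub>?L\<^esub> F j) x)"
      using cl by (intro additive_maps_finsum[OF Lg Bg L_eval[OF x]]) auto
    also have "\<dots> = (\<Oplus>\<^bsub>B\<^esub>j\<in>J. F (\<phi> (\<beta> j x) \<otimes>\<^bsub>A\<^esub> j))"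
      using x F be jA
      by (intro B.finsum_cong') (auto simp: L_simps L_lin L_cl phi_simps)
    also have "\<dots> = F (\<Oplus>\<^bsub>A\<^esub>j\<in>J. \<phi> (\<beta> j x) \<otimes>\<^bsub>A\<^esub> j)"
      using x be jA
      by (intro additive_maps_finsum[OF Ag Bg L_add[OF F], symmetric]) (auto simp: L_cl phi_simps)
    finally show "(\<Oplus>\<^bsub>?L\<^esub>j\<in>J. \<beta> j \<bullet>\<^bsub>?L\<^esub> F j) x = F x" by (simp add: be_eq x)
  qed
  \<comment> \<open>Injectivity of the map from \<open>A\<close> to its double dual: an element is
    recovered from the values of the \<beta> \<open>j\<close>.\<close>
  have separate: "x = y" if xy: "x \<in> carrier A" "y \<in> carrier A" and eq: "\<And>F. F \<in> carrier ?L \<Longrightarrow> F x = F y" for x y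
  proof -
    have "(\<Oplus>\<^bsub>A\<^esub>j\<in>J. \<phi> (\<beta> j x) \<otimes>\<^bsub>A\<^esub> j) = (\<Oplus>\<^bsub>A\<^esub>j\<in>J. \<phi> (\<beta> j y) \<otimes>\<^bsub>A\<^esub> j)"
      using xy be jA eq[OF be] by (intro A.finsum_cong') (auto simp: L_cl phi_simps)
    then show ?thesis using be_eq xy by simp
  qed
  have g_add: "g k \<in> additive_maps ?L A" if "k < n" for k
    using left_hom_additive[of "g k" A ?L AB] g[OF that] by simp
  have g_cl: "g k F \<in> carrier A" if "k < n" "F \<in> carrier ?L" for k F
    using additive_maps_closed[OF g_add] that .
  have g_l: "g k (a \<odot>\<^bsub>?L\<^esub> F) = a \<otimes>\<^bsub>A\<^esub> g k F" if "k < n" "a \<in> carrier A" "F \<in> carrier ?L" for k a F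
    using left_hom_smult[of "g k" A ?L AB a F] g[OF that(1)] that by simp
  have g_r: "g k (F \<bullet>\<^bsub>?L\<^esub> b) = g k F \<otimes>\<^bsub>A\<^esub> \<phi> b" if "k < n" "b \<in> carrier B" "F \<in> carrier ?L" for k b F
    using right_hom_rsmult[of "g k" B ?L AB F b] g[OF that(1)] that by simp
  have f_add: "f k \<in> additive_maps A ?L" if "k < n" for k
    using left_hom_additive[of "f k" A AB ?L] f[OF that] by simp
  have f_cl: "f k x \<in> carrier ?L" if "k < n" "x \<in> carrier A" for k x
    using additive_maps_closed[OF f_add] that .
  have f_l: "f k (a \<otimes>\<^bsub>A\<^esub> x) = a \<odot>\<^bsub>?L\<^esub> f k x" if "k < n" "a \<in> carrier A" "x \<in> carrier A" for k a x
    using left_hom_smult[of "f k" A AB ?L a x] f[OF that(1)] that by simp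
  have f_r: "f k (x \<otimes>\<^bsub>A\<^esub> \<phi> b) = f k x \<bullet>\<^bsub>?L\<^esub> b" if "k < n" "b \<in> carrier B" "x \<in> carrier A" for k b x
    using right_hom_rsmult[of "f k" B AB ?L x b] f[OF that(1)] that by simp
  \<comment> \<open>By \<open>be_eq\<close> an element \<open>a\<close> is recovered from evaluation
    at \<open>a\<close>, as the sum of the \<open>\<phi> (\<beta> j a) j\<close>. Replacing that
    evaluation by the functional \<open>F \<mapsto> \<alpha> (g k F)\<close> gives the element of
    \<open>A\<close> representing this functional, as \<open>LH\<close> confirms. Thus
    \<open>H k\<close> is the transpose of \<open>g k\<close>.\<close>
  define H where "H k \<alpha> = (\<Oplus>\<^bsub>A\<^esub>j\<in>J. \<phi> (\<alpha> (g k (\<beta> j))) \<otimes>\<^bsub>A\<^esub> j)" for k \<alpha>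
  have H_cl: "H k \<alpha> \<in> carrier A" if "k < n" "\<alpha> \<in> carrier D" for k \<alpha>
    unfolding H_def using that by (intro A.finsum_closed) (auto simp: phi_simps D_closed g_cl be jA)
  have LH: "F (H k \<alpha>) = \<alpha> (g k F)" if k: "k < n" and al: "\<alpha> \<in> carrier D" and F: "F \<in> carrier ?L" for k \<alpha> F
  proof -
    have "F (H k \<alpha>) = (\<Oplus>\<^bsub>B\<^esub>j\<in>J. F (\<phi> (\<alpha> (g k (\<beta> j))) \<otimes>\<^bsub>A\<^esub> j))"
      unfolding H_def using k al
      by (intro additive_maps_finsum[OF Ag Bg L_add[OF F]]) (auto simp: phi_simps D_closed g_cl be jA)
    also have "\<dots> = (\<Oplus>\<^bsub>B\<^esub>j\<in>J. \<alpha> (g k (\<beta> j \<bullet>\<^bsub>?L\<^esub> F j)))"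
      using k al F
      by (intro B.finsum_cong') (auto simp: L_lin D_closed g_cl be jA L_cl g_r D_linear)
    also have "\<dots> = \<alpha> (g k (\<Oplus>\<^bsub>?L\<^esub>j\<in>J. \<beta> j \<bullet>\<^bsub>?L\<^esub> F j))"
      using F
      by (intro additive_maps_finsum[OF Lg Bg additive_maps_comp[OF g_add[OF k] D_additive[OF al]], symmetric])
        (auto intro!: L.rsmult_closed simp: be L_cl jA)
    finally show ?thesis by (simp add: L_expand F)
  qed
  interpret DD: bimodule B A D by (rule bimodule_D)
  note Dg = bimodule_abelian_group[OF bimodule_D]
  \<comment> \<open>The transpose of \<open>f k\<close>, applied to evaluation at
    \<open>a\<close>.\<close>
  define K where "K k a = (\<lambda>x\<in>carrier A. f k x a)" for k a
  have K_cl: "K k a \<in> carrier D" if "k < n" "a \<in> carrier A" for k a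
    unfolding K_def
    by (intro D_memI additive_maps_comp[OF f_add L_eval] that) (simp add: f_r that L_simps f_cl)
  show ?thesis
  proof (rule bimodule_dividesI_finsum[OF bimodule_D bimodule_BA, of "{..<n}" H K])
    fix k assume "k \<in> {..<n}"
    then have k: "k < n" by simp
    show "H k \<in> bimodule_hom B A D BA"
    proof (rule bimodule_homI, rule additive_mapsI)
      show "H k \<alpha> \<in> carrier BA" if "\<alpha> \<in> carrier D" for \<alpha>
        using H_cl k that by simp
      \<comment> \<open>Homomorphism properties of \<open>H k\<close> are tested against all
        functionals \<open>F\<close>, where \<open>LH\<close> removes the sum over the dual
        basis.\<close>
      show "H k (\<alpha> \<oplus>\<^bsub>D\<^esub> \<beta>) = H k \<alpha> \<oplus>\<^bsub>BA\<^esub> H k \<beta>" if "\<alpha> \<in> carrier D" "\<beta> \<in> carrier D" for \<alpha> \<beta>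
        by (rule separate)
          (use that k in \<open>simp_all add: H_cl LH D_simps g_cl additive_maps_add[OF L_add]\<close>)
      show "H k (b \<odot>\<^bsub>D\<^esub> \<alpha>) = b \<odot>\<^bsub>BA\<^esub> H k \<alpha>" if "b \<in> carrier B" "\<alpha> \<in> carrier D" for b \<alpha>
        by (rule separate)
          (use that k in \<open>simp_all add: H_cl LH D_simps g_cl L_lin DD.smult_closed phi_simps\<close>)
      show "H k (\<alpha> \<bullet>\<^bsub>D\<^esub> a) = H k \<alpha> \<bullet>\<^bsub>BA\<^esub> a" if a: "a \<in> carrier A" and al: "\<alpha> \<in> carrier D" for a \<alpha>
      proof (rule separate)
        fix F assume F: "F \<in> carrier ?L"
        have "F (H k (\<alpha> \<bullet>\<^bsub>D\<^esub> a)) = (a \<odot>\<^bsub>?L\<^esub> F) (H k \<alpha>)"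
          using F a al k by (simp add: LH DD.rsmult_closed L.smult_closed D_simps g_cl g_l)
        then show "F (H k (\<alpha> \<bullet>\<^bsub>D\<^esub> a)) = F (H k \<alpha> \<bullet>\<^bsub>BA\<^esub> a)"
          using k al by (simp add: L_simps H_cl)
      qed (use a al k in \<open>simp_all add: H_cl DD.rsmult_closed\<close>)
    qed
    show "K k \<in> bimodule_hom B A BA D"
    proof (rule bimodule_homI, rule additive_mapsI)
      show "K k a \<in> carrier D" if "a \<in> carrier BA" for a
        using K_cl k that by simp
      show "K k (a \<oplus>\<^bsub>BA\<^esub> a') = K k a \<oplus>\<^bsub>D\<^esub> K k a'" if "a \<in> carrier BA" "a' \<in> carrier BA" for a a'
      proof (rule D_eqI)
        show "K k (a \<oplus>\<^bsub>BA\<^esub> a') \<in> carrier D" "K k a \<oplus>\<^bsub>D\<^esub> K k a' \<in> carrier D"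
          using that k by (simp_all add: K_cl)
      qed (use that k in \<open>simp add: K_def D_simps f_cl additive_maps_add[OF L_add]\<close>)
      show "K k (b \<odot>\<^bsub>BA\<^esub> a) = b \<odot>\<^bsub>D\<^esub> K k a" if "b \<in> carrier B" "a \<in> carrier BA" for b a
      proof (rule D_eqI)
        show "K k (b \<odot>\<^bsub>BA\<^esub> a) \<in> carrier D" "b \<odot>\<^bsub>D\<^esub> K k a \<in> carrier D"
          using that k by (simp_all add: K_cl DD.smult_closed phi_simps)
      qed (use that k in \<open>simp add: K_def D_simps f_cl L_lin\<close>)
      show "K k (a \<bullet>\<^bsub>BA\<^esub> a') = K k a \<bullet>\<^bsub>D\<^esub> a'" if "a' \<in> carrier A" "a \<in> carrier BA" for a a'
      proof (rule D_eqI)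
        show "K k (a \<bullet>\<^bsub>BA\<^esub> a') \<in> carrier D" "K k a \<bullet>\<^bsub>D\<^esub> a' \<in> carrier D"
          using that k by (simp_all add: K_cl DD.rsmult_closed)
      qed (use that k in \<open>simp add: K_def D_simps f_l L_simps\<close>)
    qed
  next
    fix \<alpha> assume al: "\<alpha> \<in> carrier D"
    have cl: "K k (H k \<alpha>) \<in> carrier D" if "k < n" for k using K_cl H_cl al that by blast
    show "(\<Oplus>\<^bsub>D\<^esub>k\<in>{..<n}. K k (H k \<alpha>)) = \<alpha>"
    proof (rule D_eqI[OF _ al])
      show "(\<Oplus>\<^bsub>D\<^esub>k\<in>{..<n}. K k (H k \<alpha>)) \<in> carrier D" using cl by (intro DD.M.finsum_closed) auto
      fix x assume x: "x \<in> carrier A"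
      have "(\<Oplus>\<^bsub>D\<^esub>k\<in>{..<n}. K k (H k \<alpha>)) x = (\<Oplus>\<^bsub>B\<^esub>k\<in>{..<n}. K k (H k \<alpha>) x)"
        using cl by (intro additive_maps_finsum[OF Dg Bg D_eval[OF x]]) auto
      also have "\<dots> = (\<Oplus>\<^bsub>B\<^esub>k\<in>{..<n}. \<alpha> (g k (f k x)))"
        using x al by (intro B.finsum_cong') (auto simp: K_def LH f_cl g_cl D_closed)
      also have "\<dots> = \<alpha> (\<Oplus>\<^bsub>A\<^esub>k\<in>{..<n}. g k (f k x))"
        using x by (intro additive_maps_finsum[OF Ag Bg D_additive[OF al], symmetric]) (auto simp: f_cl g_cl)
      finally show "(\<Oplus>\<^bsub>D\<^esub>k\<in>{..<n}. K k (H k \<alpha>)) x = \<alpha> x" by (simp add: gf x)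
    qed
  qed simp
qed

end

section \<open>Descending the depth two condition from the endomorphism ring\<close>

text \<open>Fixes the data extracted from right QF, namely \<open>f\<close> and \<open>g\<close>
  witnessing \<open>BA | D\<close> and a dual basis \<open>J\<close>, \<alpha> of \<open>A\<close>
  as a right \<open>B\<close>-module, so that maps built from them can be named. The depth two data
  of \<open>E\<close> over \<open>A\<close> stay outside, as the two descents use different halves
  of them.\<close>

locale QF_endomorphism = ring_extension A B \<phi>
  for A :: "('a, 'k) ring_scheme" and B :: "('b, 'l) ring_scheme" and \<phi> :: "'b \<Rightarrow> 'a" +
  fixes n :: nat and f :: "nat \<Rightarrow> 'a \<Rightarrow> 'a \<Rightarrow> 'b" and g :: "nat \<Rightarrow> ('a \<Rightarrow> 'b) \<Rightarrow> 'a"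
    and J :: "'a set" and \<alpha> :: "'a \<Rightarrow> 'a \<Rightarrow> 'b"
  assumes E_ext: "ring_extension E A (left_mult A)"
    and f: "\<And>k. k < n \<Longrightarrow> f k \<in> bimodule_hom B A BA D"
    and g: "\<And>k. k < n \<Longrightarrow> g k \<in> bimodule_hom B A D BA"
    and gf: "\<And>x. x \<in> carrier A \<Longrightarrow> (\<Oplus>\<^bsub>A\<^esub>k\<in>{..<n}. g k (f k x)) = x"
    and J: "finite J" "J \<subseteq> carrier A"
    and \<alpha>: "\<And>j. j \<in> J \<Longrightarrow> \<alpha> j \<in> carrier D"
    and basis: "\<And>x. x \<in> carrier A \<Longrightarrow> (\<Oplus>\<^bsub>A\<^esub>j\<in>J. j \<otimes>\<^bsub>A\<^esub> \<phi> (\<alpha> j x)) = x"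
begin

sublocale End: ring_extension E A "left_mult A"
  by (rule E_ext)

sublocale D: bimodule B A D
  by (rule bimodule_D)

abbreviation lam where "lam \<equiv> left_mult A"
abbreviation EE where "EE \<equiv> ring_bimodule E lam lam"

lemma bimodule_EE: "bimodule A A EE"
  by (rule bimodule_ring_bimodule[OF End.A.ring_axioms A.ring_axioms A.ring_axioms End.hom End.hom])

lemmas Ag = A.is_abelian_group and Bg = B.is_abelian_group and Eg = End.A.is_abelian_group
  and Dg = bimodule_abelian_group[OF bimodule_D] and Tg = TT.abelian_group_T

lemma J_closed: "j \<in> J \<Longrightarrow> j \<in> carrier A"
  using J(2) by blast

lemma f_additive: "k < n \<Longrightarrow> f k \<in> additive_maps A D"
  using left_hom_additive[of "f k" B BA D] f[of k] by simp

lemma f_closed: "\<lbrakk>k < n; x \<in> carrier A\<rbrakk> \<Longrightarrow> f k x \<in> carrier D"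
  using additive_maps_closed[OF f_additive] .

lemma f_smult: "\<lbrakk>k < n; b \<in> carrier B; x \<in> carrier A\<rbrakk> \<Longrightarrow> f k (\<phi> b \<otimes>\<^bsub>A\<^esub> x) = b \<odot>\<^bsub>D\<^esub> f k x"
  using left_hom_smult[of "f k" B BA D b x] f[of k] by simp

lemma f_rsmult: "\<lbrakk>k < n; a \<in> carrier A; x \<in> carrier A\<rbrakk> \<Longrightarrow> f k (x \<otimes>\<^bsub>A\<^esub> a) = f k x \<bullet>\<^bsub>D\<^esub> a"
  using right_hom_rsmult[of "f k" A BA D x a] f[of k] by simp

lemma g_additive: "k < n \<Longrightarrow> g k \<in> additive_maps D A"
  using left_hom_additive[of "g k" B D BA] g[of k] by simp

lemma g_closed: "\<lbrakk>k < n; \<beta> \<in> carrier D\<rbrakk> \<Longrightarrow> g k \<beta> \<in> carrier A"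
  using additive_maps_closed[OF g_additive] .

lemma g_smult: "\<lbrakk>k < n; b \<in> carrier B; \<beta> \<in> carrier D\<rbrakk> \<Longrightarrow> g k (b \<odot>\<^bsub>D\<^esub> \<beta>) = \<phi> b \<otimes>\<^bsub>A\<^esub> g k \<beta>"
  using left_hom_smult[of "g k" B D BA b \<beta>] g[of k] by simp

lemma g_rsmult: "\<lbrakk>k < n; a \<in> carrier A; \<beta> \<in> carrier D\<rbrakk> \<Longrightarrow> g k (\<beta> \<bullet>\<^bsub>D\<^esub> a) = g k \<beta> \<otimes>\<^bsub>A\<^esub> a"
  using right_hom_rsmult[of "g k" A D BA \<beta> a] g[of k] by simp

lemma tens_additive_left: "y \<in> carrier A \<Longrightarrow> (\<lambda>x. tens x y) \<in> additive_maps A T"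
  by (rule additive_mapsI) (simp_all add: tens_closed tens_add_left)

lemma tens_additive_right: "x \<in> carrier A \<Longrightarrow> tens x \<in> additive_maps A T"
  by (rule additive_mapsI) (simp_all add: tens_closed tens_add_right)

text \<open>Apply \<beta> to the expansion of \<open>x\<close> in the dual basis; right linearity
  takes the scalars \<open>\<alpha> j x\<close> out. So the \<alpha> \<open>j\<close> generate
  \<open>D\<close> as a left \<open>B\<close>-module.\<close>

lemma dual_expand:
  assumes be: "\<beta> \<in> carrier D"
  shows "(\<Oplus>\<^bsub>D\<^esub>j\<in>J. \<beta> j \<odot>\<^bsub>D\<^esub> \<alpha> j) = \<beta>"
proof (rule D_eqI[OF _ be])
  have cl: "\<beta> j \<odot>\<^bsub>D\<^esub> \<alpha> j \<in> carrier D" if "j \<in> J" for j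
    by (intro D.smult_closed D_closed[OF be] \<alpha> J_closed that)
  then show "(\<Oplus>\<^bsub>D\<^esub>j\<in>J. \<beta> j \<odot>\<^bsub>D\<^esub> \<alpha> j) \<in> carrier D" by (intro D.M.finsum_closed) auto
  fix x assume x: "x \<in> carrier A"
  have "(\<Oplus>\<^bsub>D\<^esub>j\<in>J. \<beta> j \<odot>\<^bsub>D\<^esub> \<alpha> j) x = (\<Oplus>\<^bsub>B\<^esub>j\<in>J. (\<beta> j \<odot>\<^bsub>D\<^esub> \<alpha> j) x)"
    using cl by (intro additive_maps_finsum[OF Dg Bg D_eval[OF x]]) auto
  also have "\<dots> = (\<Oplus>\<^bsub>B\<^esub>j\<in>J. \<beta> (j \<otimes>\<^bsub>A\<^esub> \<phi> (\<alpha> j x)))"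
    using x be by (intro B.finsum_cong') (auto simp: D_simps D_linear D_closed \<alpha> J_closed phi_simps)
  also have "\<dots> = \<beta> (\<Oplus>\<^bsub>A\<^esub>j\<in>J. j \<otimes>\<^bsub>A\<^esub> \<phi> (\<alpha> j x))"
    using x by (intro additive_maps_finsum[OF Ag Bg D_additive[OF be], symmetric])
      (auto simp: D_closed \<alpha> J_closed phi_simps)
  finally show "(\<Oplus>\<^bsub>D\<^esub>j\<in>J. \<beta> j \<odot>\<^bsub>D\<^esub> \<alpha> j) x = \<beta> x" by (simp add: basis x)
qed

text \<open>\<open>U\<close> and \<open>V\<close> realize \<open>A \<otimes>\<^sub>B A | A \<otimes>\<^sub>B (A\<^sub>B)\<^sup>* \<cong> E\<close>.\<close>

definition U0 where "U0 k a a' = (\<lambda>x\<in>carrier A. a \<otimes>\<^bsub>A\<^esub> \<phi> (f k a' x))"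
definition U where "U k = tensor_lift B AB BA EE (U0 k)"
definition V where "V k e = (\<Oplus>\<^bsub>T\<^esub>j\<in>J. tens (e j) (g k (\<alpha> j)))"

lemma U0_apply: "x \<in> carrier A \<Longrightarrow> U0 k a a' x = a \<otimes>\<^bsub>A\<^esub> \<phi> (f k a' x)"
  by (simp add: U0_def)

lemma U0_closed:
  assumes k: "k < n" and "a \<in> carrier A" "a' \<in> carrier A"
  shows "U0 k a a' \<in> carrier E"
  unfolding U0_def
proof (rule E_memI)
  note fd = f_closed[OF k assms(3)]
  show "(\<lambda>x. a \<otimes>\<^bsub>A\<^esub> \<phi> (f k a' x)) \<in> additive_maps A A"
    by (rule additive_maps_comp[OF additive_maps_comp[OF D_additive[OF fd] additive_maps_phi]
          additive_maps_lmult[OF assms(2)]])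
  show "a \<otimes>\<^bsub>A\<^esub> \<phi> (f k a' (x \<otimes>\<^bsub>A\<^esub> \<phi> b)) = a \<otimes>\<^bsub>A\<^esub> \<phi> (f k a' x) \<otimes>\<^bsub>A\<^esub> \<phi> b"
    if "x \<in> carrier A" "b \<in> carrier B" for x b
    using that assms fd by (simp add: D_linear D_closed phi_simps A.m_assoc)
qed

lemma U0_smult:
  assumes "k < n" "a \<in> carrier A" "x \<in> carrier A" "y \<in> carrier A"
  shows "U0 k (a \<otimes>\<^bsub>A\<^esub> x) y = lam a \<otimes>\<^bsub>E\<^esub> U0 k x y"
  by (rule E_eqI)
    (use assms in \<open>simp_all add: U0_closed End.phi_simps E_simps U0_apply A.m_assoc phi_simps D_closed f_closed\<close>)

lemma U0_rsmult:
  assumes "k < n" "a \<in> carrier A" "x \<in> carrier A" "y \<in> carrier A"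
  shows "U0 k x (y \<otimes>\<^bsub>A\<^esub> a) = U0 k x y \<otimes>\<^bsub>E\<^esub> lam a"
  by (rule E_eqI)
    (use assms in \<open>simp_all add: U0_closed End.phi_simps E_simps U0_apply f_rsmult D_simps\<close>)

lemma U0_balanced:
  assumes k: "k < n"
  shows "balanced B AB BA EE (U0 k)"
proof (rule balancedI)
  fix x x' y assume "x \<in> carrier AB" "x' \<in> carrier AB" "y \<in> carrier BA"
  then show "U0 k (x \<oplus>\<^bsub>AB\<^esub> x') y = U0 k x y \<oplus>\<^bsub>EE\<^esub> U0 k x' y"
    using k by (intro E_eqI)
      (simp_all add: U0_closed E_simps U0_apply A.l_distr phi_simps D_closed f_closed)
next
  fix x y y' assume "x \<in> carrier AB" "y \<in> carrier BA" "y' \<in> carrier BA"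
  then show "U0 k x (y \<oplus>\<^bsub>BA\<^esub> y') = U0 k x y \<oplus>\<^bsub>EE\<^esub> U0 k x y'"
    using k by (intro E_eqI)
      (simp_all add: U0_closed E_simps U0_apply A.r_distr phi_simps D_closed f_closed D_simps
        additive_maps_add[OF f_additive])
next
  fix x b y assume "x \<in> carrier AB" "b \<in> carrier B" "y \<in> carrier BA"
  then show "U0 k (x \<bullet>\<^bsub>AB\<^esub> b) y = U0 k x (b \<odot>\<^bsub>BA\<^esub> y)"
    using k by (intro E_eqI)
      (simp_all add: U0_closed U0_apply phi_simps D_closed f_closed D_simps f_smult A.m_assoc)
qed (simp add: U0_closed k)

lemma U_hom:
  assumes k: "k < n"
  shows "U k \<in> bimodule_hom A A T EE"
  unfolding U_def
  by (rule TT.tensor_lift_bimodule_hom[OF bimodule_EE U0_balanced[OF k]])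
    (simp_all add: k U0_smult U0_rsmult)

lemma U_additive: "k < n \<Longrightarrow> U k \<in> additive_maps T E"
  using left_hom_additive[of "U k" A T EE] U_hom[of k] by simp

lemma U_smult: "\<lbrakk>k < n; a \<in> carrier A; t \<in> carrier T\<rbrakk> \<Longrightarrow> U k (a \<odot>\<^bsub>T\<^esub> t) = lam a \<otimes>\<^bsub>E\<^esub> U k t"
  using left_hom_smult[of "U k" A T EE a t] U_hom[of k] by simp

lemma U_rsmult: "\<lbrakk>k < n; a \<in> carrier A; t \<in> carrier T\<rbrakk> \<Longrightarrow> U k (t \<bullet>\<^bsub>T\<^esub> a) = U k t \<otimes>\<^bsub>E\<^esub> lam a"
  using right_hom_rsmult[of "U k" A T EE t a] U_hom[of k] by simp

lemma U_tens: "\<lbrakk>k < n; x \<in> carrier A; y \<in> carrier A\<rbrakk> \<Longrightarrow> U k (tens x y) = U0 k x y"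
  using TT.tensor_lift_tensor[OF bimodule_abelian_group[OF bimodule_EE] U0_balanced[of k]]
  by (simp add: U_def)

lemma V_additive:
  assumes k: "k < n"
  shows "V k \<in> additive_maps E T"
  unfolding V_def
  by (rule additive_maps_finsum_closed[OF Tg J(1)])
    (intro additive_maps_comp[OF E_eval tens_additive_left] J_closed g_closed k \<alpha>)

lemma V_closed: "\<lbrakk>k < n; e \<in> carrier E\<rbrakk> \<Longrightarrow> V k e \<in> carrier T"
  using additive_maps_closed[OF V_additive] .

lemma V_term_closed: "\<lbrakk>k < n; e \<in> carrier E; j \<in> J\<rbrakk> \<Longrightarrow> tens (e j) (g k (\<alpha> j)) \<in> carrier T"
  by (rule tens_closed[OF E_closed[OF _ J_closed] g_closed[OF _ \<alpha>]])

lemma V_smult: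
  assumes k: "k < n" and a: "a \<in> carrier A" and e: "e \<in> carrier E"
  shows "V k (lam a \<otimes>\<^bsub>E\<^esub> e) = a \<odot>\<^bsub>T\<^esub> V k e"
proof -
  have "V k (lam a \<otimes>\<^bsub>E\<^esub> e) = (\<Oplus>\<^bsub>T\<^esub>j\<in>J. a \<odot>\<^bsub>T\<^esub> tens (e j) (g k (\<alpha> j)))"
    unfolding V_def
    by (intro TT.T.finsum_cong')
      (use k a e in \<open>auto simp: E_simps J_closed E_closed smult_tens g_closed \<alpha> tens_closed\<close>)
  also have "\<dots> = a \<odot>\<^bsub>T\<^esub> V k e"
    unfolding V_def using k e
    by (intro additive_maps_finsum[OF Tg Tg TT.smult_T_additive[OF a], symmetric])
      (auto simp: V_term_closed)
  finally show ?thesis .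
qed

text \<open>Right multiplication by \<open>a\<close> changes the arguments of \<open>e\<close> from
  \<open>i\<close> to \<open>a i\<close>, which must be rewritten in the dual basis. Expanding
  \<open>a i\<close> as the sum of the \<open>j \<phi> (\<alpha> j (a i))\<close>, each scalar
  passes through \<open>e\<close> by right linearity, across the tensor sign, and into
  \<open>g k\<close> by left linearity. After exchanging the sums, \<open>dual_expand\<close>
  collects the terms over \<open>i\<close> to \<alpha> \<open>j\<close> acted on by
  \<open>a\<close>, and \<open>g k\<close> is right linear.\<close>

lemma V_rsmult:
  assumes k: "k < n" and a: "a \<in> carrier A" and e: "e \<in> carrier E"
  shows "V k (e \<otimes>\<^bsub>E\<^esub> lam a) = V k e \<bullet>\<^bsub>T\<^esub> a"
proof -
  let ?h = "\<lambda>i j. tens (e j) (g k (\<alpha> j (a \<otimes>\<^bsub>A\<^esub> i) \<odot>\<^bsub>D\<^esub> \<alpha> i))"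
  have sm: "\<alpha> j (a \<otimes>\<^bsub>A\<^esub> i) \<odot>\<^bsub>D\<^esub> \<alpha> i \<in> carrier D" if "i \<in> J" "j \<in> J" for i j
    using that a by (intro D.smult_closed D_closed \<alpha>) (simp_all add: J_closed)
  have h_cl: "?h i j \<in> carrier T" if "i \<in> J" "j \<in> J" for i j
    using that by (intro tens_closed E_closed[OF e] g_closed[OF k] sm J_closed)
  have expand: "tens ((e \<otimes>\<^bsub>E\<^esub> lam a) i) (g k (\<alpha> i)) = (\<Oplus>\<^bsub>T\<^esub>j\<in>J. ?h i j)" if i: "i \<in> J" for i
  proof -
    have ai: "a \<otimes>\<^bsub>A\<^esub> i \<in> carrier A" using a J_closed[OF i] by simp
    have gi: "g k (\<alpha> i) \<in> carrier A" using g_closed[OF k \<alpha>[OF i]] .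
    note ad = additive_maps_comp[OF E_additive[OF e] tens_additive_left[OF gi]]
    have "tens ((e \<otimes>\<^bsub>E\<^esub> lam a) i) (g k (\<alpha> i)) =
        tens (e (\<Oplus>\<^bsub>A\<^esub>j\<in>J. j \<otimes>\<^bsub>A\<^esub> \<phi> (\<alpha> j (a \<otimes>\<^bsub>A\<^esub> i)))) (g k (\<alpha> i))"
      using a J_closed[OF i] by (simp add: E_simps basis)
    also have "\<dots> = (\<Oplus>\<^bsub>T\<^esub>j\<in>J. tens (e (j \<otimes>\<^bsub>A\<^esub> \<phi> (\<alpha> j (a \<otimes>\<^bsub>A\<^esub> i)))) (g k (\<alpha> i)))"
      by (intro additive_maps_finsum[OF Ag Tg ad]) (use ai in \<open>auto simp: J_closed phi_simps D_closed \<alpha>\<close>)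
    also have "\<dots> = (\<Oplus>\<^bsub>T\<^esub>j\<in>J. ?h i j)"
    proof (rule TT.T.finsum_cong')
      fix j assume j: "j \<in> J"
      have b: "\<alpha> j (a \<otimes>\<^bsub>A\<^esub> i) \<in> carrier B" by (rule D_closed[OF \<alpha>[OF j] ai])
      show "tens (e (j \<otimes>\<^bsub>A\<^esub> \<phi> (\<alpha> j (a \<otimes>\<^bsub>A\<^esub> i)))) (g k (\<alpha> i)) = ?h i j"
        by (simp add: E_linear[OF e J_closed[OF j] b] g_smult[OF k b \<alpha>[OF i]]
            tens_balanced[OF E_closed[OF e J_closed[OF j]] b gi])
    qed (use i h_cl in auto)
    finally show ?thesis .
  qed
  have collect: "(\<Oplus>\<^bsub>T\<^esub>i\<in>J. ?h i j) = tens (e j) (g k (\<alpha> j)) \<bullet>\<^bsub>T\<^esub> a" if j: "j \<in> J" for j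
  proof -
    have ej: "e j \<in> carrier A" by (rule E_closed[OF e J_closed[OF j]])
    have "(\<Oplus>\<^bsub>T\<^esub>i\<in>J. ?h i j) = tens (e j) (g k (\<Oplus>\<^bsub>D\<^esub>i\<in>J. \<alpha> j (a \<otimes>\<^bsub>A\<^esub> i) \<odot>\<^bsub>D\<^esub> \<alpha> i))"
      by (intro additive_maps_finsum[OF Dg Tg
            additive_maps_comp[OF g_additive[OF k] tens_additive_right[OF ej]], symmetric])
        (use sm j in auto)
    also have "(\<Oplus>\<^bsub>D\<^esub>i\<in>J. \<alpha> j (a \<otimes>\<^bsub>A\<^esub> i) \<odot>\<^bsub>D\<^esub> \<alpha> i) = (\<Oplus>\<^bsub>D\<^esub>i\<in>J. (\<alpha> j \<bullet>\<^bsub>D\<^esub> a) i \<odot>\<^bsub>D\<^esub> \<alpha> i)"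
      by (intro D.M.finsum_cong') (use sm j in \<open>auto simp: D_simps J_closed\<close>)
    also have "\<dots> = \<alpha> j \<bullet>\<^bsub>D\<^esub> a"
      by (intro dual_expand D.rsmult_closed \<alpha> j a)
    also have "tens (e j) (g k (\<alpha> j \<bullet>\<^bsub>D\<^esub> a)) = tens (e j) (g k (\<alpha> j)) \<bullet>\<^bsub>T\<^esub> a"
      by (simp only: g_rsmult[OF k a \<alpha>[OF j]] rsmult_tens[OF a ej g_closed[OF k \<alpha>[OF j]]])
    finally show ?thesis .
  qed
  have "V k (e \<otimes>\<^bsub>E\<^esub> lam a) = (\<Oplus>\<^bsub>T\<^esub>i\<in>J. \<Oplus>\<^bsub>T\<^esub>j\<in>J. ?h i j)"
    unfolding V_def by (rule TT.T.finsum_cong') (auto simp: expand h_cl intro!: TT.T.finsum_closed)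
  also have "\<dots> = (\<Oplus>\<^bsub>T\<^esub>j\<in>J. \<Oplus>\<^bsub>T\<^esub>i\<in>J. ?h i j)"
    by (rule TT.T.finsum_swap[OF J(1)]) (rule h_cl)
  also have "\<dots> = (\<Oplus>\<^bsub>T\<^esub>j\<in>J. tens (e j) (g k (\<alpha> j)) \<bullet>\<^bsub>T\<^esub> a)"
    by (rule TT.T.finsum_cong')
      (use k e a in \<open>auto simp: collect intro!: additive_maps_closed[OF TT.rsmult_T_additive] V_term_closed\<close>)
  also have "\<dots> = V k e \<bullet>\<^bsub>T\<^esub> a"
    unfolding V_def using k e
    by (intro additive_maps_finsum[OF Tg Tg TT.rsmult_T_additive[OF a], symmetric])
      (auto simp: V_term_closed)
  finally show ?thesis .
qed

text \<open>The scalars \<open>f k a' j\<close> move across the tensor sign and into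
  \<open>g k\<close>, where \<open>dual_expand\<close> reassembles \<open>f k a'\<close>.\<close>

lemma V_U0:
  assumes k: "k < n" and a: "a \<in> carrier A" and a': "a' \<in> carrier A"
  shows "V k (U0 k a a') = tens a (g k (f k a'))"
proof -
  note fa = f_closed[OF k a']
  have sm: "f k a' j \<odot>\<^bsub>D\<^esub> \<alpha> j \<in> carrier D" if "j \<in> J" for j
    by (intro D.smult_closed D_closed[OF fa] \<alpha> J_closed that)
  have "V k (U0 k a a') = (\<Oplus>\<^bsub>T\<^esub>j\<in>J. tens a (g k (f k a' j \<odot>\<^bsub>D\<^esub> \<alpha> j)))"
    unfolding V_def
  proof (rule TT.T.finsum_cong')
    fix j assume j: "j \<in> J"
    have "tens (U0 k a a' j) (g k (\<alpha> j)) = tens a (\<phi> (f k a' j) \<otimes>\<^bsub>A\<^esub> g k (\<alpha> j))"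
      using j k a fa by (simp add: U0_apply J_closed tens_balanced D_closed g_closed \<alpha>)
    then show "tens (U0 k a a' j) (g k (\<alpha> j)) = tens a (g k (f k a' j \<odot>\<^bsub>D\<^esub> \<alpha> j))"
      using j k fa by (simp add: g_smult J_closed D_closed \<alpha>)
  qed (use k a sm in \<open>auto intro!: tens_closed g_closed\<close>)
  also have "\<dots> = tens a (g k (\<Oplus>\<^bsub>D\<^esub>j\<in>J. f k a' j \<odot>\<^bsub>D\<^esub> \<alpha> j))"
    by (intro additive_maps_finsum[OF Dg Tg
          additive_maps_comp[OF g_additive[OF k] tens_additive_right[OF a]], symmetric])
      (use sm in auto)
  finally show ?thesis by (simp add: dual_expand fa)
qed

text \<open>Here \<open>gf\<close> is applied in the second tensor factor only. Stating the result
  for \<open>U0\<close> makes it available for \<open>a = 1\<close>, where the left factor is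
  supplied separately.\<close>

lemma V_U_sum:
  assumes a: "a \<in> carrier A" and a': "a' \<in> carrier A"
  shows "(\<Oplus>\<^bsub>T\<^esub>k\<in>{..<n}. V k (U0 k a a')) = tens a a'"
proof -
  have "(\<Oplus>\<^bsub>T\<^esub>k\<in>{..<n}. V k (U0 k a a')) = (\<Oplus>\<^bsub>T\<^esub>k\<in>{..<n}. tens a (g k (f k a')))"
    by (rule TT.T.finsum_cong') (use a a' in \<open>auto simp: V_U0 intro!: tens_closed g_closed f_closed\<close>)
  also have "\<dots> = tens a (\<Oplus>\<^bsub>A\<^esub>k\<in>{..<n}. g k (f k a'))"
    by (intro additive_maps_finsum[OF Ag Tg tens_additive_right[OF a], symmetric])
      (use a' in \<open>auto intro!: g_closed f_closed\<close>)
  finally show ?thesis by (simp add: gf a')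
qed

lemma V_U:
  assumes t: "t \<in> carrier T"
  shows "(\<Oplus>\<^bsub>T\<^esub>k\<in>{..<n}. V k (U k t)) = t"
proof (rule T_eqI[OF Tg _ _ _ t])
  show "(\<lambda>t. \<Oplus>\<^bsub>T\<^esub>k\<in>{..<n}. V k (U k t)) \<in> additive_maps T T"
    by (rule additive_maps_finsum_closed[OF Tg])
      (auto intro: additive_maps_comp[OF U_additive V_additive])
  show "(\<lambda>t. t) \<in> additive_maps T T" by (simp add: additive_maps_def)
  fix x y assume xy: "x \<in> carrier A" "y \<in> carrier A"
  have "(\<Oplus>\<^bsub>T\<^esub>k\<in>{..<n}. V k (U k (tens x y))) = (\<Oplus>\<^bsub>T\<^esub>k\<in>{..<n}. V k (U0 k x y))"
    by (rule TT.T.finsum_cong') (use xy in \<open>auto simp: U_tens intro!: V_closed U0_closed\<close>)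
  then show "(\<Oplus>\<^bsub>T\<^esub>k\<in>{..<n}. V k (U k (tens x y))) = tens x y"
    by (simp add: V_U_sum xy)
qed

text \<open>Applying \<open>- \<otimes>\<^sub>E A\<close> to \<open>E \<otimes>\<^sub>A E | E\<close> gives \<open>E | A\<close> as \<open>(A,B)\<close>-bimodules; here \<open>\<mu> x\<close> is
  \<open>r \<otimes> s \<mapsto> r \<otimes> s(x)\<close> followed by \<open>E \<otimes>\<^sub>A A \<cong> E\<close>.\<close>

definition \<mu> where "\<mu> x = tensor_lift A End.AB End.BA E (\<lambda>r s. r \<otimes>\<^bsub>E\<^esub> lam (s x))"

lemma mu_balanced:
  assumes x: "x \<in> carrier A"
  shows "balanced A End.AB End.BA E (\<lambda>r s. r \<otimes>\<^bsub>E\<^esub> lam (s x))"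
  by (rule balancedI)
    (use x in \<open>simp_all add: E_closed E_simps End.phi_simps End.A.l_distr End.A.r_distr End.A.m_assoc\<close>)

lemma mu_additive: "x \<in> carrier A \<Longrightarrow> \<mu> x \<in> additive_maps End.T E"
  unfolding \<mu>_def by (rule End.TT.tensor_lift_additive[OF Eg mu_balanced])

lemma mu_closed: "\<lbrakk>x \<in> carrier A; t \<in> carrier End.T\<rbrakk> \<Longrightarrow> \<mu> x t \<in> carrier E"
  using additive_maps_closed[OF mu_additive] .

lemma mu_tens: "\<lbrakk>x \<in> carrier A; r \<in> carrier E; s \<in> carrier E\<rbrakk>
    \<Longrightarrow> \<mu> x (End.tens r s) = r \<otimes>\<^bsub>E\<^esub> lam (s x)"
  unfolding \<mu>_def using End.TT.tensor_lift_tensor[OF Eg mu_balanced] by simp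

text \<open>The relation \<open>t e \<otimes> x = t \<otimes> e x\<close> of a tensor product over
  \<open>E\<close> whose first factor is \<open>E \<otimes>\<^sub>A E\<close>.\<close>

lemma mu_rsmult:
  assumes x: "x \<in> carrier A" and e: "e \<in> carrier E" and t: "t \<in> carrier End.T"
  shows "\<mu> x (t \<bullet>\<^bsub>End.T\<^esub> e) = \<mu> (e x) t"
  by (rule End.T_eqI[OF Eg additive_maps_comp[OF End.TT.rsmult_T_additive[OF e] mu_additive[OF x]]
        mu_additive[OF E_closed[OF e x]] _ t])
    (simp add: x e E_closed End.rsmult_tens mu_tens E_simps)

lemma mu_smult:
  assumes x: "x \<in> carrier A" and e: "e \<in> carrier E" and t: "t \<in> carrier End.T"
  shows "\<mu> x (e \<odot>\<^bsub>End.T\<^esub> t) = e \<otimes>\<^bsub>E\<^esub> \<mu> x t"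
  by (rule End.T_eqI[OF Eg additive_maps_comp[OF End.TT.smult_T_additive[OF e] mu_additive[OF x]]
        additive_maps_comp[OF mu_additive[OF x] End.additive_maps_lmult[OF e]] _ t])
    (simp add: x e E_closed End.smult_tens mu_tens End.A.m_assoc End.phi_simps)

lemma mu_add:
  assumes x: "x \<in> carrier A" and y: "y \<in> carrier A" and t: "t \<in> carrier End.T"
  shows "\<mu> (x \<oplus>\<^bsub>A\<^esub> y) t = \<mu> x t \<oplus>\<^bsub>E\<^esub> \<mu> y t"
  by (rule End.T_eqI[OF Eg mu_additive additive_maps_sum[OF Eg mu_additive mu_additive] _ t])
    (simp_all add: x y E_closed mu_tens additive_maps_add[OF E_additive] End.phi_simps End.A.r_distr)

lemma mu_rmult:
  assumes x: "x \<in> carrier A" and b: "b \<in> carrier B" and t: "t \<in> carrier End.T"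
  shows "\<mu> (x \<otimes>\<^bsub>A\<^esub> \<phi> b) t = \<mu> x t \<otimes>\<^bsub>E\<^esub> lam (\<phi> b)"
  by (rule End.T_eqI[OF Eg mu_additive
        additive_maps_comp[OF mu_additive[OF x] End.additive_maps_rmult] _ t])
    (simp_all add: x b E_closed mu_tens E_linear End.phi_simps phi_simps End.A.m_assoc)

lemma right_D2_if_End_left_D2:
  assumes "left_D2 E A lam"
  shows "right_D2 A B \<phi>"
proof -
  \<comment> \<open>In \<open>E \<otimes>\<^sub>E A\<close> the factor \<open>A\<close> is an
    \<open>(E,B)\<close>-bimodule, so what remains on the right is \<open>B\<close>, acting on
    \<open>E\<close> through \<phi> and \<open>lam\<close>.\<close>
  let ?E = "ring_bimodule E lam (\<lambda>b. lam (\<phi> b))"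
  have lam_phi: "(\<lambda>b. lam (\<phi> b)) \<in> ring_hom B E"
    by (rule ring_hom_memI) (simp_all add: phi_simps End.phi_simps)
  have bT: "bimodule A B T_AB"
    by (intro bimodule_tensor_square A.ring_axioms B.ring_axioms hom id_ring_hom)
  have bE: "bimodule A B ?E"
    by (intro bimodule_ring_bimodule A.ring_axioms B.ring_axioms End.A.ring_axioms End.hom lam_phi)
  have TE: "bimodule_divides A B T_AB ?E"
  proof (rule bimodule_dividesI_finsum[OF bT bE, of "{..<n}" U V])
    fix k assume "k \<in> {..<n}"
    then have k: "k < n" by simp
    show "U k \<in> bimodule_hom A B T_AB ?E"
      using k by (intro bimodule_homI)
        (simp_all add: additive_maps_tensor_square tensor_square_simps U_additive U_smult U_rsmult phi_simps)
    show "V k \<in> bimodule_hom A B ?E T_AB"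
      using k by (intro bimodule_homI)
        (simp_all add: additive_maps_tensor_square tensor_square_simps V_additive V_smult V_rsmult phi_simps)
  next
    fix t assume "t \<in> carrier T_AB"
    then show "(\<Oplus>\<^bsub>T_AB\<^esub>k\<in>{..<n}. V k (U k t)) = t"
      by (simp add: finsum_tensor_square tensor_square_simps V_U)
  qed simp
  have EA: "bimodule_divides A B ?E AB"
  proof -
    obtain m :: nat and p q where p: "\<And>k. k < m \<Longrightarrow> p k \<in> additive_maps End.T E"
      and p_l: "\<And>k b t. \<lbrakk>k < m; b \<in> carrier A; t \<in> carrier End.T\<rbrakk>
        \<Longrightarrow> p k (lam b \<odot>\<^bsub>End.T\<^esub> t) = lam b \<otimes>\<^bsub>E\<^esub> p k t"
      and p_r: "\<And>k t a. \<lbrakk>k < m; t \<in> carrier End.T; a \<in> carrier E\<rbrakk> \<Longrightarrow> p k (t \<bullet>\<^bsub>End.T\<^esub> a) = p k t \<otimes>\<^bsub>E\<^esub> a"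
      and q: "\<And>k. k < m \<Longrightarrow> q k \<in> additive_maps E End.T"
      and q_l: "\<And>k b x. \<lbrakk>k < m; b \<in> carrier A; x \<in> carrier E\<rbrakk>
        \<Longrightarrow> q k (lam b \<otimes>\<^bsub>E\<^esub> x) = lam b \<odot>\<^bsub>End.T\<^esub> q k x"
      and q_r: "\<And>k x a. \<lbrakk>k < m; x \<in> carrier E; a \<in> carrier E\<rbrakk> \<Longrightarrow> q k (x \<otimes>\<^bsub>E\<^esub> a) = q k x \<bullet>\<^bsub>End.T\<^esub> a"
      and qp: "\<And>t. t \<in> carrier End.T \<Longrightarrow> (\<Oplus>\<^bsub>End.T\<^esub>k\<in>{..<m}. q k (p k t)) = t"
      by (rule End.left_D2_data[OF assms]) (rule that)
    let ?u = "\<one>\<^bsub>A\<^esub>" and ?I = "\<one>\<^bsub>E\<^esub>"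
    note p_cl = additive_maps_closed[OF p] and q_cl = additive_maps_closed[OF q]
    have q1_l: "q k e = q k ?I \<bullet>\<^bsub>End.T\<^esub> e" if "k < m" "e \<in> carrier E" for k e
      using q_r[OF that(1), of ?I e] that by simp
    \<comment> \<open>Both sides equal \<open>q k (lam a)\<close>: one by right linearity over
      \<open>E\<close>, the other by left linearity over \<open>A\<close>.\<close>
    have comm: "q k ?I \<bullet>\<^bsub>End.T\<^esub> lam a = lam a \<odot>\<^bsub>End.T\<^esub> q k ?I" if "k < m" "a \<in> carrier A" for k a
      using q_l[OF that, of ?I] q1_l[OF that(1), of "lam a"] that End.phi_simps(1) by simp
    note tc = End.tens_closed
    \<comment> \<open>These are \<open>p k\<close> and \<open>q k\<close> tensored with
      \<open>A\<close> over \<open>E\<close>. An endomorphism \<open>e\<close> corresponds to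
      \<open>e \<otimes> 1 \<otimes> 1\<close> and \<open>E \<otimes>\<^sub>E A\<close> is
      identified with \<open>A\<close> by evaluation, which gives \<open>?P\<close>; an element
      \<open>x\<close> corresponds to \<open>1 \<otimes> x\<close> and is sent to
      \<open>q k 1 \<otimes> x\<close>, which gives \<open>?Q\<close>.\<close>
    let ?P = "\<lambda>k e. p k (End.tens e ?I) ?u" and ?Q = "\<lambda>k x. \<mu> x (q k ?I)"
    have Pk: "?P k \<in> bimodule_hom A B ?E AB" if k: "k < m" for k
    proof (rule bimodule_homI)
      show "?P k \<in> additive_maps ?E AB"
        unfolding additive_maps_ring_bimodule
        by (rule additive_mapsI)
          (simp_all add: k tc p_cl E_closed End.tens_add_left additive_maps_add[OF p[OF k]] E_simps)
      fix a e assume a: "a \<in> carrier A" and e: "e \<in> carrier ?E"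
      have "?P k e \<in> carrier A" using E_closed[OF p_cl[OF k tc[of e ?I]] A.one_closed] e by simp
      with a e show "?P k (a \<odot>\<^bsub>?E\<^esub> e) = a \<odot>\<^bsub>AB\<^esub> ?P k e"
        using p_l[OF k, of a "End.tens e ?I"] k
        by (simp add: End.smult_tens End.phi_simps tc E_simps)
    next
      fix e b assume e: "e \<in> carrier ?E" and b: "b \<in> carrier B"
      have l: "lam (\<phi> b) \<in> carrier E" by (simp add: b phi_simps End.phi_simps)
      \<comment> \<open>Moving \<open>lam (\<phi> b)\<close> to the second factor makes it a right
        multiplication, which \<open>p k\<close> respects; evaluated at \<open>1\<close> it becomes
        \<open>\<phi> b\<close>, which the right \<open>B\<close>-linear value of \<open>p k\<close>
        releases.\<close>
      have "End.tens (e \<otimes>\<^bsub>E\<^esub> lam (\<phi> b)) ?I = End.tens e ?I \<bullet>\<^bsub>End.T\<^esub> lam (\<phi> b)"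
        using e b l End.tens_balanced[of e "\<phi> b" ?I] by (simp add: End.rsmult_tens phi_simps)
      then have "?P k (e \<bullet>\<^bsub>?E\<^esub> b) = p k (End.tens e ?I) (?u \<otimes>\<^bsub>A\<^esub> \<phi> b)"
        using e b l k by (simp add: p_r tc E_simps phi_simps)
      also have "\<dots> = ?P k e \<otimes>\<^bsub>A\<^esub> \<phi> b"
        using e b k by (intro E_linear p_cl tc) simp_all
      finally show "?P k (e \<bullet>\<^bsub>?E\<^esub> b) = ?P k e \<bullet>\<^bsub>AB\<^esub> b" by simp
    qed
    have Qk: "?Q k \<in> bimodule_hom A B AB ?E" if k: "k < m" for k
    proof (rule bimodule_homI)
      show "?Q k \<in> additive_maps AB ?E"
        unfolding additive_maps_ring_bimodule
        by (rule additive_mapsI) (simp_all add: k mu_closed mu_add q_cl)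
      fix a x assume a: "a \<in> carrier A" and x: "x \<in> carrier AB"
      \<comment> \<open>Since \<open>lam a x\<close> is the product of \<open>a\<close> and
        \<open>x\<close>, the scalar acts on \<open>q k 1\<close> from the right;
        \<open>comm\<close> carries it to the left, and \<open>mu_smult\<close> takes it
        out.\<close>
      have "\<mu> (lam a x) (q k ?I) = \<mu> x (q k ?I \<bullet>\<^bsub>End.T\<^esub> lam a)"
        using a x k by (simp add: mu_rsmult End.phi_simps q_cl)
      then show "?Q k (a \<odot>\<^bsub>AB\<^esub> x) = a \<odot>\<^bsub>?E\<^esub> ?Q k x"
        using a x k by (simp add: E_simps comm mu_smult End.phi_simps q_cl)
    next
      fix x b assume "x \<in> carrier AB" "b \<in> carrier B"
      then show "?Q k (x \<bullet>\<^bsub>AB\<^esub> b) = ?Q k x \<bullet>\<^bsub>?E\<^esub> b"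
        using k by (simp add: mu_rmult q_cl)
    qed
    show ?thesis
    proof (rule bimodule_dividesI_finsum[OF bE bimodule_AB, of "{..<m}" ?P ?Q])
      fix e assume "e \<in> carrier ?E"
      then have e: "e \<in> carrier E" by simp
      let ?t = "End.tens e ?I"
      have t: "?t \<in> carrier End.T" using e by (simp add: tc)
      have "(\<Oplus>\<^bsub>?E\<^esub>k\<in>{..<m}. ?Q k (?P k e)) = (\<Oplus>\<^bsub>E\<^esub>k\<in>{..<m}. ?Q k (?P k e))" by simp
      \<comment> \<open>Evaluating \<open>p k ?t\<close> at \<open>1\<close> inside \<mu> is, by
        \<open>mu_rsmult\<close>, the same as multiplying \<open>q k 1\<close> by
        \<open>p k ?t\<close> on the right, and this product is \<open>q k (p k ?t)\<close>.\<close>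
      also have "\<dots> = (\<Oplus>\<^bsub>E\<^esub>k\<in>{..<m}. \<mu> ?u (q k (p k ?t)))"
      proof (rule End.A.finsum_cong')
        fix k assume "k \<in> {..<m}"
        then show "?Q k (?P k e) = \<mu> ?u (q k (p k ?t))"
          using t q1_l[of k "p k ?t"] by (simp add: mu_rsmult p_cl q_cl)
      qed (use t in \<open>auto simp: mu_closed p_cl q_cl\<close>)
      also have "\<dots> = \<mu> ?u (\<Oplus>\<^bsub>End.T\<^esub>k\<in>{..<m}. q k (p k ?t))"
        by (intro additive_maps_finsum[OF End.TT.abelian_group_T Eg mu_additive, symmetric])
          (use t in \<open>auto simp: p_cl q_cl\<close>)
      also have "\<dots> = e"
        using e by (simp add: qp t mu_tens E_simps End.phi_simps)
      finally show "(\<Oplus>\<^bsub>?E\<^esub>k\<in>{..<m}. ?Q k (?P k e)) = e" .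
    qed (use Pk Qk in blast)+
  qed
  show ?thesis
    unfolding right_D2_def bimodule_similar_def
    using bimodule_divides_trans[OF bT bE bimodule_AB TE EA] divides_tensor_square(1) by blast
qed

text \<open>Composition makes \<open>D\<close> a right \<open>E\<close>-module, the structure behind
  \<open>D \<otimes>\<^sub>E -\<close>. Along \<open>lam\<close> it restricts to the right
  \<open>A\<close>-action of the dual. The restriction to the carrier keeps the values
  extensional.\<close>

definition act where "act \<beta> e = (\<lambda>x\<in>carrier A. \<beta> (e x))"

lemma act_apply: "x \<in> carrier A \<Longrightarrow> act \<beta> e x = \<beta> (e x)"
  by (simp add: act_def)

lemma act_closed:
  assumes "\<beta> \<in> carrier D" "e \<in> carrier E"
  shows "act \<beta> e \<in> carrier D"
  unfolding act_def
  by (rule D_memI[OF additive_maps_comp[OF E_additive[OF assms(2)] D_additive[OF assms(1)]]])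
    (simp add: assms E_linear D_linear E_closed)

lemma act_mult:
  assumes "\<beta> \<in> carrier D" "e \<in> carrier E" "e' \<in> carrier E"
  shows "act \<beta> (e \<otimes>\<^bsub>E\<^esub> e') = act (act \<beta> e) e'"
  by (rule D_eqI) (use assms in \<open>simp_all add: act_closed act_apply E_simps E_closed\<close>)

lemma act_add_left:
  assumes "\<beta> \<in> carrier D" "\<beta>' \<in> carrier D" "e \<in> carrier E"
  shows "act (\<beta> \<oplus>\<^bsub>D\<^esub> \<beta>') e = act \<beta> e \<oplus>\<^bsub>D\<^esub> act \<beta>' e"
  by (rule D_eqI) (use assms in \<open>simp_all add: act_closed act_apply D_simps E_closed\<close>)

lemma act_add_right:
  assumes "\<beta> \<in> carrier D" "e \<in> carrier E" "e' \<in> carrier E"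
  shows "act \<beta> (e \<oplus>\<^bsub>E\<^esub> e') = act \<beta> e \<oplus>\<^bsub>D\<^esub> act \<beta> e'"
  by (rule D_eqI)
    (use assms in \<open>simp_all add: act_closed act_apply D_simps E_simps E_closed
      additive_maps_add[OF D_additive]\<close>)

lemma act_smult:
  assumes "b \<in> carrier B" "\<beta> \<in> carrier D" "e \<in> carrier E"
  shows "act (b \<odot>\<^bsub>D\<^esub> \<beta>) e = b \<odot>\<^bsub>D\<^esub> act \<beta> e"
  by (rule D_eqI)
    (use assms in \<open>simp_all add: act_closed act_apply D_simps E_closed D.smult_closed\<close>)

lemma act_lam:
  assumes "a \<in> carrier A" "\<beta> \<in> carrier D"
  shows "act \<beta> (lam a) = \<beta> \<bullet>\<^bsub>D\<^esub> a"
  by (rule D_eqI)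
    (use assms in \<open>simp_all add: act_closed act_apply D_simps E_simps End.phi_simps D.rsmult_closed\<close>)

lemma act_one:
  assumes "\<beta> \<in> carrier D"
  shows "act \<beta> \<one>\<^bsub>E\<^esub> = \<beta>"
  by (rule D_eqI) (use assms in \<open>simp_all add: act_closed act_apply E_simps\<close>)

text \<open>The element \<open>\<beta> \<otimes> r \<otimes> s\<close> of
  \<open>D \<otimes>\<^sub>E E \<otimes>\<^sub>A E\<close> becomes
  \<open>\<beta> r \<otimes> s\<close> in \<open>D \<otimes>\<^sub>A E\<close>, and
  \<open>g l \<otimes> V l'\<close> sends it to \<open>A \<otimes>\<^sub>A T\<close>, which is
  \<open>T\<close> by scalar multiplication. Fixing \<beta> leaves a map out of a single tensor
  product.\<close>

definition \<nu>0 where "\<nu>0 l l' \<beta> r s = g l (act \<beta> r) \<odot>\<^bsub>T\<^esub> V l' s"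
definition \<nu> where "\<nu> l l' \<beta> = tensor_lift A End.AB End.BA T (\<nu>0 l l' \<beta>)"

lemmas smult_T_closed = additive_maps_closed[OF TT.smult_T_additive]
  and smult_T_add = additive_maps_add[OF TT.smult_T_additive]
  and rsmult_T_closed = additive_maps_closed[OF TT.rsmult_T_additive]

lemma nu0_closed:
  assumes "l < n" "l' < n" "\<beta> \<in> carrier D" "r \<in> carrier E" "s \<in> carrier E"
  shows "\<nu>0 l l' \<beta> r s \<in> carrier T"
  unfolding \<nu>0_def
  by (rule smult_T_closed[OF g_closed[OF assms(1) act_closed[OF assms(3,4)]] V_closed[OF assms(2,5)]])

interpretation bT: bimodule A A T
  by (rule bimodule_T)

lemma nu0_balanced:
  assumes l: "l < n" "l' < n" and be: "\<beta> \<in> carrier D"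
  shows "balanced A End.AB End.BA T (\<nu>0 l l' \<beta>)"
proof (rule balancedI)
  fix r r' s assume "r \<in> carrier End.AB" "r' \<in> carrier End.AB" "s \<in> carrier End.BA"
  then show "\<nu>0 l l' \<beta> (r \<oplus>\<^bsub>End.AB\<^esub> r') s = \<nu>0 l l' \<beta> r s \<oplus>\<^bsub>T\<^esub> \<nu>0 l l' \<beta> r' s"
    using l be
    by (simp add: \<nu>0_def act_add_right act_closed additive_maps_add[OF g_additive] g_closed V_closed
        bT.smult_l_distr)
next
  fix r s s' assume "r \<in> carrier End.AB" "s \<in> carrier End.BA" "s' \<in> carrier End.BA"
  then show "\<nu>0 l l' \<beta> r (s \<oplus>\<^bsub>End.BA\<^esub> s') = \<nu>0 l l' \<beta> r s \<oplus>\<^bsub>T\<^esub> \<nu>0 l l' \<beta> r s'"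
    using l be
    by (simp add: \<nu>0_def act_closed additive_maps_add[OF V_additive] g_closed V_closed bT.smult_r_distr)
next
  fix r a s assume "r \<in> carrier End.AB" "a \<in> carrier A" "s \<in> carrier End.BA"
  then show "\<nu>0 l l' \<beta> (r \<bullet>\<^bsub>End.AB\<^esub> a) s = \<nu>0 l l' \<beta> r (a \<odot>\<^bsub>End.BA\<^esub> s)"
    using l be
    by (simp add: \<nu>0_def act_closed act_mult act_lam End.phi_simps g_rsmult g_closed V_closed V_smult
        bT.smult_assoc)
qed (simp add: nu0_closed l be)

lemma nu_additive: "\<lbrakk>l < n; l' < n; \<beta> \<in> carrier D\<rbrakk> \<Longrightarrow> \<nu> l l' \<beta> \<in> additive_maps End.T T"
  unfolding \<nu>_def by (rule End.TT.tensor_lift_additive[OF Tg nu0_balanced])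

lemma nu_closed: "\<lbrakk>l < n; l' < n; \<beta> \<in> carrier D; t \<in> carrier End.T\<rbrakk> \<Longrightarrow> \<nu> l l' \<beta> t \<in> carrier T"
  using additive_maps_closed[OF nu_additive] .

lemma nu_tens: "\<lbrakk>l < n; l' < n; \<beta> \<in> carrier D; r \<in> carrier E; s \<in> carrier E\<rbrakk>
    \<Longrightarrow> \<nu> l l' \<beta> (End.tens r s) = \<nu>0 l l' \<beta> r s"
  unfolding \<nu>_def using End.TT.tensor_lift_tensor[OF Tg nu0_balanced] by simp

text \<open>The relation \<open>\<beta> e \<otimes> t = \<beta> \<otimes> e t\<close> of a tensor
  product over \<open>E\<close>.\<close>

lemma nu_act:
  assumes l: "l < n" "l' < n" and be: "\<beta> \<in> carrier D" and e: "e \<in> carrier E" and t: "t \<in> carrier End.T"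
  shows "\<nu> l l' (act \<beta> e) t = \<nu> l l' \<beta> (e \<odot>\<^bsub>End.T\<^esub> t)"
  by (rule End.T_eqI[OF Tg nu_additive[OF l act_closed[OF be e]]
        additive_maps_comp[OF End.TT.smult_T_additive[OF e] nu_additive[OF l be]] _ t])
    (simp add: l be e act_closed nu_tens End.smult_tens \<nu>0_def act_mult)

lemma nu_add:
  assumes l: "l < n" "l' < n" and be: "\<beta> \<in> carrier D" "\<beta>' \<in> carrier D" and t: "t \<in> carrier End.T"
  shows "\<nu> l l' (\<beta> \<oplus>\<^bsub>D\<^esub> \<beta>') t = \<nu> l l' \<beta> t \<oplus>\<^bsub>T\<^esub> \<nu> l l' \<beta>' t"
  by (rule End.T_eqI[OF Tg nu_additive[OF l D.M.a_closed[OF be]]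
        additive_maps_sum[OF Tg nu_additive[OF l be(1)] nu_additive[OF l be(2)]] _ t])
    (simp add: l be nu_tens \<nu>0_def act_add_left act_closed additive_maps_add[OF g_additive] g_closed
      V_closed bT.smult_l_distr)

lemma nu_smult:
  assumes l: "l < n" "l' < n" and be: "\<beta> \<in> carrier D" and b: "b \<in> carrier B" and t: "t \<in> carrier End.T"
  shows "\<nu> l l' (b \<odot>\<^bsub>D\<^esub> \<beta>) t = \<phi> b \<odot>\<^bsub>T\<^esub> \<nu> l l' \<beta> t"
proof -
  have p: "\<phi> b \<in> carrier A" using b by (simp add: phi_simps)
  show ?thesis
    by (rule End.T_eqI[OF Tg nu_additive[OF l D.smult_closed[OF b be]]
          additive_maps_comp[OF nu_additive[OF l be] TT.smult_T_additive[OF p]] _ t])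
      (simp add: l be b p nu_tens \<nu>0_def act_smult D.smult_closed act_closed g_smult g_closed
        V_closed bT.smult_assoc)
qed

lemma nu_rsmult:
  assumes l: "l < n" "l' < n" and be: "\<beta> \<in> carrier D" and a: "a \<in> carrier A" and t: "t \<in> carrier End.T"
  shows "\<nu> l l' \<beta> (t \<bullet>\<^bsub>End.T\<^esub> lam a) = \<nu> l l' \<beta> t \<bullet>\<^bsub>T\<^esub> a"
proof -
  have p: "lam a \<in> carrier E" using a by (simp add: End.phi_simps)
  show ?thesis
    by (rule End.T_eqI[OF Tg additive_maps_comp[OF End.TT.rsmult_T_additive[OF p] nu_additive[OF l be]]
          additive_maps_comp[OF nu_additive[OF l be] TT.rsmult_T_additive[OF a]] _ t])
      (simp add: l be a p nu_tens End.rsmult_tens \<nu>0_def act_closed g_closed V_closed V_rsmult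
        bT.smult_rsmult_assoc)
qed

text \<open>Applying \<open>(A\<^sub>B)\<^sup>* \<otimes>\<^sub>E -\<close> to \<open>E \<otimes>\<^sub>A E | E\<close> gives \<open>(A\<^sub>B)\<^sup>* \<otimes>\<^sub>A E | (A\<^sub>B)\<^sup>*\<close> as
  \<open>(B,A)\<close>-bimodules, and \<open>A \<otimes>\<^sub>B A | (A\<^sub>B)\<^sup>* \<otimes>\<^sub>A E\<close>.\<close>

lemma left_D2_if_End_right_D2:
  assumes "right_D2 E A lam" and DA: "bimodule_divides B A D BA"
  shows "left_D2 A B \<phi>"
proof -
  have bT: "bimodule B A T_BA"
    by (intro bimodule_tensor_square A.ring_axioms B.ring_axioms hom id_ring_hom)
  note bTg = bimodule_abelian_group[OF bT]
  obtain m :: nat and p q where p: "\<And>k. k < m \<Longrightarrow> p k \<in> additive_maps End.T E"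
    and p_l: "\<And>k a t. \<lbrakk>k < m; a \<in> carrier E; t \<in> carrier End.T\<rbrakk> \<Longrightarrow> p k (a \<odot>\<^bsub>End.T\<^esub> t) = a \<otimes>\<^bsub>E\<^esub> p k t"
    and p_r: "\<And>k t b. \<lbrakk>k < m; t \<in> carrier End.T; b \<in> carrier A\<rbrakk>
      \<Longrightarrow> p k (t \<bullet>\<^bsub>End.T\<^esub> lam b) = p k t \<otimes>\<^bsub>E\<^esub> lam b"
    and q: "\<And>k. k < m \<Longrightarrow> q k \<in> additive_maps E End.T"
    and q_l: "\<And>k a x. \<lbrakk>k < m; a \<in> carrier E; x \<in> carrier E\<rbrakk> \<Longrightarrow> q k (a \<otimes>\<^bsub>E\<^esub> x) = a \<odot>\<^bsub>End.T\<^esub> q k x"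
    and q_r: "\<And>k x b. \<lbrakk>k < m; x \<in> carrier E; b \<in> carrier A\<rbrakk>
      \<Longrightarrow> q k (x \<otimes>\<^bsub>E\<^esub> lam b) = q k x \<bullet>\<^bsub>End.T\<^esub> lam b"
    and qp: "\<And>t. t \<in> carrier End.T \<Longrightarrow> (\<Oplus>\<^bsub>End.T\<^esub>k\<in>{..<m}. q k (p k t)) = t"
    by (rule End.right_D2_data[OF assms(1)]) (rule that)
  let ?u = "\<one>\<^bsub>A\<^esub>" and ?I = "\<one>\<^bsub>E\<^esub>"
  note p_cl = additive_maps_closed[OF p] and q_cl = additive_maps_closed[OF q]
  note tc = End.tens_closed
  \<comment> \<open>Now \<open>q k\<close> is linear over \<open>E\<close> on the left, and again
    its value at the unit determines it.\<close>
  have q1_l: "q k e = e \<odot>\<^bsub>End.T\<^esub> q k ?I" if "k < m" "e \<in> carrier E" for k e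
    using q_l[OF that, of ?I] that by simp
  have comm: "q k ?I \<bullet>\<^bsub>End.T\<^esub> lam a = lam a \<odot>\<^bsub>End.T\<^esub> q k ?I" if "k < m" "a \<in> carrier A" for k a
    using q_r[OF that(1) _ that(2), of ?I] q1_l[OF that(1), of "lam a"] that End.phi_simps(1) by simp
  \<comment> \<open>The pure tensor \<open>1 \<otimes> y\<close> goes to \<open>E\<close> under
    \<open>U l'\<close> and from there to \<open>E \<otimes>\<^sub>A E\<close> as the second factor.
    The other factor \<open>x\<close> of \<open>x \<otimes> y\<close> is kept in \<open>D\<close> as
    \<open>f l x\<close>.\<close>
  define w where "w l' y = End.tens ?I (U0 l' ?u y)" for l' y
  have w_cl: "w l' y \<in> carrier End.T" if "l' < n" "y \<in> carrier A" for l' y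
    unfolding w_def using that by (intro tc U0_closed) simp_all
  have w_add: "w l' (y \<oplus>\<^bsub>A\<^esub> y') = w l' y \<oplus>\<^bsub>End.T\<^esub> w l' y'"
    if "l' < n" "y \<in> carrier A" "y' \<in> carrier A" for l' y y'
  proof -
    have "U0 l' ?u (y \<oplus>\<^bsub>A\<^esub> y') = U0 l' ?u y \<oplus>\<^bsub>E\<^esub> U0 l' ?u y'"
      using additive_maps_add[of "U0 l' ?u" A E y y'] U0_balanced[OF that(1)] that
      by (simp add: balanced_def)
    then show ?thesis using that by (simp add: w_def U0_closed End.tens_add_right)
  qed
  have w_r: "w l' (y \<otimes>\<^bsub>A\<^esub> a) = w l' y \<bullet>\<^bsub>End.T\<^esub> lam a" if "l' < n" "y \<in> carrier A" "a \<in> carrier A" for l' y a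
    using that by (simp add: w_def U0_rsmult End.rsmult_tens U0_closed End.phi_simps)
  \<comment> \<open>A scalar from \<open>B\<close> crosses two tensor signs: over \<open>B\<close>
    inside \<open>U0\<close>, then over \<open>A\<close> next to the unit of \<open>E\<close>. This
    is what makes \<open>u0\<close> balanced.\<close>
  have w_l: "w l' (\<phi> b \<otimes>\<^bsub>A\<^esub> y) = lam (\<phi> b) \<odot>\<^bsub>End.T\<^esub> w l' y" if "l' < n" "y \<in> carrier A" "b \<in> carrier B" for l' y b
  proof -
    have pb: "\<phi> b \<in> carrier A" using that by (simp add: phi_simps)
    have "U0 l' ?u (\<phi> b \<otimes>\<^bsub>A\<^esub> y) = U0 l' (?u \<otimes>\<^bsub>A\<^esub> \<phi> b) y"
      using U0_balanced[OF that(1)] that by (simp add: balanced_def)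
    also have "\<dots> = lam (\<phi> b) \<otimes>\<^bsub>E\<^esub> U0 l' ?u y"
      using U0_smult[of l' "\<phi> b" ?u y] that pb by simp
    finally show ?thesis
      using that pb End.tens_balanced[of ?I "\<phi> b" "U0 l' ?u y"]
      by (simp add: w_def End.smult_tens U0_closed End.phi_simps)
  qed
  \<comment> \<open>The element \<open>f l x \<otimes> w l' y\<close> of
    \<open>D \<otimes>\<^sub>E (E \<otimes>\<^sub>A E)\<close> is mapped by \<open>p k\<close> to
    \<open>D \<otimes>\<^sub>E E\<close>, identified with \<open>D\<close> by
    \<open>act\<close>.\<close>
  define u0 where "u0 l l' k x y = act (f l x) (p k (w l' y))" for l l' k x y
  define u where "u l l' k = tensor_lift B AB BA D (u0 l l' k)" for l l' k
  \<comment> \<open>The way back: \<beta> goes to \<open>\<beta> \<otimes> q k 1\<close>, and \<nu>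
    brings the result to \<open>T\<close>.\<close>
  define v where "v l l' k \<beta> = \<nu> l l' \<beta> (q k ?I)" for l l' k \<beta>
  have pw_cl: "p k (w l' y) \<in> carrier E" if "k < m" "l' < n" "y \<in> carrier A" for k l' y
    using p_cl w_cl that by blast
  have u0_cl: "u0 l l' k x y \<in> carrier D"
    if "l < n" "l' < n" "k < m" "x \<in> carrier A" "y \<in> carrier A" for l l' k x y
    unfolding u0_def by (rule act_closed[OF f_closed pw_cl]) (rule that)+
  have u0_bal: "balanced B AB BA D (u0 l l' k)" if l: "l < n" "l' < n" "k < m" for l l' k
  proof (rule balancedI)
    fix x x' y assume "x \<in> carrier AB" "x' \<in> carrier AB" "y \<in> carrier BA"
    then show "u0 l l' k (x \<oplus>\<^bsub>AB\<^esub> x') y = u0 l l' k x y \<oplus>\<^bsub>D\<^esub> u0 l l' k x' y"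
      using l by (simp add: u0_def additive_maps_add[OF f_additive] act_add_left f_closed pw_cl)
  next
    fix x y y' assume "x \<in> carrier AB" "y \<in> carrier BA" "y' \<in> carrier BA"
    then show "u0 l l' k x (y \<oplus>\<^bsub>BA\<^esub> y') = u0 l l' k x y \<oplus>\<^bsub>D\<^esub> u0 l l' k x y'"
      using l by (simp add: u0_def w_add additive_maps_add[OF p] w_cl act_add_right f_closed pw_cl)
  next
    fix x b y assume "x \<in> carrier AB" "b \<in> carrier B" "y \<in> carrier BA"
    then show "u0 l l' k (x \<bullet>\<^bsub>AB\<^esub> b) y = u0 l l' k x (b \<odot>\<^bsub>BA\<^esub> y)"
      using l by (simp add: u0_def phi_simps f_rsmult w_l p_l End.phi_simps w_cl act_mult f_closed
          pw_cl act_lam)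
  qed (simp add: u0_cl l)
  have u0_l: "u0 l l' k (\<phi> b \<otimes>\<^bsub>A\<^esub> x) y = b \<odot>\<^bsub>D\<^esub> u0 l l' k x y"
    if "l < n" "l' < n" "k < m" "b \<in> carrier B" "x \<in> carrier A" "y \<in> carrier A" for l l' k b x y
    using that by (simp add: u0_def f_smult act_smult f_closed pw_cl)
  have u0_r: "u0 l l' k x (y \<otimes>\<^bsub>A\<^esub> a) = u0 l l' k x y \<bullet>\<^bsub>D\<^esub> a"
    if "l < n" "l' < n" "k < m" "a \<in> carrier A" "x \<in> carrier A" "y \<in> carrier A" for l l' k a x y
    using that
    by (simp add: u0_def w_r p_r w_cl act_mult End.phi_simps f_closed pw_cl act_lam act_closed)
  note u_lift = TT.tensor_lift_additive[OF Dg u0_bal, folded u_def]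
  have u_tens: "u l l' k (tens x y) = u0 l l' k x y"
    if "l < n" "l' < n" "k < m" "x \<in> carrier A" "y \<in> carrier A" for l l' k x y
    using TT.tensor_lift_tensor[OF Dg u0_bal[OF that(1-3)]] that by (simp add: u_def)
  have u_hom: "u l l' k \<in> bimodule_hom B A T_BA D" if l: "l < n" "l' < n" "k < m" for l l' k
  proof (rule bimodule_homI)
    show "u l l' k \<in> additive_maps T_BA D"
      by (simp add: additive_maps_tensor_square u_lift l)
    show "u l l' k (b \<odot>\<^bsub>T_BA\<^esub> t) = b \<odot>\<^bsub>D\<^esub> u l l' k t" if b: "b \<in> carrier B" and t: "t \<in> carrier T_BA" for b t
    proof -
      have pb: "\<phi> b \<in> carrier A" using b by (simp add: phi_simps)
      have "u l l' k (\<phi> b \<odot>\<^bsub>T\<^esub> t) = b \<odot>\<^bsub>D\<^esub> u l l' k t"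
        by (rule T_eqI[OF Dg additive_maps_comp[OF TT.smult_T_additive[OF pb] u_lift[OF l]]
              additive_maps_comp[OF u_lift[OF l] bimodule_smult_additive[OF bimodule_D b]]])
          (use t l b pb in \<open>simp_all add: tensor_square_simps smult_tens u_tens u0_l\<close>)
      then show ?thesis by (simp add: tensor_square_simps)
    qed
    show "u l l' k (t \<bullet>\<^bsub>T_BA\<^esub> a) = u l l' k t \<bullet>\<^bsub>D\<^esub> a" if a: "a \<in> carrier A" and t: "t \<in> carrier T_BA" for a t
    proof -
      have "u l l' k (t \<bullet>\<^bsub>T\<^esub> a) = u l l' k t \<bullet>\<^bsub>D\<^esub> a"
        by (rule T_eqI[OF Dg additive_maps_comp[OF TT.rsmult_T_additive[OF a] u_lift[OF l]]
              additive_maps_comp[OF u_lift[OF l] bimodule_rsmult_additive[OF bimodule_D a]]])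
          (use t l a in \<open>simp_all add: tensor_square_simps rsmult_tens u_tens u0_r\<close>)
      then show ?thesis by (simp add: tensor_square_simps)
    qed
  qed
  have v_hom: "v l l' k \<in> bimodule_hom B A D T_BA" if l: "l < n" "l' < n" and k: "k < m" for l l' k
  proof (rule bimodule_homI)
    have qI: "q k ?I \<in> carrier End.T" using q_cl k by simp
    show "v l l' k \<in> additive_maps D T_BA"
      unfolding additive_maps_tensor_square
      by (rule additive_mapsI) (simp_all add: v_def l qI nu_closed nu_add)
    show "v l l' k (b \<odot>\<^bsub>D\<^esub> \<beta>) = b \<odot>\<^bsub>T_BA\<^esub> v l l' k \<beta>" if "b \<in> carrier B" "\<beta> \<in> carrier D" for b \<beta>
      using that by (simp add: v_def l qI nu_smult tensor_square_simps)
    \<comment> \<open>The action of \<open>a\<close> on \<beta> is \<open>act\<close> by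
      \<open>lam a\<close>. It moves to the left of \<open>q k 1\<close> by \<open>nu_act\<close>,
      to its right by \<open>comm\<close>, and out by \<open>nu_rsmult\<close>.\<close>
    show "v l l' k (\<beta> \<bullet>\<^bsub>D\<^esub> a) = v l l' k \<beta> \<bullet>\<^bsub>T_BA\<^esub> a" if "a \<in> carrier A" "\<beta> \<in> carrier D" for a \<beta>
      using that by (simp add: v_def l qI tensor_square_simps End.phi_simps comm[OF k, symmetric]
          nu_act nu_rsmult flip: act_lam)
  qed
  have v_cl: "v l l' k \<beta> \<in> carrier T" if "l < n" "l' < n" "k < m" "\<beta> \<in> carrier D" for l l' k \<beta>
    unfolding v_def using that q_cl by (intro nu_closed) simp_all
  have v_additive: "v l l' k \<in> additive_maps D T" if "l < n" "l' < n" "k < m" for l l' k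
    using left_hom_additive[of "v l l' k" B D T_BA] v_hom[OF that] by (simp add: additive_maps_tensor_square)
  \<comment> \<open>Summing over \<open>k\<close> removes the depth two maps: by
    \<open>nu_act\<close> the value \<open>p k (w l' y)\<close> moves from \<beta> onto
    \<open>q k 1\<close>, so that the decomposition of the identity of \<open>End.T\<close> applies
    to \<open>w l' y\<close>. What is left is \<open>g l\<close> after \<open>f l\<close> on
    \<open>x\<close> and \<open>V l'\<close> after \<open>U0 l'\<close> on
    \<open>1 \<otimes> y\<close>.\<close>
  have vu: "(\<Oplus>\<^bsub>T\<^esub>k\<in>{..<m}. v l l' k (u0 l l' k x y)) = g l (f l x) \<odot>\<^bsub>T\<^esub> V l' (U0 l' ?u y)"
    if l: "l < n" "l' < n" and x: "x \<in> carrier A" and y: "y \<in> carrier A" for l l' x y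
  proof -
    have W: "w l' y \<in> carrier End.T" using w_cl l y by blast
    note fx = f_closed[OF l(1) x]
    have "(\<Oplus>\<^bsub>T\<^esub>k\<in>{..<m}. v l l' k (u0 l l' k x y)) = (\<Oplus>\<^bsub>T\<^esub>k\<in>{..<m}. \<nu> l l' (f l x) (q k (p k (w l' y))))"
    proof (rule TT.T.finsum_cong')
      fix k assume "k \<in> {..<m}"
      then show "v l l' k (u0 l l' k x y) = \<nu> l l' (f l x) (q k (p k (w l' y)))"
        using l y fx W q1_l[of k "p k (w l' y)"] by (simp add: v_def u0_def nu_act pw_cl q_cl)
    qed (use l fx W in \<open>auto intro!: nu_closed q_cl p_cl\<close>)
    also have "\<dots> = \<nu> l l' (f l x) (\<Oplus>\<^bsub>End.T\<^esub>k\<in>{..<m}. q k (p k (w l' y)))"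
      by (intro additive_maps_finsum[OF End.TT.abelian_group_T Tg nu_additive[OF l fx], symmetric])
        (use W in \<open>auto simp: p_cl q_cl\<close>)
    also have "\<dots> = g l (f l x) \<odot>\<^bsub>T\<^esub> V l' (U0 l' ?u y)"
      using l y fx by (simp add: qp[OF W]) (simp add: w_def nu_tens U0_closed \<nu>0_def act_one)
    finally show ?thesis .
  qed
  \<comment> \<open>The sum over \<open>l'\<close> removes the maps of
    \<open>A \<otimes>\<^sub>B A | E\<close>; the coefficient \<open>a\<close> will be
    \<open>g l (f l x)\<close>.\<close>
  have sum_l': "(\<Oplus>\<^bsub>T\<^esub>l'\<in>{..<n}. a \<odot>\<^bsub>T\<^esub> V l' (U0 l' ?u y)) = tens a y"
    if a: "a \<in> carrier A" and y: "y \<in> carrier A" for a y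
  proof -
    have "(\<Oplus>\<^bsub>T\<^esub>l'\<in>{..<n}. a \<odot>\<^bsub>T\<^esub> V l' (U0 l' ?u y)) = a \<odot>\<^bsub>T\<^esub> (\<Oplus>\<^bsub>T\<^esub>l'\<in>{..<n}. V l' (U0 l' ?u y))"
      by (intro additive_maps_finsum[OF Tg Tg TT.smult_T_additive[OF a], symmetric])
        (use y in \<open>auto intro!: V_closed U0_closed\<close>)
    then show ?thesis by (simp add: V_U_sum a y smult_tens)
  qed
  \<comment> \<open>The index \<open>l\<close> belongs to \<open>A | D\<close> in the left factor,
    \<open>l'\<close> to the passage from the tensor square to \<open>E\<close>, and
    \<open>k\<close> to depth two. The sums collapse from the innermost outwards.\<close>
  let ?s = "\<lambda>t. \<Oplus>\<^bsub>T\<^esub>l\<in>{..<n}. \<Oplus>\<^bsub>T\<^esub>l'\<in>{..<n}. \<Oplus>\<^bsub>T\<^esub>k\<in>{..<m}. v l l' k (u l l' k t)"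
  have s_id: "?s t = t" if t: "t \<in> carrier T" for t
  proof (rule T_eqI[OF Tg _ _ _ t])
    show "?s \<in> additive_maps T T"
      by (intro additive_maps_finsum_closed[OF Tg] additive_maps_comp[OF u_lift v_additive]) simp_all
    show "(\<lambda>t. t) \<in> additive_maps T T" by (simp add: additive_maps_def)
    fix x y assume x: "x \<in> carrier A" and y: "y \<in> carrier A"
    have gfx: "g l (f l x) \<in> carrier A" if "l < n" for l
      by (rule g_closed[OF that f_closed[OF that x]])
    have 1: "(\<Oplus>\<^bsub>T\<^esub>k\<in>{..<m}. v l l' k (u l l' k (tens x y))) = g l (f l x) \<odot>\<^bsub>T\<^esub> V l' (U0 l' ?u y)"
      if "l < n" "l' < n" for l l'
      unfolding vu[OF that x y, symmetric]
      by (rule TT.T.finsum_cong') (use that x y in \<open>auto simp: u_tens intro!: v_cl u0_cl\<close>)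
    have 2: "(\<Oplus>\<^bsub>T\<^esub>l'\<in>{..<n}. \<Oplus>\<^bsub>T\<^esub>k\<in>{..<m}. v l l' k (u l l' k (tens x y))) = tens (g l (f l x)) y"
      if l: "l < n" for l
      unfolding sum_l'[OF gfx[OF l] y, symmetric]
      by (rule TT.T.finsum_cong')
        (use l y in \<open>auto simp: 1 intro!: smult_T_closed gfx V_closed U0_closed\<close>)
    have "?s (tens x y) = (\<Oplus>\<^bsub>T\<^esub>l\<in>{..<n}. tens (g l (f l x)) y)"
      by (rule TT.T.finsum_cong') (use y in \<open>auto simp: 2 intro!: tens_closed gfx\<close>)
    also have "\<dots> = tens (\<Oplus>\<^bsub>A\<^esub>l\<in>{..<n}. g l (f l x)) y"
      by (intro additive_maps_finsum[OF Ag Tg tens_additive_left[OF y], symmetric]) (auto intro: gfx)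
    finally show "?s (tens x y) = tens x y" by (simp add: gf x)
  qed
  \<comment> \<open>The identity is a triple sum of composites through \<open>D\<close>, so
    \<open>factors_finsum\<close> is used once for each index.\<close>
  have "\<exists>h. factors B A T_BA D h \<and> (\<forall>t\<in>carrier T_BA. h t =
      (\<Oplus>\<^bsub>T_BA\<^esub>l\<in>{..<n}. \<Oplus>\<^bsub>T_BA\<^esub>l'\<in>{..<n}. \<Oplus>\<^bsub>T_BA\<^esub>k\<in>{..<m}. v l l' k (u l l' k t)))"
    by (intro factors_finsum[OF bTg] factors_single[OF bTg] u_hom v_hom) simp_all
  then obtain h where h: "factors B A T_BA D h" "\<And>t. t \<in> carrier T \<Longrightarrow> h t = t"
    by (auto simp: finsum_tensor_square tensor_square_simps s_id)
  have TD: "bimodule_divides B A T_BA D"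
    by (rule bimodule_dividesI[OF bT bimodule_D h(1)]) (simp add: h(2) tensor_square_simps)
  show ?thesis
    unfolding left_D2_def bimodule_similar_def
    using bimodule_divides_trans[OF bT bimodule_D bimodule_BA TD DA] divides_tensor_square(2) by blast
qed

end

theorem theorem3p7:
  fixes A :: "('a, 'k) ring_scheme" and B :: "('b, 'l) ring_scheme" and \<phi> :: "'b \<Rightarrow> 'a"
  assumes ext: "ring_extension A B \<phi>"
    and QF: "QF_extension A B \<phi>"
    and gen: "right_generator B (ring_bimodule A \<phi> \<phi>)"
    and D2: "D2_extension (right_End B (ring_bimodule A \<phi> \<phi>)) A (left_mult A)"
  shows "D2_extension A B \<phi>"
proof -
  interpret ring_extension A B \<phi> by (rule ext)
  have rQF: "right_QF A B \<phi>" and lQF: "left_QF A B \<phi>"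
    using QF by (simp_all add: QF_extension_def)
  have "bimodule_divides B A BA D" using rQF by (simp add: right_QF_def)
  from bimodule_dividesD[OF bimodule_BA bimodule_D this]
  obtain n :: nat and f g where f: "\<And>k. k < n \<Longrightarrow> f k \<in> bimodule_hom B A BA D"
    and g: "\<And>k. k < n \<Longrightarrow> g k \<in> bimodule_hom B A D BA"
    and gf: "\<And>x. x \<in> carrier A \<Longrightarrow> (\<Oplus>\<^bsub>A\<^esub>k\<in>{..<n}. g k (f k x)) = x"
    by auto
  \<comment> \<open>The two bimodules differ only in their left scalars, which
    \<open>right_as_left\<close> forgets; so the dual basis can be taken in the dual of
    \<open>AB\<close>.\<close>
  have "right_as_left (ring_bimodule A \<phi> \<phi>) = right_as_left AB"
    by (simp add: right_as_left_def ring_bimodule_def)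
  then have "right_fg_projective B AB"
    using rQF by (simp add: right_QF_def right_fg_projective_def)
  from right_dual_basis[OF bimodule_AB this]
  obtain J and \<alpha> :: "'a \<Rightarrow> 'a \<Rightarrow> 'b" where J: "finite J" "J \<subseteq> carrier A"
    and al: "\<And>j. j \<in> J \<Longrightarrow> \<alpha> j \<in> carrier D"
    and basis: "\<And>x. x \<in> carrier A \<Longrightarrow> (\<Oplus>\<^bsub>A\<^esub>j\<in>J. j \<otimes>\<^bsub>A\<^esub> \<phi> (\<alpha> j x)) = x"
    by auto
  have E: "ring_extension E A (left_mult A)" "right_D2 E A (left_mult A)" "left_D2 E A (left_mult A)"
    using D2 by (simp_all add: D2_extension_def)
  interpret QF_endomorphism A B \<phi> n f g J \<alpha>
    by (intro QF_endomorphism.intro ext QF_endomorphism_axioms.intro E(1) f g gf J al basis)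
  show ?thesis
    unfolding D2_extension_def
    using ext right_D2_if_End_left_D2[OF E(3)]
      left_D2_if_End_right_D2[OF E(2) right_dual_divides[OF lQF]] by blast
qed

end
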